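(* Let $q\in(0,1)$, $\alpha=1$, and let $\gamma_q$ be a non-zero real number. With all notation as in the context, let $\mathcal{H}:=\big(L_2(\mathbb{D}_q,\mu_1)\,\bar\otimes\, L_2(\mathbb{S}^1)\big)\oplus\big(L_2(\mathbb{D}_q,\mu_1)\,\bar\otimes\, L_2(\mathbb{S}^1)\big)$, and define $\pi:\Gamma^{(1)}(\mathrm{SU}_q(2))\to B(\mathcal{H})$, $\pi(\phi):=\phi\oplus\phi$, as left multiplication operators. Let $\mathcal{D}=\mathcal{D}_0\otimes C^{(1)}(\mathbb{S}^1)$ and let $\hat H_1,\hat E_1,\hat F_1$ be the operators with domain $\mathcal{D}$ defined in the context. Then, for any $c\in\mathbb{R}$, the operator $$D_1:=\begin{pmatrix}\hat H_1-2 & c\hat E_1\\ c\hat F_1 & -\hat H_1-2\end{pmatrix}$$ is symmetric on $\mathcal{D}\oplus\mathcal{D}$. Furthermore, $$[D_1,\pi(\phi)]_{\hat\sigma^2}:=D_1\,\pi(\phi)-\pi(\hat\sigma^2(\phi))\,D_1$$ is bounded for all $\phi\in\Gamma^{(1)}(\mathrm{SU}_q(2))$.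
   Context: Fix $q\in(0,1)$; $\mathbb{N}=\{0,1,2,\dots\}$; $\otimes$ is the algebraic and $\bar\otimes$ the Hilbert space tensor product. On $\ell_2(\mathbb{N})$ with orthonormal basis $(e_n)_{n\in\mathbb{N}}$ let $s e_n=e_{n+1}$, $z e_n=\sqrt{1-q^{2n}}\,e_{n-1}$ (so $ze_0=0$), and $y:=\sqrt{1-z^*z}$, i.e. $y e_n=q^n e_n$. Then $zz^*-q^2z^*z=1-q^2$, $zy=qyz$, $yz^*=qz^*y$. Function algebras. For a bounded function $f$ on $\mathrm{spec}(y)=\{q^n:n\in\mathbb{N}\}\cup\{0\}$, $f(y)$ is given by functional calculus, $f(y)e_n=f(q^n)e_n$. Let $\mathcal{F}(\mathbb{D}_q)\subset B(\ell_2(\mathbb{N}))$ be the *-algebra of all $\sum_{n=0}^N s^nf_n(y)+\sum_{n=1}^M f_{-n}(y)s^{*n}$ with $N,M\in\mathbb{N}$ and bounded $f_k$. Let $\mathcal{F}_0(\mathbb{D}_q)$ be the subspace where all $f_k$ have finite support (in $\{q^n:n\in\mathbb{N}\}$). For $\beta\in\mathbb{R}$ let $\sigma^\beta$ be the automorphism of $\mathcal{F}(\mathbb{D}_q)$ with $\sigma^\beta(s)=q^{-\beta}s$, $\sigma^\beta(s^* )=q^{\beta}s^*$, $\sigma^\beta(f(y))=f(y)$; thus $g\,y^\beta=y^\beta\sigma^\beta(g)$. Put $\hat\sigma^\beta:=\sigma^\beta\otimes\mathrm{id}$ on $\mathcal{F}(\mathbb{D}_q)\otimes C(\mathbb{S}^1)$.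 Hilbert space. For $\alpha>0$ let $\int_{\mathbb{D}_q} f\,d\mu_\alpha:=(1-q)\mathrm{Tr}_{\ell_2(\mathbb{N})}(f y^\alpha)$ for $f\in\mathcal{F}(\mathbb{D}_q)$, a faithful positive functional, and let $L_2(\mathbb{D}_q,\mu_\alpha)$ be the completion of $\mathcal{F}(\mathbb{D}_q)$ for $\langle f,g\rangle:=\int_{\mathbb{D}_q}f^*g\,d\mu_\alpha$; $\mathcal{F}_0(\mathbb{D}_q)$ is dense in it. $\mathcal{F}(\mathbb{D}_q)$ acts on it by bounded left multiplication operators. Let $\mathcal{O}^+(\mathbb{D}_q)$ be the *-algebra generated by $\mathcal{F}(\mathbb{D}_q)$ and $y^{-1}$; it acts on $\mathcal{F}_0(\mathbb{D}_q)$ by left multiplication. For $x\in\mathcal{O}^+(\mathbb{D}_q)$, $x^{\mathrm{op}}$ denotes right multiplication, $x^{\mathrm{op}}f:=fx$. Left multiplication by $y^\beta$ ($\beta\in\mathbb{R}$) is regarded as a self-adjoint (in general unbounded) operator on $L_2(\mathbb{D}_q,\mu_\alpha)$; $\mathrm{dom}(y^{-2})$ is the domain of $y^{-2}$. On $L_2(\mathbb{S}^1)$ (Lebesgue measure, coordinate $t\in[-\pi,\pi]$), $e^{\pm\mathrm{i}t}$ are multiplication operators and $\frac{\partial}{\partial t}$ acts on $C^{(1)}(\mathbb{S}^1)$. Operators on one tensor factor are tacitly tensored with the identity on the other; $(f\otimes g)^*=f^*\otimes\bar g$. Derivatives. $\mathcal{F}^{(1)}(\mathbb{D}_q):=\{f\in\mathcal{F}(\mathbb{D}_q):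 y^{-2}[z^*,f]\in\mathcal{F}(\mathbb{D}_q),\ y^{-2}[z,f]\in\mathcal{F}(\mathbb{D}_q)\}$, a *-algebra, and for $f\in\mathcal{F}^{(1)}(\mathbb{D}_q)$ $$\tfrac{\partial}{\partial z}f:=\tfrac{-1}{1-q^2}y^{-2}[z^*,f],\qquad \tfrac{\partial}{\partial\bar z}f:=\tfrac{1}{1-q^2}y^{-2}[z,f].$$ Operators (with $\alpha=1$). Let $\mathcal{D}_0:=\mathcal{F}^{(1)}(\mathbb{D}_q)\cap\mathrm{dom}(y^{-2})$ and $\mathcal{D}:=\mathcal{D}_0\otimes C^{(1)}(\mathbb{S}^1)\subset L_2(\mathbb{D}_q,\mu_1)\,\bar\otimes\,L_2(\mathbb{S}^1)$, and on $\mathcal{D}$ define $$\hat H_1:=q\,z^{\mathrm{op}}\tfrac{\partial}{\partial z}-z^{*\mathrm{op}}\tfrac{\partial}{\partial\bar z}+(y^2)^{\mathrm{op}}y^{-2}\,\mathrm{i}\tfrac{\partial}{\partial t},$$ $$\hat E_1:=-q^{-1}e^{-\mathrm{i}t}\,y^{\mathrm{op}}\tfrac{\partial}{\partial\bar z}-\gamma_q\,z^{\mathrm{op}}y^{\mathrm{op}}y^{-2}e^{-\mathrm{i}t}\,\mathrm{i}\tfrac{\partial}{\partial t}-\tfrac{\gamma_q}{2}\,z^{\mathrm{op}}y^{\mathrm{op}}y^{-2}e^{-\mathrm{i}t},$$ $$\hat F_1:=q\,e^{\mathrm{i}t}\,y^{\mathrm{op}}\tfrac{\partial}{\partial z}-\gamma_q\,z^{*\mathrm{op}}y^{\mathrm{op}}y^{-2}e^{\mathrm{i}t}\,\mathrm{i}\tfrac{\partial}{\partial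 t}+\tfrac{\gamma_q}{2}\,z^{*\mathrm{op}}y^{\mathrm{op}}y^{-2}e^{\mathrm{i}t}.$$ (Here $z^{\mathrm{op}}y^{\mathrm{op}}f=fyz$ and $z^{*\mathrm{op}}y^{\mathrm{op}}f=fyz^*$.) Differentiable functions. The operators $\hat H_1,\hat E_1,\hat F_1$ also act on $\phi\in\mathcal{F}^{(1)}(\mathbb{D}_q)\otimes C^{(1)}(\mathbb{S}^1)$ by the same formulas, the opposite elements multiplying the (differentiated) function itself from the right: $$\hat H_1(\phi)=q\,(\tfrac{\partial}{\partial z}\phi)\,z-(\tfrac{\partial}{\partial\bar z}\phi)\,z^*+\mathrm{i}\,y^{-2}(\tfrac{\partial}{\partial t}\phi)\,y^2,$$ $$\hat E_1(\phi)=-q^{-1}e^{-\mathrm{i}t}\,(\tfrac{\partial}{\partial\bar z}\phi)\,y-\gamma_q\,e^{-\mathrm{i}t}\,y^{-2}(\mathrm{i}\tfrac{\partial}{\partial t}\phi)\,yz-\tfrac{\gamma_q}{2}\,e^{-\mathrm{i}t}\,y^{-2}\phi\,yz,$$ $$\hat F_1(\phi)=q\,e^{\mathrm{i}t}\,(\tfrac{\partial}{\partial z}\phi)\,y-\gamma_q\,e^{\mathrm{i}t}\,y^{-2}(\mathrm{i}\tfrac{\partial}{\partial t}\phi)\,yz^*+\tfrac{\gamma_q}{2}\,e^{\mathrm{i}t}\,y^{-2}\phi\,yz^*.$$ These are elements of $\mathcal{O}^+(\mathbb{D}_q)\otimes C(\mathbb{S}^1)$, understood as (a priori unbounded) left multiplication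 operators on $L_2(\mathbb{D}_q,\mu_1)\,\bar\otimes\,L_2(\mathbb{S}^1)$ with domain containing $\mathcal{F}_0(\mathbb{D}_q)\otimes C^{(1)}(\mathbb{S}^1)$. Then $$\Gamma^{(1)}(\mathrm{SU}_q(2)):=\{\phi\in\mathcal{F}^{(1)}(\mathbb{D}_q)\otimes C^{(1)}(\mathbb{S}^1):\hat H_1(\phi),\hat E_1(\phi),\hat F_1(\phi),\hat H_1(\phi^* ),\hat E_1(\phi^* ),\hat F_1(\phi^* )\text{ are bounded}\}.$$ *)

theory Defs
  imports "HOL-Analysis.Analysis" "HOL-Library.Function_Algebras"
begin

text \<open>
  An operator \<open>T\<close> on \<open>\<ell>\<^sub>2(\<nat>)\<close> is represented by its matrix \<open>T m n = \<langle>e\<^sub>m, T e\<^sub>n\<rangle>\<close>. The same type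
  carries the elements of the completion \<open>L\<^sub>2(\<D>\<^sub>q, \<mu>\<^sub>\<alpha>)\<close> and the unbounded elements \<open>y\<^sup>\<beta>\<close>.
  In every product formed below at least one factor has finitely many nonzero diagonals (so
  that each entry is a finite sum), with the single exception of the inner product of
  \<open>L\<^sub>2(\<D>\<^sub>q, \<mu>\<^sub>\<alpha>)\<close>, where the diagonal entries of \<open>f\<^sup>* g\<close> converge absolutely.
\<close>

type_synonym mat = "nat \<Rightarrow> nat \<Rightarrow> complex"

definition mmul :: "mat \<Rightarrow> mat \<Rightarrow> mat" (infixl "\<odot>" 70) where
  "A \<odot> B = (\<lambda>m n. \<Sum>\<^sub>\<infinity>k. A m k * B k n)"

definition msc :: "complex \<Rightarrow> mat \<Rightarrow> mat" (infixr "\<cdot>" 75) where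
  "c \<cdot> A = (\<lambda>m n. c * A m n)"

definition madj :: "mat \<Rightarrow> mat" where
  "madj A = (\<lambda>m n. cnj (A n m))"

definition mdiag :: "(nat \<Rightarrow> complex) \<Rightarrow> mat" where
  "mdiag d = (\<lambda>m n. if m = n then d n else 0)"

definition mone :: mat where
  "mone = mdiag (\<lambda>_. 1)"

definition mpow :: "mat \<Rightarrow> nat \<Rightarrow> mat" where
  "mpow A n = (((\<odot>) A) ^^ n) mone"

definition mtrace :: "mat \<Rightarrow> complex" where
  "mtrace A = (\<Sum>\<^sub>\<infinity>n. A n n)"

definition mcomm :: "mat \<Rightarrow> mat \<Rightarrow> mat" where
  "mcomm A B = A \<odot> B - B \<odot> A"


subsection \<open>The quantum disc\<close>

definition sop :: mat where
  "sop = (\<lambda>m n. if m = Suc n then 1 else 0)"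

definition zop :: "real \<Rightarrow> mat" where
  "zop q = (\<lambda>m n. if n = Suc m then complex_of_real (sqrt (1 - q ^ (2 * n))) else 0)"

definition zstar :: "real \<Rightarrow> mat" where
  "zstar q = madj (zop q)"

definition spec_y :: "real \<Rightarrow> real set" where
  "spec_y q = range (\<lambda>n. q ^ n) \<union> {0}"

text \<open>Functional calculus: \<open>fy q f\<close> is \<open>f(y)\<close>, that is \<open>f(y) e\<^sub>n = f(q\<^sup>n) e\<^sub>n\<close>.\<close>

definition fy :: "real \<Rightarrow> (real \<Rightarrow> complex) \<Rightarrow> mat" where
  "fy q f = mdiag (\<lambda>n. f (q ^ n))"

definition yop :: "real \<Rightarrow> mat" where
  "yop q = fy q complex_of_real"

definition ypow :: "real \<Rightarrow> real \<Rightarrow> mat" where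
  "ypow q \<beta> = fy q (\<lambda>x. complex_of_real (x powr \<beta>))"

definition band :: "real \<Rightarrow> nat \<Rightarrow> nat \<Rightarrow> (int \<Rightarrow> real \<Rightarrow> complex) \<Rightarrow> mat" where
  "band q N M f = (\<Sum>n=0..N. mpow sop n \<odot> fy q (f (int n)))
                + (\<Sum>n=1..M. fy q (f (- int n)) \<odot> mpow (madj sop) n)"

definition FD :: "real \<Rightarrow> mat set" where
  "FD q = {band q N M f | N M f. \<forall>k. bounded (f k ` spec_y q)}"

definition FD0 :: "real \<Rightarrow> mat set" where
  "FD0 q = {band q N M f | N M f.
     \<forall>k. finite {x \<in> spec_y q. f k x \<noteq> 0} \<and> {x \<in> spec_y q. f k x \<noteq> 0} \<subseteq> range (\<lambda>n. q ^ n)}"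

text \<open>
  The automorphism \<open>\<sigma>\<^sup>\<beta>\<close> multiplies the diagonal \<open>m - n = k\<close> by \<open>q\<^bsup>-\<beta>k\<^esup>\<close>. The lemmas
  \<open>sig_sop\<close>, \<open>sig_sop_star\<close>, \<open>sig_fy\<close> and \<open>sig_ypow\<close> below recover its defining properties.
\<close>

definition sig :: "real \<Rightarrow> real \<Rightarrow> mat \<Rightarrow> mat" where
  "sig q \<beta> A = (\<lambda>m n. complex_of_real (q powr (- \<beta> * (real m - real n))) * A m n)"

definition F1D :: "real \<Rightarrow> mat set" where
  "F1D q = {f \<in> FD q. ypow q (-2) \<odot> mcomm (zstar q) f \<in> FD q
                     \<and> ypow q (-2) \<odot> mcomm (zop q) f \<in> FD q}"

definition dz :: "real \<Rightarrow> mat \<Rightarrow> mat" where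
  "dz q f = complex_of_real (- 1 / (1 - q\<^sup>2)) \<cdot> (ypow q (-2) \<odot> mcomm (zstar q) f)"

definition dzbar :: "real \<Rightarrow> mat \<Rightarrow> mat" where
  "dzbar q f = complex_of_real (1 / (1 - q\<^sup>2)) \<cdot> (ypow q (-2) \<odot> mcomm (zop q) f)"

definition mu_int :: "real \<Rightarrow> real \<Rightarrow> mat \<Rightarrow> complex" where
  "mu_int q \<alpha> f = complex_of_real (1 - q) * mtrace (f \<odot> ypow q \<alpha>)"

definition l2inner :: "real \<Rightarrow> real \<Rightarrow> mat \<Rightarrow> mat \<Rightarrow> complex" where
  "l2inner q \<alpha> f g = mu_int q \<alpha> (madj f \<odot> g)"

definition l2norm :: "real \<Rightarrow> real \<Rightarrow> mat \<Rightarrow> real" where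
  "l2norm q \<alpha> f = sqrt (Re (l2inner q \<alpha> f f))"

text \<open>
  The completion \<open>L\<^sub>2(\<D>\<^sub>q, \<mu>\<^sub>\<alpha>)\<close>. Since
  \<open>\<langle>f, f\<rangle> = (1 - q) (\<Sum>n. q\<^bsup>\<alpha>n\<^esup> (\<Sum>m. \<bar>f m n\<bar>\<^sup>2))\<close>, it is the weighted \<open>\<ell>\<^sub>2\<close>-space of all matrices for
  which this double series converges; it contains the finitely supported matrices
  \<open>\<F>\<^sub>0(\<D>\<^sub>q)\<close> as a dense subspace.
\<close>

definition L2D :: "real \<Rightarrow> real \<Rightarrow> mat set" where
  "L2D q \<alpha> = {\<xi>. (\<lambda>(m, n). q powr (\<alpha> * real n) * (cmod (\<xi> m n))\<^sup>2) summable_on UNIV}"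

text \<open>Domain of the self-adjoint operator of left multiplication by \<open>y\<^sup>\<beta>\<close>.\<close>

definition dom_ypow :: "real \<Rightarrow> real \<Rightarrow> real \<Rightarrow> mat set" where
  "dom_ypow q \<alpha> \<beta> = {\<xi> \<in> L2D q \<alpha>. ypow q \<beta> \<odot> \<xi> \<in> L2D q \<alpha>}"


subsection \<open>Tensor products with functions on the circle\<close>

text \<open>
  Functions on \<open>\<S>\<^sup>1\<close> are \<open>2\<pi>\<close>-periodic functions of the coordinate \<open>t\<close>, and \<open>\<Sum>\<^sub>j f\<^sub>j \<otimes> g\<^sub>j\<close> is
  represented by the matrix-valued function \<open>t \<mapsto> \<Sum>\<^sub>j g\<^sub>j(t) f\<^sub>j\<close> (a faithful representation of the
  algebraic tensor product).
\<close>

type_synonym matfun = "real \<Rightarrow> mat"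

definition C1S :: "(real \<Rightarrow> complex) set" where
  "C1S = {g. (\<forall>t. g (t + 2 * pi) = g t) \<and> g C1_differentiable_on UNIV}"

definition tensor :: "mat set \<Rightarrow> (real \<Rightarrow> complex) set \<Rightarrow> matfun set" where
  "tensor A B = {(\<lambda>t m n. \<Sum>j<N. f j m n * g j t) | (N :: nat) f g.
                   (\<forall>j<N. f j \<in> A) \<and> (\<forall>j<N. g j \<in> B)}"

definition fadj :: "matfun \<Rightarrow> matfun" where
  "fadj \<phi> = (\<lambda>t. madj (\<phi> t))"

definition lmul :: "matfun \<Rightarrow> matfun \<Rightarrow> matfun" where
  "lmul \<phi> \<psi> = (\<lambda>t. \<phi> t \<odot> \<psi> t)"

definition sighat :: "real \<Rightarrow> real \<Rightarrow> matfun \<Rightarrow> matfun" where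
  "sighat q \<beta> \<phi> = (\<lambda>t. sig q \<beta> (\<phi> t))"

definition ddt :: "matfun \<Rightarrow> matfun" where
  "ddt \<phi> = (\<lambda>t m n. vector_derivative (\<lambda>\<tau>. \<phi> \<tau> m n) (at t))"

text \<open>
  \<open>L\<^sub>2(\<D>\<^sub>q, \<mu>\<^sub>\<alpha>)\<close> tensored with \<open>L\<^sub>2(\<S>\<^sup>1)\<close> as a Hilbert space, realised as the space of
  square-integrable functions on the circle with values in \<open>L\<^sub>2(\<D>\<^sub>q, \<mu>\<^sub>\<alpha>)\<close>. Elements
  are functions, not classes modulo null sets, so that \<open>hinner\<close> is only semi-definite on them.
\<close>

definition circle :: "real measure" where
  "circle = lebesgue_on {- pi..pi}"

definition Hsp :: "real \<Rightarrow> real \<Rightarrow> matfun set" where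
  "Hsp q \<alpha> = {\<psi>. (\<forall>m n. (\<lambda>t. \<psi> t m n) \<in> borel_measurable circle)
                 \<and> (AE t in circle. \<psi> t \<in> L2D q \<alpha>)
                 \<and> integrable circle (\<lambda>t. (l2norm q \<alpha> (\<psi> t))\<^sup>2)}"

definition hinner :: "real \<Rightarrow> real \<Rightarrow> matfun \<Rightarrow> matfun \<Rightarrow> complex" where
  "hinner q \<alpha> \<psi> \<eta> = (LINT t|circle. l2inner q \<alpha> (\<psi> t) (\<eta> t))"

definition hinner2 :: "real \<Rightarrow> real \<Rightarrow> matfun \<times> matfun \<Rightarrow> matfun \<times> matfun \<Rightarrow> complex" where
  "hinner2 q \<alpha> \<Psi> X = hinner q \<alpha> (fst \<Psi>) (fst X) + hinner q \<alpha> (snd \<Psi>) (snd X)"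


subsection \<open>Bounded and symmetric operators\<close>

text \<open>
  Here \<open>H\<close> is the carrier of a Hilbert space with inner product \<open>ip\<close>, and \<open>S\<close> the domain of \<open>T\<close>.
\<close>

definition ipnorm :: "('a \<Rightarrow> 'a \<Rightarrow> complex) \<Rightarrow> 'a \<Rightarrow> real" where
  "ipnorm ip x = sqrt (Re (ip x x))"

definition bounded_op :: "('a \<Rightarrow> 'a \<Rightarrow> complex) \<Rightarrow> 'a set \<Rightarrow> 'a set \<Rightarrow> ('a \<Rightarrow> 'a) \<Rightarrow> bool" where
  "bounded_op ip H S T \<longleftrightarrow> S \<subseteq> H \<and> T ` S \<subseteq> H
     \<and> (\<exists>C. \<forall>x\<in>S. ipnorm ip (T x) \<le> C * ipnorm ip x)"

definition dense_in :: "('a :: minus \<Rightarrow> 'a \<Rightarrow> complex) \<Rightarrow> 'a set \<Rightarrow> 'a set \<Rightarrow> bool" where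
  "dense_in ip H S \<longleftrightarrow> S \<subseteq> H \<and> (\<forall>x\<in>H. \<forall>e>0. \<exists>y\<in>S. ipnorm ip (x - y) < e)"

definition symmetric_op ::
  "('a :: minus \<Rightarrow> 'a \<Rightarrow> complex) \<Rightarrow> 'a set \<Rightarrow> 'a set \<Rightarrow> ('a \<Rightarrow> 'a) \<Rightarrow> bool" where
  "symmetric_op ip H S T \<longleftrightarrow> dense_in ip H S \<and> T ` S \<subseteq> H
     \<and> (\<forall>x\<in>S. \<forall>y\<in>S. ip (T x) y = ip x (T y))"


subsection \<open>The operators for \<open>\<alpha> = 1\<close>\<close>

text \<open>
  The same formulas give the operators on the domain \<open>\<D>\<close> and their action on
  differentiable functions, the opposite elements being right multiplications in both cases.
\<close>

definition Hop :: "real \<Rightarrow> matfun \<Rightarrow> matfun" where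
  "Hop q \<phi> = (\<lambda>t. complex_of_real q \<cdot> (dz q (\<phi> t) \<odot> zop q)
                 - dzbar q (\<phi> t) \<odot> zstar q
                 + \<i> \<cdot> (ypow q (-2) \<odot> ddt \<phi> t \<odot> ypow q 2))"

definition Eop :: "real \<Rightarrow> real \<Rightarrow> matfun \<Rightarrow> matfun" where
  "Eop q \<gamma> \<phi> = (\<lambda>t.
     (- complex_of_real (1 / q) * exp (- \<i> * t)) \<cdot> (dzbar q (\<phi> t) \<odot> yop q)
     - (complex_of_real \<gamma> * exp (- \<i> * t)) \<cdot> (ypow q (-2) \<odot> (\<i> \<cdot> ddt \<phi> t) \<odot> yop q \<odot> zop q)
     - (complex_of_real (\<gamma> / 2) * exp (- \<i> * t)) \<cdot> (ypow q (-2) \<odot> \<phi> t \<odot> yop q \<odot> zop q))"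

definition Fop :: "real \<Rightarrow> real \<Rightarrow> matfun \<Rightarrow> matfun" where
  "Fop q \<gamma> \<phi> = (\<lambda>t.
     (complex_of_real q * exp (\<i> * t)) \<cdot> (dz q (\<phi> t) \<odot> yop q)
     - (complex_of_real \<gamma> * exp (\<i> * t)) \<cdot> (ypow q (-2) \<odot> (\<i> \<cdot> ddt \<phi> t) \<odot> yop q \<odot> zstar q)
     + (complex_of_real (\<gamma> / 2) * exp (\<i> * t)) \<cdot> (ypow q (-2) \<odot> \<phi> t \<odot> yop q \<odot> zstar q))"

definition D0 :: "real \<Rightarrow> mat set" where
  "D0 q = F1D q \<inter> dom_ypow q 1 (-2)"

definition Dom :: "real \<Rightarrow> matfun set" where
  "Dom q = tensor (D0 q) C1S"

text \<open>
  A matrix-valued function is bounded as a left multiplication operator on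
  \<open>L\<^sub>2(\<D>\<^sub>q, \<mu>\<^sub>1)\<close> tensor \<open>L\<^sub>2(\<S>\<^sup>1)\<close>; the operator is tested on the dense domain
  \<open>\<F>\<^sub>0(\<D>\<^sub>q) \<otimes> C\<^sup>1(\<S>\<^sup>1)\<close>.
\<close>

definition lmul_bounded :: "real \<Rightarrow> matfun \<Rightarrow> bool" where
  "lmul_bounded q X \<longleftrightarrow> bounded_op (hinner q 1) (Hsp q 1) (tensor (FD0 q) C1S) (lmul X)"

definition Gamma1 :: "real \<Rightarrow> real \<Rightarrow> matfun set" where
  "Gamma1 q \<gamma> = {\<phi> \<in> tensor (F1D q) C1S.
     lmul_bounded q (Hop q \<phi>) \<and> lmul_bounded q (Eop q \<gamma> \<phi>) \<and> lmul_bounded q (Fop q \<gamma> \<phi>) \<and>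
     lmul_bounded q (Hop q (fadj \<phi>)) \<and> lmul_bounded q (Eop q \<gamma> (fadj \<phi>)) \<and>
     lmul_bounded q (Fop q \<gamma> (fadj \<phi>))}"

definition pi_rep :: "matfun \<Rightarrow> matfun \<times> matfun \<Rightarrow> matfun \<times> matfun" where
  "pi_rep \<phi> = (\<lambda>(\<psi>1, \<psi>2). (lmul \<phi> \<psi>1, lmul \<phi> \<psi>2))"

definition D1 :: "real \<Rightarrow> real \<Rightarrow> real \<Rightarrow> matfun \<times> matfun \<Rightarrow> matfun \<times> matfun" where
  "D1 q \<gamma> c = (\<lambda>(\<psi>1, \<psi>2).
     (\<lambda>t. (Hop q \<psi>1 t - 2 \<cdot> \<psi>1 t) + complex_of_real c \<cdot> Eop q \<gamma> \<psi>2 t,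
      \<lambda>t. complex_of_real c \<cdot> Fop q \<gamma> \<psi>1 t + (- Hop q \<psi>2 t - 2 \<cdot> \<psi>2 t)))"

definition twisted_comm ::
  "real \<Rightarrow> real \<Rightarrow> real \<Rightarrow> matfun \<Rightarrow> matfun \<times> matfun \<Rightarrow> matfun \<times> matfun" where
  "twisted_comm q \<gamma> c \<phi> \<Psi> = D1 q \<gamma> c (pi_rep \<phi> \<Psi>) - pi_rep (sighat q 2 \<phi>) (D1 q \<gamma> c \<Psi>)"


subsection \<open>Consistency of the conventions\<close>

lemma mmul_mdiag_left: "mdiag d \<odot> A = (\<lambda>m n. d m * A m n)"
proof (intro ext)
  fix m n
  have "(mdiag d \<odot> A) m n = (\<Sum>\<^sub>\<infinity>k\<in>{m}. d m * A m n)"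
    unfolding mmul_def by (rule infsum_cong_neutral) (auto simp: mdiag_def)
  then show "(mdiag d \<odot> A) m n = d m * A m n" by simp
qed

lemma mmul_mdiag_right: "A \<odot> mdiag d = (\<lambda>m n. A m n * d n)"
proof (intro ext)
  fix m n
  have "(A \<odot> mdiag d) m n = (\<Sum>\<^sub>\<infinity>k\<in>{n}. A m n * d n)"
    unfolding mmul_def by (rule infsum_cong_neutral) (auto simp: mdiag_def)
  then show "(A \<odot> mdiag d) m n = A m n * d n" by simp
qed

lemma zstar_zop: "zstar q \<odot> zop q = mdiag (\<lambda>n. (complex_of_real (sqrt (1 - q ^ (2 * n))))\<^sup>2)"
proof (intro ext)
  fix m n :: nat
  have "(zstar q \<odot> zop q) m n
      = (\<Sum>\<^sub>\<infinity>k\<in>{m - 1}. mdiag (\<lambda>n. (complex_of_real (sqrt (1 - q ^ (2 * n))))\<^sup>2) m n)"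
    unfolding mmul_def
    by (rule infsum_cong_neutral; cases m)
       (auto simp: mdiag_def zstar_def madj_def zop_def power2_eq_square)
  then show "(zstar q \<odot> zop q) m n
      = mdiag (\<lambda>n. (complex_of_real (sqrt (1 - q ^ (2 * n))))\<^sup>2) m n" by simp
qed

lemma yop_square:
  assumes "0 < q" "q < 1"
  shows "yop q \<odot> yop q = mone - zstar q \<odot> zop q"
proof -
  have "q ^ (2 * n) \<le> 1" for n using assms by (simp add: power_le_one)
  then show ?thesis
    unfolding zstar_zop yop_def fy_def mmul_mdiag_left mone_def
    by (auto simp: mdiag_def fun_eq_iff power_mult power2_eq_square power_mult_distrib
             simp flip: of_real_mult of_real_power)
qed

lemma sig_sop: "0 < q \<Longrightarrow> sig q \<beta> sop = complex_of_real (q powr (- \<beta>)) \<cdot> sop"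
  by (auto simp: sig_def sop_def msc_def fun_eq_iff)

lemma sig_sop_star: "0 < q \<Longrightarrow> sig q \<beta> (madj sop) = complex_of_real (q powr \<beta>) \<cdot> madj sop"
  by (auto simp: sig_def sop_def madj_def msc_def fun_eq_iff)

lemma sig_fy: "0 < q \<Longrightarrow> sig q \<beta> (fy q f) = fy q f"
  by (auto simp: sig_def fy_def mdiag_def fun_eq_iff)

lemma sig_ypow: "0 < q \<Longrightarrow> A \<odot> ypow q \<beta> = ypow q \<beta> \<odot> sig q \<beta> A"
  by (auto simp: sig_def ypow_def fy_def mmul_mdiag_left mmul_mdiag_right fun_eq_iff
        powr_power powr_realpow[symmetric] powr_powr powr_add[symmetric] algebra_simps
        simp flip: of_real_mult)

lemma sig_mmul:
  assumes "0 < q"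
  shows "sig q \<beta> (A \<odot> B) = sig q \<beta> A \<odot> sig q \<beta> B"
proof (intro ext)
  fix m n
  let ?w = "\<lambda>m n :: nat. complex_of_real (q powr (- \<beta> * (real m - real n)))"
  have w: "?w m n = ?w m k * ?w k n" for k
    by (simp add: algebra_simps flip: of_real_mult powr_add)
  have "sig q \<beta> (A \<odot> B) m n = (\<Sum>\<^sub>\<infinity>k. ?w m n * (A m k * B k n))"
    unfolding sig_def mmul_def by (rule infsum_cmult_right'[symmetric])
  also have "\<dots> = (\<Sum>\<^sub>\<infinity>k. (?w m k * A m k) * (?w k n * B k n))"
  proof (rule infsum_cong)
    fix k
    show "?w m n * (A m k * B k n) = (?w m k * A m k) * (?w k n * B k n)"
      unfolding w[of k] by (simp only: mult_ac)
  qed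
  finally show "sig q \<beta> (A \<odot> B) m n = (sig q \<beta> A \<odot> sig q \<beta> B) m n"
    by (simp add: sig_def mmul_def)
qed

lemma l2inner_eq:
  "l2inner q \<alpha> f g =
     complex_of_real (1 - q) * (\<Sum>\<^sub>\<infinity>n. (\<Sum>\<^sub>\<infinity>m. cnj (f m n) * g m n) * complex_of_real ((q ^ n) powr \<alpha>))"
  by (simp add: l2inner_def mu_int_def mtrace_def ypow_def fy_def mmul_mdiag_right)
     (simp add: mmul_def madj_def)

lemma hinner_elementary_tensors:
  "hinner q \<alpha> (\<lambda>t m n. f m n * g t) (\<lambda>t m n. f' m n * g' t)
     = l2inner q \<alpha> f f' * (LINT t|circle. cnj (g t) * g' t)"
proof -
  have *: "l2inner q \<alpha> (\<lambda>m n. f m n * a) (\<lambda>m n. f' m n * b) = l2inner q \<alpha> f f' * (cnj a * b)"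
    for a b
  proof -
    have "(\<Sum>\<^sub>\<infinity>m. cnj (f m n * a) * (f' m n * b)) = (\<Sum>\<^sub>\<infinity>m. cnj (f m n) * f' m n) * (cnj a * b)" for n
      by (subst infsum_cmult_left'[symmetric]) (simp add: mult_ac)
    then have "(\<Sum>\<^sub>\<infinity>n. (\<Sum>\<^sub>\<infinity>m. cnj (f m n * a) * (f' m n * b)) * complex_of_real ((q ^ n) powr \<alpha>))
        = (\<Sum>\<^sub>\<infinity>n. ((\<Sum>\<^sub>\<infinity>m. cnj (f m n) * f' m n) * complex_of_real ((q ^ n) powr \<alpha>)) * (cnj a * b))"
      by (simp only: mult_ac)
    also have "\<dots> = (\<Sum>\<^sub>\<infinity>n. (\<Sum>\<^sub>\<infinity>m. cnj (f m n) * f' m n) * complex_of_real ((q ^ n) powr \<alpha>)) * (cnj a * b)"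
      by (rule infsum_cmult_left')
    finally show ?thesis unfolding l2inner_eq by (simp only: mult.assoc)
  qed
  show ?thesis unfolding hinner_def * by simp
qed

end

theory Submission
  imports Defs
begin

text \<open>
  Elements of \<open>\<F>(\<D>\<^sub>q)\<close> are exactly the uniformly bounded matrices with finitely many diagonals, and
  such matrices act boundedly from either side on the weighted \<open>\<ell>\<^sub>2\<close>-space of matrices.

  Symmetry is checked pointwise in \<open>t\<close>. On \<open>dom(y\<^bsup>-2\<^esup>)\<close> every product occurring in the operators is
  separately square integrable, so the commutators may be split, and the adjoint relations between the
  resulting terms are shifts of summation indices. What remains is the \<open>t\<close>-derivative of a periodic
  function, whose integral vanishes.

  By the twisted Leibniz rule the twisted commutator is a sum of bounded operators and of operators
  \<open>\<psi> \<mapsto> y\<^bsup>-2\<^esup> (\<partial>\<^sub>t \<phi>) \<psi> r\<close> with \<open>r\<close> bounded. Boundedness of \<open>E(\<phi>)\<close> and \<open>F(\<phi>)\<close> makes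
  \<open>\<i> \<partial>\<^sub>t \<phi> + \<phi>/2\<close> and \<open>\<i> \<partial>\<^sub>t \<phi> - \<phi>/2\<close>, hence \<open>\<partial>\<^sub>t \<phi>\<close>, tend to zero along every diagonal, for
  almost all \<open>t\<close>. Since \<open>y\<^bsup>-2\<^esup> [z\<^sup>*, \<cdot>]\<close> is bounded on the coefficients of \<open>\<phi>\<close>, consecutive diagonal
  entries differ by \<open>O(q\<^bsup>2m\<^esup>)\<close>. Summing these differences, \<open>\<partial>\<^sub>t \<phi>\<close> is itself \<open>O(q\<^bsup>2m\<^esup>)\<close>, so
  \<open>y\<^bsup>-2\<^esup> \<partial>\<^sub>t \<phi>\<close> is bounded.
\<close>

subsection \<open>Banded matrices\<close>

text \<open>The twist has a single source, \<open>ypow_sig\<close>: moving \<open>y^(-2)\<close>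
  past A turns A into \<open>sig q 2 A\<close>. A commutator is a derivation, but its prefactor
  \<open>y^(-2)\<close> must cross the left factor of a product, whereas the opposite elements
  multiply from the right and never meet that factor. The obstacle is the angular term. For \<phi> =
  1 \<otimes> g both radial derivatives vanish while \<open>y^(-2)\<close> times the angular
  derivative is unbounded, so the decay has to come from E(\<phi>) and F(\<phi>). There the right
  factor y cancels one of the two powers in \<open>y^(-2)\<close>: after division by \<gamma> they
  give decay of order q^m, and only in mean square over t. This is one power short, yet it
  identifies the limit along each diagonal as zero; the radial differences supply the rest. On the
  symmetric side, the powers of q in the coefficients are those that index shifts produce: q for a
  column shift under the weight q^n, q^2 for a row shift under \<open>y^(-2)\<close>. The terms with
  \<gamma>/2 compensate the derivative of e^(it).\<close>

definition banded :: "nat \<Rightarrow> mat \<Rightarrow> bool" where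
  "banded K A \<longleftrightarrow> (\<forall>m n. m + K < n \<or> n + K < m \<longrightarrow> A m n = 0)"

definition bdd_mat :: "real \<Rightarrow> mat \<Rightarrow> bool" where
  "bdd_mat C A \<longleftrightarrow> (\<forall>m n. cmod (A m n) \<le> C)"

lemma bandedD: "banded K A \<Longrightarrow> m + K < n \<or> n + K < m \<Longrightarrow> A m n = 0"
  by (auto simp: banded_def)

lemma bdd_mat_nonneg: "bdd_mat C A \<Longrightarrow> 0 \<le> C"
  unfolding bdd_mat_def by (meson norm_ge_zero order_trans)

text \<open>One banded factor makes every entry a finite sum over a fixed window. The other factor
  is arbitrary, so the rule also covers L2 matrices, which need not be banded.\<close>

lemma mmul_banded_left:
  assumes "banded K A"
  shows "(A \<odot> B) m n = (\<Sum>k\<in>{m-K..m+K}. A m k * B k n)"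
proof -
  have "(A \<odot> B) m n = (\<Sum>\<^sub>\<infinity>k\<in>{m-K..m+K}. A m k * B k n)"
    unfolding mmul_def using assms
    by (intro infsum_cong_neutral) (auto simp: banded_def)
  then show ?thesis by simp
qed

lemma mmul_banded_right:
  assumes "banded K B"
  shows "(A \<odot> B) m n = (\<Sum>k\<in>{n-K..n+K}. A m k * B k n)"
proof -
  have "(A \<odot> B) m n = (\<Sum>\<^sub>\<infinity>k\<in>{n-K..n+K}. A m k * B k n)"
    unfolding mmul_def using assms
    by (intro infsum_cong_neutral) (auto simp: banded_def)
  then show ?thesis by simp
qed

text \<open>With both outer factors banded the two sums are finite and may be swapped, whatever the
  middle factor is. In this form left and right multiplications on an L2 matrix commute.\<close>

lemma mmul_assoc:
  assumes "banded K A" "banded L C"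
  shows "(A \<odot> B) \<odot> C = A \<odot> (B \<odot> C)"
proof (intro ext)
  fix m n
  have "((A \<odot> B) \<odot> C) m n = (\<Sum>k\<in>{n-L..n+L}. \<Sum>j\<in>{m-K..m+K}. A m j * B j k * C k n)"
    by (simp add: mmul_banded_right[OF assms(2)] mmul_banded_left[OF assms(1)] sum_distrib_right)
  also have "\<dots> = (\<Sum>j\<in>{m-K..m+K}. \<Sum>k\<in>{n-L..n+L}. A m j * B j k * C k n)"
    by (rule sum.swap)
  also have "\<dots> = (A \<odot> (B \<odot> C)) m n"
    by (simp add: mmul_banded_right[OF assms(2)] mmul_banded_left[OF assms(1)] sum_distrib_left mult.assoc)
  finally show "((A \<odot> B) \<odot> C) m n = (A \<odot> (B \<odot> C)) m n" .
qed

lemma mmul_add_right: "banded K A \<Longrightarrow> A \<odot> (B + C) = A \<odot> B + A \<odot> C"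
  by (auto simp: fun_eq_iff mmul_banded_left distrib_left sum.distrib)

lemma mmul_diff_right: "banded K A \<Longrightarrow> A \<odot> (B - C) = A \<odot> B - A \<odot> C"
  by (auto simp: fun_eq_iff mmul_banded_left right_diff_distrib sum_subtractf)

lemma mmul_add_left: "banded K C \<Longrightarrow> (A + B) \<odot> C = A \<odot> C + B \<odot> C"
  by (auto simp: fun_eq_iff mmul_banded_right distrib_right sum.distrib)

lemma mmul_diff_left: "banded K C \<Longrightarrow> (A - B) \<odot> C = A \<odot> C - B \<odot> C"
  by (auto simp: fun_eq_iff mmul_banded_right left_diff_distrib sum_subtractf)

lemma mmul_msc_left: "(c \<cdot> A) \<odot> B = c \<cdot> (A \<odot> B)"
  by (auto simp: fun_eq_iff mmul_def msc_def mult.assoc infsum_cmult_right')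

lemma mmul_msc_right: "A \<odot> (c \<cdot> B) = c \<cdot> (A \<odot> B)"
  by (auto simp: fun_eq_iff mmul_def msc_def mult.left_commute infsum_cmult_right')

lemma mmul_sum_left:
  "banded K C \<Longrightarrow> (\<lambda>m n. \<Sum>j\<in>J. f j m n * g j) \<odot> C = (\<lambda>m n. \<Sum>j\<in>J. (f j \<odot> C) m n * g j)"
  by (auto simp: fun_eq_iff mmul_banded_right sum_distrib_right sum_distrib_left mult_ac intro: sum.swap)

lemma mmul_sum_right:
  "banded K C \<Longrightarrow> C \<odot> (\<lambda>m n. \<Sum>j\<in>J. f j m n * g j) = (\<lambda>m n. \<Sum>j\<in>J. (C \<odot> f j) m n * g j)"
  by (auto simp: fun_eq_iff mmul_banded_left sum_distrib_right sum_distrib_left mult_ac intro: sum.swap)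

lemma banded_add: "banded K A \<Longrightarrow> banded L B \<Longrightarrow> banded (max K L) (A + B)"
  by (auto simp: banded_def)

lemma banded_diff: "banded K A \<Longrightarrow> banded L B \<Longrightarrow> banded (max K L) (A - B)"
  by (auto simp: banded_def)

lemma banded_msc: "banded K A \<Longrightarrow> banded K (c \<cdot> A)"
  by (auto simp: banded_def msc_def)

lemma banded_sig: "banded K A \<Longrightarrow> banded K (sig q \<beta> A)"
  by (auto simp: banded_def sig_def)

lemma banded_mdiag: "banded 0 (mdiag d)"
  by (auto simp: banded_def mdiag_def)

lemma banded_mmul:
  assumes "banded K A" "banded L B"
  shows "banded (K + L) (A \<odot> B)"
  unfolding banded_def mmul_banded_left[OF assms(1)]
proof (intro allI impI sum.neutral ballI)
  fix m n k assume "m + (K + L) < n \<or> n + (K + L) < m" "k \<in> {m - K..m + K}"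
  then have "k + L < n \<or> n + L < k" by auto
  then show "A m k * B k n = 0" using assms(2) by (simp add: bandedD)
qed

lemma bdd_mat_mmul:
  assumes "banded K A" "bdd_mat C A" "bdd_mat D B"
  shows "bdd_mat (real (2 * K + 1) * (C * D)) (A \<odot> B)"
  unfolding bdd_mat_def mmul_banded_left[OF assms(1)]
proof (intro allI)
  fix m n
  have "0 \<le> C" "0 \<le> D" using assms bdd_mat_nonneg by auto
  have "cmod (\<Sum>k\<in>{m-K..m+K}. A m k * B k n) \<le> (\<Sum>k\<in>{m-K..m+K}. C * D)"
    using assms(2,3) \<open>0 \<le> C\<close> \<open>0 \<le> D\<close>
    by (intro order_trans[OF norm_sum] sum_mono) (auto simp: norm_mult bdd_mat_def intro!: mult_mono)
  also have "\<dots> = real (m + K + 1 - (m - K)) * (C * D)" by simp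
  also have "\<dots> \<le> real (2 * K + 1) * (C * D)"
    using \<open>0 \<le> C\<close> \<open>0 \<le> D\<close> by (intro mult_right_mono) (auto simp: of_nat_diff)
  finally show "cmod (\<Sum>k\<in>{m-K..m+K}. A m k * B k n) \<le> real (2 * K + 1) * (C * D)" .
qed

lemma bdd_mat_msc: "bdd_mat C A \<Longrightarrow> bdd_mat (cmod c * C) (c \<cdot> A)"
  by (auto simp: bdd_mat_def msc_def norm_mult intro: mult_left_mono)

lemma bdd_mat_add: "bdd_mat C A \<Longrightarrow> bdd_mat D B \<Longrightarrow> bdd_mat (C + D) (A + B)"
  by (auto simp: bdd_mat_def intro: norm_triangle_mono)

section \<open>The generators z, z* and y as matrices\<close>

definition aq :: "real \<Rightarrow> nat \<Rightarrow> complex" where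
  "aq q n = complex_of_real (sqrt (1 - q ^ (2 * n)))"

lemma aq_0 [simp]: "aq q 0 = 0"
  by (simp add: aq_def)

lemma cnj_aq [simp]: "cnj (aq q n) = aq q n"
  by (simp add: aq_def)

lemma cmod_aq_le:
  assumes "0 < q" "q < 1"
  shows "cmod (aq q n) \<le> 1"
  using assms by (simp add: aq_def power_le_one real_sqrt_le_1_iff)

lemma zop_eq: "zop q = (\<lambda>m n. if n = Suc m then aq q n else 0)"
  by (simp add: zop_def aq_def fun_eq_iff)

lemma zstar_eq: "zstar q = (\<lambda>m n. if m = Suc n then aq q m else 0)"
  by (auto simp: zstar_def madj_def zop_eq fun_eq_iff)

lemma banded_zop: "banded 1 (zop q)" and banded_zstar: "banded 1 (zstar q)"
  by (auto simp: banded_def zop_eq zstar_eq)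

lemma bdd_zop: "0 < q \<Longrightarrow> q < 1 \<Longrightarrow> bdd_mat 1 (zop q)"
  and bdd_zstar: "0 < q \<Longrightarrow> q < 1 \<Longrightarrow> bdd_mat 1 (zstar q)"
  by (auto simp: bdd_mat_def zop_eq zstar_eq cmod_aq_le)

lemma ypow_eq: "ypow q \<beta> = mdiag (\<lambda>n. complex_of_real ((q ^ n) powr \<beta>))"
  by (simp add: ypow_def fy_def)

lemma yop_eq: "yop q = mdiag (\<lambda>n. complex_of_real (q ^ n))"
  by (simp add: yop_def fy_def)

lemma banded_ypow: "banded 0 (ypow q \<beta>)" and banded_yop: "banded 0 (yop q)"
  by (simp_all add: ypow_eq yop_eq banded_mdiag)

lemma ypow_m2_mult: "0 < q \<Longrightarrow> ypow q (-2) \<odot> A = (\<lambda>m n. A m n / complex_of_real q ^ (2 * m))"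
  by (auto simp: ypow_eq mmul_mdiag_left powr_minus divide_simps power_mult[symmetric] mult.commute
      simp flip: of_real_power)

lemma mult_ypow_2: "0 < q \<Longrightarrow> A \<odot> ypow q 2 = (\<lambda>m n. A m n * complex_of_real q ^ (2 * n))"
  by (auto simp: ypow_eq mmul_mdiag_right power_mult[symmetric] mult.commute
      simp flip: of_real_power)

lemma mult_yop: "A \<odot> yop q = (\<lambda>m n. A m n * complex_of_real q ^ n)"
  by (simp add: yop_eq mmul_mdiag_right)

lemma zop_mult: "zop q \<odot> A = (\<lambda>m n. aq q (Suc m) * A (Suc m) n)"
proof (intro ext)
  fix m n
  have "(zop q \<odot> A) m n = (\<Sum>\<^sub>\<infinity>k\<in>{Suc m}. aq q (Suc m) * A (Suc m) n)"
    unfolding mmul_def by (rule infsum_cong_neutral) (auto simp: zop_eq)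
  then show "(zop q \<odot> A) m n = aq q (Suc m) * A (Suc m) n" by simp
qed

lemma zstar_mult: "zstar q \<odot> A = (\<lambda>m n. case m of 0 \<Rightarrow> 0 | Suc k \<Rightarrow> aq q m * A k n)"
proof (intro ext)
  fix m n
  \<comment> \<open>For m = 0 the truncated predecessor is 0 and row 0 of \<open>zstar\<close>
    vanishes, so the singleton contributes 0 as required.\<close>
  have "(zstar q \<odot> A) m n = (\<Sum>\<^sub>\<infinity>k\<in>{m-1}. case m of 0 \<Rightarrow> 0 | Suc k \<Rightarrow> aq q m * A k n)"
    unfolding mmul_def by (rule infsum_cong_neutral) (auto simp: zstar_eq split: nat.splits)
  then show "(zstar q \<odot> A) m n = (case m of 0 \<Rightarrow> 0 | Suc k \<Rightarrow> aq q m * A k n)" by simp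
qed

lemma mult_zop: "A \<odot> zop q = (\<lambda>m n. case n of 0 \<Rightarrow> 0 | Suc k \<Rightarrow> A m k * aq q n)"
proof (intro ext)
  fix m n
  have "(A \<odot> zop q) m n = (\<Sum>\<^sub>\<infinity>k\<in>{n-1}. case n of 0 \<Rightarrow> 0 | Suc k \<Rightarrow> A m k * aq q n)"
    unfolding mmul_def by (rule infsum_cong_neutral) (auto simp: zop_eq split: nat.splits)
  then show "(A \<odot> zop q) m n = (case n of 0 \<Rightarrow> 0 | Suc k \<Rightarrow> A m k * aq q n)" by simp
qed

lemma mult_zstar: "A \<odot> zstar q = (\<lambda>m n. A m (Suc n) * aq q (Suc n))"
proof (intro ext)
  fix m n
  have "(A \<odot> zstar q) m n = (\<Sum>\<^sub>\<infinity>k\<in>{Suc n}. A m (Suc n) * aq q (Suc n))"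
    unfolding mmul_def by (rule infsum_cong_neutral) (auto simp: zstar_eq)
  then show "(A \<odot> zstar q) m n = A m (Suc n) * aq q (Suc n)" by simp
qed

subsection \<open>The function algebras\<close>

lemma mpow_sop: "mpow sop k = (\<lambda>m n. if m = n + k then 1 else 0)"
proof (induction k)
  case 0 then show ?case by (auto simp: mpow_def mone_def mdiag_def fun_eq_iff)
next
  case (Suc k)
  have "mpow sop (Suc k) = sop \<odot> mpow sop k" by (simp add: mpow_def)
  also have "\<dots> = (\<lambda>m n. if m = n + Suc k then 1 else 0)"
  proof (intro ext)
    fix m n
    have "(sop \<odot> mpow sop k) m n = (\<Sum>\<^sub>\<infinity>j\<in>{m-1}. if m = n + Suc k then 1 else 0)"
      unfolding mmul_def Suc by (rule infsum_cong_neutral) (auto simp: sop_def)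
    then show "(sop \<odot> mpow sop k) m n = (if m = n + Suc k then 1 else 0)" by simp
  qed
  finally show ?case .
qed

lemma mpow_sop_star: "mpow (madj sop) k = (\<lambda>m n. if n = m + k then 1 else 0)"
proof (induction k)
  case 0 then show ?case by (auto simp: mpow_def mone_def mdiag_def fun_eq_iff)
next
  case (Suc k)
  have "mpow (madj sop) (Suc k) = madj sop \<odot> mpow (madj sop) k" by (simp add: mpow_def)
  also have "\<dots> = (\<lambda>m n. if n = m + Suc k then 1 else 0)"
  proof (intro ext)
    fix m n
    have "(madj sop \<odot> mpow (madj sop) k) m n = (\<Sum>\<^sub>\<infinity>j\<in>{Suc m}. if n = m + Suc k then 1 else 0)"
      unfolding mmul_def Suc by (rule infsum_cong_neutral) (auto simp: sop_def madj_def)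
    then show "(madj sop \<odot> mpow (madj sop) k) m n = (if n = m + Suc k then 1 else 0)" by simp
  qed
  finally show ?case .
qed

lemma sum_fun_apply2: "(\<Sum>i\<in>I. f i) m n = (\<Sum>i\<in>I. f i m n :: complex)"
  by (induction I rule: infinite_finite_induct) auto

text \<open>In \<open>s^k f_k(y)\<close> the function acts first, so a lower diagonal is indexed by
  its column; in \<open>f_{-k}(y) s*^k\<close> it acts last, so an upper diagonal is indexed by its
  row.\<close>

lemma band_eq:
  "band q N M f m n =
     (if n \<le> m \<and> m - n \<le> N then f (int (m - n)) (q ^ n)
      else if m < n \<and> n - m \<le> M then f (- int (n - m)) (q ^ m) else 0)"
proof -
  have 1: "(\<Sum>k=0..N. mpow sop k \<odot> fy q (f (int k))) m n
      = (if n \<le> m \<and> m - n \<le> N then f (int (m - n)) (q ^ n) else 0)"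
  proof -
    have "(\<Sum>k=0..N. mpow sop k \<odot> fy q (f (int k))) m n
       = (\<Sum>k=0..N. if k = m - n \<and> n \<le> m then f (int (m - n)) (q ^ n) else 0)"
      unfolding sum_fun_apply2 fy_def mmul_mdiag_right mpow_sop
      by (rule sum.cong) auto
    then show ?thesis by (cases "n \<le> m") auto
  qed
  have 2: "(\<Sum>k=1..M. fy q (f (- int k)) \<odot> mpow (madj sop) k) m n
      = (if m < n \<and> n - m \<le> M then f (- int (n - m)) (q ^ m) else 0)"
  proof -
    have "(\<Sum>k=1..M. fy q (f (- int k)) \<odot> mpow (madj sop) k) m n
       = (\<Sum>k=1..M. if k = n - m \<and> m < n then f (- int (n - m)) (q ^ m) else 0)"
      unfolding sum_fun_apply2 fy_def mmul_mdiag_left mpow_sop_star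
      by (rule sum.cong) auto
    then show ?thesis by (cases "m < n") auto
  qed
  show ?thesis
    unfolding band_def plus_fun_apply 1 2 by auto
qed

lemma qpow_inj: "0 < q \<Longrightarrow> q < 1 \<Longrightarrow> q ^ m = q ^ n \<longleftrightarrow> m = (n :: nat)" for q :: real
  by (metis less_irrefl linorder_neqE_nat power_strict_decreasing_iff)

text \<open>Inverse of \<open>band\<close>: the symbols are read off the diagonals of A. The value
  at the spectral point 0 is set to 0; it never enters the matrix.\<close>

definition diag_fun :: "real \<Rightarrow> mat \<Rightarrow> int \<Rightarrow> real \<Rightarrow> complex" where
  "diag_fun q A k x = (if \<exists>n. x = q ^ n then
      (let n = (THE n. x = q ^ n) in if 0 \<le> k then A (n + nat k) n else A n (n + nat (- k))) else 0)"

lemma diag_fun_qpow: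
  assumes "0 < q" "q < 1"
  shows "diag_fun q A k (q ^ n) = (if 0 \<le> k then A (n + nat k) n else A n (n + nat (- k)))"
proof -
  have "(THE j. q ^ n = q ^ j) = n" using assms by (auto simp: qpow_inj)
  then show ?thesis by (auto simp: diag_fun_def Let_def)
qed

lemma band_diag_fun:
  assumes "0 < q" "q < 1" "banded K A"
  shows "band q K K (diag_fun q A) = A"
  using assms by (auto simp: fun_eq_iff band_eq diag_fun_qpow bandedD simp del: of_nat_diff)

lemma FD_iff:
  assumes "0 < q" "q < 1"
  shows "A \<in> FD q \<longleftrightarrow> (\<exists>K C. banded K A \<and> bdd_mat C A)"
proof
  assume "A \<in> FD q"
  then obtain N M f where A: "A = band q N M f" and b: "\<And>k. bounded (f k ` spec_y q)"
    by (auto simp: FD_def)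
  have "\<exists>C. \<forall>x\<in>spec_y q. cmod (f k x) \<le> C" for k
    using b[of k] by (auto simp: bounded_iff)
  then obtain C where C: "\<And>k x. x \<in> spec_y q \<Longrightarrow> cmod (f k x) \<le> C k" by metis
  \<comment> \<open>Only finitely many symbols occur, and the sum of their bounds dominates each of
    them.\<close>
  let ?D = "\<Sum>k\<in>{- int M..int N}. \<bar>C k\<bar>"
  have D: "cmod (f k (q ^ n)) \<le> ?D" if "k \<in> {- int M..int N}" for k n
  proof -
    have "cmod (f k (q ^ n)) \<le> \<bar>C k\<bar>" using C[of "q ^ n" k] by (auto simp: spec_y_def)
    also have "\<dots> \<le> ?D" using that by (intro member_le_sum) auto
    finally show ?thesis .
  qed
  have "bdd_mat ?D A" unfolding bdd_mat_def
  proof (intro allI)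
    fix m n
    have "0 \<le> ?D" by (intro sum_nonneg) auto
    then show "cmod (A m n) \<le> ?D" unfolding A band_eq using D by auto
  qed
  moreover have "banded (N + M) A" unfolding A by (auto simp: banded_def band_eq)
  ultimately show "\<exists>K C. banded K A \<and> bdd_mat C A" by blast
next
  assume "\<exists>K C. banded K A \<and> bdd_mat C A"
  then obtain K C where KC: "banded K A" "bdd_mat C A" by blast
  have "bounded (diag_fun q A k ` spec_y q)" for k
    unfolding bounded_iff using KC(2) bdd_mat_nonneg[OF KC(2)]
    by (intro exI[of _ C]) (auto simp: diag_fun_def Let_def bdd_mat_def)
  then have "band q K K (diag_fun q A) \<in> FD q" unfolding FD_def by blast
  then show "A \<in> FD q" by (simp add: band_diag_fun[OF assms KC(1)])
qed

text \<open>Supplies the matrix units as test elements when \<open>lmul_bounded\<close> is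
  evaluated.\<close>

lemma finite_supp_in_FD0:
  assumes "0 < q" "q < 1" and A: "\<And>m n. m \<ge> L \<or> n \<ge> L \<Longrightarrow> A m n = 0"
  shows "A \<in> FD0 q"
proof -
  have "banded L A" unfolding banded_def using A by (metis add.commute le_add1 less_imp_le_nat order_trans)
  then have 1: "A = band q L L (diag_fun q A)" using band_diag_fun assms by metis
  have sub: "{x \<in> spec_y q. diag_fun q A k x \<noteq> 0} \<subseteq> (\<lambda>n. q ^ n) ` {..<L}" for k
  proof
    fix x assume x: "x \<in> {x \<in> spec_y q. diag_fun q A k x \<noteq> 0}"
    then obtain n where n: "x = q ^ n" by (auto simp: diag_fun_def split: if_splits)
    with x have "n < L" using A by (auto simp: diag_fun_qpow[OF assms(1,2)] not_less[symmetric] split: if_splits)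
    with n show "x \<in> (\<lambda>n. q ^ n) ` {..<L}" by auto
  qed
  have "\<forall>k. finite {x \<in> spec_y q. diag_fun q A k x \<noteq> 0}
        \<and> {x \<in> spec_y q. diag_fun q A k x \<noteq> 0} \<subseteq> range (\<lambda>n. q ^ n)"
    using sub by (meson finite_imageI finite_lessThan finite_subset image_mono order_trans subset_UNIV)
  with 1 show ?thesis unfolding FD0_def by blast
qed

subsection \<open>Weighted square sums\<close>

text \<open>The squared norm of \<open>L2D q 1\<close> up to the factor 1 - q, as an element of
  [0, \<infinity>]. Rearrangements then need no summability conditions, and membership becomes
  finiteness.\<close>

definition nnorm2 :: "real \<Rightarrow> mat \<Rightarrow> ennreal" where
  "nnorm2 q \<xi> = (\<Sum>n. \<Sum>m. ennreal (q ^ n * (cmod (\<xi> m n))\<^sup>2))"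

lemma ennreal_suminf_swap:
  fixes f :: "nat \<Rightarrow> nat \<Rightarrow> ennreal"
  shows "(\<Sum>m. \<Sum>n. f m n) = (\<Sum>n. \<Sum>m. f m n)"
proof -
  have "(\<Sum>m. \<Sum>n. f m n) = (\<integral>\<^sup>+m. (\<Sum>n. f m n) \<partial>count_space UNIV)"
    by (rule nn_integral_count_space_nat[symmetric])
  also have "\<dots> = (\<Sum>n. \<integral>\<^sup>+m. f m n \<partial>count_space UNIV)"
    by (rule nn_integral_suminf) simp
  finally show ?thesis by (simp add: nn_integral_count_space_nat)
qed

lemma nnorm2_count:
  "nnorm2 q \<xi> = (\<integral>\<^sup>+(m, n). ennreal (q ^ n * (cmod (\<xi> m n))\<^sup>2) \<partial>count_space UNIV)"
  using nn_integral_snd_count_space[of "\<lambda>(m, n). ennreal (q ^ n * (cmod (\<xi> m n))\<^sup>2)"]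
  by (simp add: nnorm2_def nn_integral_count_space_nat)

lemma summable_on_iff_nn_integral:
  fixes f :: "'a \<Rightarrow> real"
  assumes "\<And>x. 0 \<le> f x"
  shows "f summable_on UNIV \<longleftrightarrow> (\<integral>\<^sup>+x. ennreal (f x) \<partial>count_space UNIV) < \<infinity>"
proof -
  have "f summable_on UNIV \<longleftrightarrow> Infinite_Sum.abs_summable_on f UNIV"
    using assms by simp
  also have "\<dots> \<longleftrightarrow> integrable (count_space UNIV) f"
    by (simp only: abs_summable_equivalent Infinite_Set_Sum.abs_summable_on_def)
  also have "\<dots> \<longleftrightarrow> (\<integral>\<^sup>+x. ennreal (f x) \<partial>count_space UNIV) < \<infinity>"
    using assms by (simp add: integrable_iff_bounded)
  finally show ?thesis .
qed

lemma L2D_eq: "0 < q \<Longrightarrow> L2D q 1 = {\<xi>. (\<lambda>(m, n). q ^ n * (cmod (\<xi> m n))\<^sup>2) summable_on UNIV}"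
  by (simp add: L2D_def powr_realpow)

lemma L2D_iff: "0 < q \<Longrightarrow> \<xi> \<in> L2D q 1 \<longleftrightarrow> nnorm2 q \<xi> < \<infinity>"
  unfolding L2D_eq nnorm2_count mem_Collect_eq
  by (subst summable_on_iff_nn_integral) (auto simp: case_prod_unfold)

text \<open>No summability is assumed: if the series diverges, \<open>infsum\<close> defaults to 0,
  and \<open>enn2real\<close> of infinity is 0 as well.\<close>

lemma infsum_nonneg_enn2real:
  fixes f :: "nat \<Rightarrow> real"
  assumes "\<And>n. 0 \<le> f n"
  shows "infsum f UNIV = enn2real (\<Sum>n. ennreal (f n))"
proof (cases "summable f")
  case True
  then have "infsum f UNIV = suminf f"
    using assms by (intro infsumI sums_nonneg_imp_has_sum summable_sums) auto
  moreover have "0 \<le> suminf f" using True assms by (intro suminf_nonneg) auto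
  ultimately show ?thesis using True assms by (simp add: suminf_ennreal2)
next
  case False
  have "(\<Sum>n. ennreal (f n)) = top"
  proof (rule ccontr)
    assume "(\<Sum>n. ennreal (f n)) \<noteq> top"
    then have "summable f" by (rule summable_suminf_not_top[rotated]) (rule assms)
    with False show False ..
  qed
  moreover have "\<not> f summable_on UNIV"
    using False assms summable_on_UNIV_nonneg_real_iff by blast
  ultimately show ?thesis by (simp add: infsum_not_exists)
qed

lemma infsum_of_real': "(\<Sum>\<^sub>\<infinity>x\<in>A. complex_of_real (f x)) = complex_of_real (\<Sum>\<^sub>\<infinity>x\<in>A. f x)"
proof (cases "f summable_on A")
  case True
  then show ?thesis by (intro infsumI has_sum_of_real) auto
next
  case False
  moreover have "\<not> (\<lambda>x. complex_of_real (f x)) summable_on A"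
  proof
    assume "(\<lambda>x. complex_of_real (f x)) summable_on A"
    then have "(\<lambda>x. Re (complex_of_real (f x))) summable_on A"
      by (rule summable_on_Re)
    with False show False by simp
  qed
  ultimately show ?thesis by (simp add: infsum_not_exists)
qed

text \<open>The value that \<open>l2inner q 1 \<xi> \<xi>\<close> takes for every matrix. The two
  nested \<open>enn2real\<close> reproduce the default values of the two nested infinite sums, and
  measurability in t can be read off.\<close>

definition nsq :: "real \<Rightarrow> mat \<Rightarrow> real" where
  "nsq q \<xi> = (1 - q) * enn2real (\<Sum>n. ennreal (q ^ n * enn2real (\<Sum>m. ennreal ((cmod (\<xi> m n))\<^sup>2))))"

lemma l2inner_self:
  assumes "0 < q"
  shows "l2inner q 1 \<xi> \<xi> = complex_of_real (nsq q \<xi>)"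
proof -
  have 1: "(\<Sum>\<^sub>\<infinity>m. cnj (\<xi> m n) * \<xi> m n) = complex_of_real (enn2real (\<Sum>m. ennreal ((cmod (\<xi> m n))\<^sup>2)))" for n
  proof -
    have "(\<Sum>\<^sub>\<infinity>m. cnj (\<xi> m n) * \<xi> m n) = (\<Sum>\<^sub>\<infinity>m. complex_of_real ((cmod (\<xi> m n))\<^sup>2))"
      by (intro infsum_cong) (simp add: complex_norm_square mult.commute del: of_real_power)
    then show ?thesis by (simp only: infsum_of_real') (simp add: infsum_nonneg_enn2real)
  qed
  let ?r = "\<lambda>n. q ^ n * enn2real (\<Sum>m. ennreal ((cmod (\<xi> m n))\<^sup>2))"
  have "l2inner q 1 \<xi> \<xi> = complex_of_real (1 - q) * (\<Sum>\<^sub>\<infinity>n. complex_of_real (?r n))"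
    unfolding l2inner_eq 1 using assms by (simp only: of_real_mult mult.commute powr_one zero_le_power less_imp_le)
  also have "(\<Sum>\<^sub>\<infinity>n. complex_of_real (?r n)) = complex_of_real (\<Sum>\<^sub>\<infinity>n. ?r n)"
    by (rule infsum_of_real')
  also have "(\<Sum>\<^sub>\<infinity>n. ?r n) = enn2real (\<Sum>n. ennreal (?r n))"
    using assms by (intro infsum_nonneg_enn2real) auto
  finally show ?thesis by (simp only: nsq_def of_real_mult)
qed

lemma nsq_nonneg: "q < 1 \<Longrightarrow> 0 \<le> nsq q \<xi>"
  by (simp add: nsq_def)

lemma l2norm_sq: "0 < q \<Longrightarrow> q < 1 \<Longrightarrow> (l2norm q 1 \<xi>)\<^sup>2 = nsq q \<xi>"
  by (simp add: l2norm_def l2inner_self nsq_nonneg)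

lemma nsq_nnorm2:
  assumes "0 < q" "q < 1" "nnorm2 q \<xi> < \<infinity>"
  shows "ennreal (nsq q \<xi>) = ennreal (1 - q) * nnorm2 q \<xi>"
proof -
  have eq: "(\<Sum>m. ennreal (q ^ n * (cmod (\<xi> m n))\<^sup>2)) = ennreal (q ^ n) * (\<Sum>m. ennreal ((cmod (\<xi> m n))\<^sup>2))" for n
    using assms by (simp add: ennreal_mult)
  \<comment> \<open>A column of infinite norm would be read as 0 by the inner
    \<open>enn2real\<close>; finiteness of the total excludes this because q^n > 0.\<close>
  have fin: "(\<Sum>m. ennreal ((cmod (\<xi> m n))\<^sup>2)) < top" for n
  proof -
    have "(\<Sum>m. ennreal (q ^ n * (cmod (\<xi> m n))\<^sup>2)) \<le> nnorm2 q \<xi>"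
      unfolding nnorm2_def
      using sum_le_suminf[of "\<lambda>n. \<Sum>m. ennreal (q ^ n * (cmod (\<xi> m n))\<^sup>2)" "{n}"] by simp
    then have "ennreal (q ^ n) * (\<Sum>m. ennreal ((cmod (\<xi> m n))\<^sup>2)) < top"
      using assms(3) unfolding eq by (simp add: order_le_less_trans)
    then show ?thesis using assms(1) by (auto simp: ennreal_mult_less_top)
  qed
  have "(\<Sum>n. ennreal (q ^ n * enn2real (\<Sum>m. ennreal ((cmod (\<xi> m n))\<^sup>2)))) = nnorm2 q \<xi>"
    unfolding nnorm2_def eq using assms(1) fin by (simp add: ennreal_mult)
  then show ?thesis unfolding nsq_def using assms by (simp add: ennreal_mult)
qed

text \<open>The bound ab \<le> a^2 + b^2 on each term replaces the Cauchy-Schwarz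
  inequality.\<close>

lemma L2D_abs_summable:
  assumes "0 < q" "f \<in> L2D q 1" "g \<in> L2D q 1"
  shows "(\<lambda>(n, m). cnj (f m n) * g m n * complex_of_real q ^ n) summable_on UNIV"
proof -
  have s: "(\<lambda>(n, m). q ^ n * (cmod (h m n))\<^sup>2) summable_on UNIV" if "h \<in> L2D q 1" for h
  proof -
    have "(\<lambda>(m, n). q ^ n * (cmod (h m n))\<^sup>2) summable_on UNIV \<times> UNIV"
      using that assms by (simp add: L2D_eq)
    then show ?thesis by (subst (asm) summable_on_swap) simp
  qed
  have "(\<lambda>p. norm ((\<lambda>(n, m). cnj (f m n) * g m n * complex_of_real q ^ n) p)) summable_on UNIV"
  proof (rule Infinite_Sum.abs_summable_on_comparison_test')
    show "(\<lambda>p. (\<lambda>(n, m). q ^ n * (cmod (f m n))\<^sup>2) p + (\<lambda>(n, m). q ^ n * (cmod (g m n))\<^sup>2) p) summable_on UNIV"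
      by (intro summable_on_add s assms)
    fix p :: "nat \<times> nat"
    obtain n m where p: "p = (n, m)" by (cases p)
    have "cmod (f m n) * cmod (g m n) \<le> (cmod (f m n))\<^sup>2 + (cmod (g m n))\<^sup>2"
    proof -
      have "2 * (cmod (f m n) * cmod (g m n)) \<le> (cmod (f m n))\<^sup>2 + (cmod (g m n))\<^sup>2"
        using sum_squares_bound[of "cmod (f m n)" "cmod (g m n)"] by simp
      moreover have "0 \<le> cmod (f m n) * cmod (g m n)" by simp
      ultimately show ?thesis by linarith
    qed
    then have "q ^ n * (cmod (f m n) * cmod (g m n)) \<le> q ^ n * ((cmod (f m n))\<^sup>2 + (cmod (g m n))\<^sup>2)"
      using assms by (intro mult_left_mono) auto
    then show "norm ((\<lambda>(n, m). cnj (f m n) * g m n * complex_of_real q ^ n) p)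
      \<le> (\<lambda>(n, m). q ^ n * (cmod (f m n))\<^sup>2) p + (\<lambda>(n, m). q ^ n * (cmod (g m n))\<^sup>2) p"
      using assms by (simp add: p norm_mult norm_power algebra_simps)
  qed
  then show ?thesis by (rule abs_summable_summable)
qed

text \<open>Absolute summability merges the iterated sum into one unordered sum over (column, row),
  in which either index may be shifted.\<close>

lemma l2inner_pairs:
  assumes "0 < q" "f \<in> L2D q 1" "g \<in> L2D q 1"
  shows "l2inner q 1 f g =
     complex_of_real (1 - q) * (\<Sum>\<^sub>\<infinity>(n, m). cnj (f m n) * g m n * complex_of_real q ^ n)"
proof -
  have "(\<Sum>\<^sub>\<infinity>n. (\<Sum>\<^sub>\<infinity>m. cnj (f m n) * g m n) * complex_of_real ((q ^ n) powr 1))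
      = (\<Sum>\<^sub>\<infinity>n. \<Sum>\<^sub>\<infinity>m. cnj (f m n) * g m n * complex_of_real q ^ n)"
    using assms(1) by (simp add: infsum_cmult_left')
  also have "\<dots> = (\<Sum>\<^sub>\<infinity>(n, m)\<in>UNIV \<times> UNIV. cnj (f m n) * g m n * complex_of_real q ^ n)"
    using L2D_abs_summable[OF assms] by (intro infsum_Sigma'_banach) simp
  finally show ?thesis unfolding l2inner_eq by simp
qed

subsection \<open>Banded matrices act boundedly\<close>

text \<open>Cauchy-Schwarz on a window of at most 2K+1 terms gives one factor 2K+1, and the overlap
  of the windows gives the other. The constant W compares the weights within a window; a constant
  weight serves multiplication from the left, a geometric one multiplication from the right.\<close>

lemma banded_kernel_bound:
  fixes w :: "nat \<Rightarrow> real"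
  assumes w: "\<And>k. 0 \<le> w k" and W: "\<And>m k. m \<le> k + K \<Longrightarrow> k \<le> m + K \<Longrightarrow> w m \<le> W * w k" and "0 \<le> W"
    and B: "\<And>m k. cmod (B m k) \<le> C" "0 \<le> C"
  shows "(\<Sum>m. ennreal (w m * (cmod (\<Sum>k\<in>{m-K..m+K}. B m k * u k))\<^sup>2))
     \<le> ennreal ((real (2 * K + 1))\<^sup>2 * C\<^sup>2 * W) * (\<Sum>k. ennreal (w k * (cmod (u k))\<^sup>2))"
proof -
  let ?I = "\<lambda>m. {m-K..m+K}"
  let ?c = "real (2 * K + 1)"
  let ?v = "\<lambda>k. w k * (cmod (u k))\<^sup>2"
  have card: "real (card (?I m)) \<le> ?c" for m by (simp add: of_nat_diff)
  have 1: "w m * (cmod (\<Sum>k\<in>?I m. B m k * u k))\<^sup>2 \<le> (?c * C\<^sup>2 * W) * (\<Sum>k\<in>?I m. ?v k)" for m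
  proof -
    have "(cmod (\<Sum>k\<in>?I m. B m k * u k))\<^sup>2 \<le> (\<Sum>k\<in>?I m. C * cmod (u k))\<^sup>2"
      using B by (intro power_mono order_trans[OF norm_sum] sum_mono)
        (auto simp: norm_mult intro!: mult_right_mono)
    also have "\<dots> \<le> (\<Sum>k\<in>?I m. (C * cmod (u k))\<^sup>2) * real (card (?I m))"
      by (rule sum_squared_le_sum_of_squares) 
    also have "\<dots> \<le> (\<Sum>k\<in>?I m. (C * cmod (u k))\<^sup>2) * ?c"
      using card by (intro mult_left_mono sum_nonneg) auto
    finally have "w m * (cmod (\<Sum>k\<in>?I m. B m k * u k))\<^sup>2 \<le> w m * ((\<Sum>k\<in>?I m. (C * cmod (u k))\<^sup>2) * ?c)"
      using w by (intro mult_left_mono)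
    also have "\<dots> = (?c * C\<^sup>2) * (\<Sum>k\<in>?I m. w m * (cmod (u k))\<^sup>2)"
      by (simp add: sum_distrib_left sum_distrib_right power_mult_distrib mult_ac)
    also have "\<dots> \<le> (?c * C\<^sup>2) * (\<Sum>k\<in>?I m. W * w k * (cmod (u k))\<^sup>2)"
      using W by (intro mult_left_mono sum_mono mult_right_mono) auto
    also have "\<dots> = (?c * C\<^sup>2 * W) * (\<Sum>k\<in>?I m. ?v k)"
      by (simp add: sum_distrib_left mult_ac)
    finally show ?thesis .
  qed
  have v: "0 \<le> ?v k" for k using w by simp
  have 2: "ennreal (w m * (cmod (\<Sum>k\<in>?I m. B m k * u k))\<^sup>2)
     \<le> ennreal (?c * C\<^sup>2 * W) * (\<Sum>k. ennreal (?v k) * indicator (?I m) k)" for m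
  proof -
    have "(\<Sum>k. ennreal (?v k) * indicator (?I m) k) = (\<Sum>k\<in>?I m. ennreal (?v k) * indicator (?I m) k)"
      by (rule suminf_finite) auto
    also have "\<dots> = (\<Sum>k\<in>?I m. ennreal (?v k))" by (rule sum.cong) auto
    also have "\<dots> = ennreal (\<Sum>k\<in>?I m. ?v k)" using v by (rule sum_ennreal)
    finally have "ennreal (?c * C\<^sup>2 * W) * (\<Sum>k. ennreal (?v k) * indicator (?I m) k)
       = ennreal ((?c * C\<^sup>2 * W) * (\<Sum>k\<in>?I m. ?v k))"
      using \<open>0 \<le> W\<close> v by (simp add: ennreal_mult sum_nonneg)
    then show ?thesis using 1[of m] by (simp add: ennreal_leI)
  qed
  \<comment> \<open>The relation "k lies in the window of m" is used from the other side: each k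
    lies in at most 2K+1 windows.\<close>
  have 3: "(\<Sum>m. ennreal (?v k) * indicator (?I m) k) \<le> ennreal ?c * ennreal (?v k)" for k
  proof -
    have "(\<Sum>m. ennreal (?v k) * indicator (?I m) k) = (\<Sum>m\<in>?I k. ennreal (?v k) * indicator (?I m) k)"
      by (rule suminf_finite) (auto simp: indicator_def)
    also have "\<dots> \<le> (\<Sum>m\<in>?I k. ennreal (?v k))"
      by (intro sum_mono) (auto simp: indicator_def)
    also have "\<dots> = ennreal (real (card (?I k))) * ennreal (?v k)"
      by (simp add: ennreal_of_nat_eq_real_of_nat)
    also have "\<dots> \<le> ennreal ?c * ennreal (?v k)"
      by (intro mult_right_mono ennreal_leI card) auto
    finally show ?thesis .
  qed
  have "(\<Sum>m. ennreal (w m * (cmod (\<Sum>k\<in>?I m. B m k * u k))\<^sup>2))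
     \<le> (\<Sum>m. ennreal (?c * C\<^sup>2 * W) * (\<Sum>k. ennreal (?v k) * indicator (?I m) k))"
    by (intro suminf_le 2) auto
  also have "\<dots> = ennreal (?c * C\<^sup>2 * W) * (\<Sum>k. \<Sum>m. ennreal (?v k) * indicator (?I m) k)"
    by (simp only: ennreal_suminf_cmult ennreal_suminf_swap[of "\<lambda>m k. ennreal (?v k) * indicator (?I m) k"])
  also have "\<dots> \<le> ennreal (?c * C\<^sup>2 * W) * (\<Sum>k. ennreal ?c * ennreal (?v k))"
    by (intro mult_left_mono suminf_le 3) auto
  also have "\<dots> = ennreal (?c * C\<^sup>2 * W) * ennreal ?c * (\<Sum>k. ennreal (?v k))"
    by (simp only: ennreal_suminf_cmult mult.assoc)
  also have "ennreal (?c * C\<^sup>2 * W) * ennreal ?c = ennreal ((real (2 * K + 1))\<^sup>2 * C\<^sup>2 * W)"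
  proof -
    have "(?c * C\<^sup>2 * W) * ?c = ?c\<^sup>2 * C\<^sup>2 * W" by (simp only: power2_eq_square mult_ac)
    then show ?thesis using \<open>0 \<le> W\<close> by (simp only: ennreal_mult[symmetric] mult_nonneg_nonneg of_nat_0_le_iff zero_le_power2)
  qed
  finally show ?thesis .
qed

lemma nnorm2_mmul_left:
  assumes "0 < q" "banded K A" "bdd_mat C A"
  shows "nnorm2 q (A \<odot> \<xi>) \<le> ennreal ((real (2 * K + 1))\<^sup>2 * C\<^sup>2) * nnorm2 q \<xi>"
proof -
  have "(\<Sum>m. ennreal (q ^ n * (cmod ((A \<odot> \<xi>) m n))\<^sup>2))
     \<le> ennreal ((real (2 * K + 1))\<^sup>2 * C\<^sup>2 * 1) * (\<Sum>k. ennreal (q ^ n * (cmod (\<xi> k n))\<^sup>2))" for n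
    unfolding mmul_banded_left[OF assms(2)]
    using assms bdd_mat_nonneg[OF assms(3)]
    by (intro banded_kernel_bound) (auto simp: bdd_mat_def)
  from suminf_le[OF this] show ?thesis by (simp only: nnorm2_def mult_1_right ennreal_suminf_cmult summableI)
qed

text \<open>The weight q^n depends on the column, so moving columns by at most K costs the factor
  q^(-K).\<close>

lemma nnorm2_mmul_right:
  assumes "0 < q" "q < 1" "banded K A" "bdd_mat C A"
  shows "nnorm2 q (\<xi> \<odot> A) \<le> ennreal ((real (2 * K + 1))\<^sup>2 * C\<^sup>2 * (1 / q ^ K)) * nnorm2 q \<xi>"
proof -
  have w: "q ^ n \<le> 1 / q ^ K * q ^ k" if "k \<le> n + K" for n k
  proof -
    have "q ^ (n + K) \<le> q ^ k" using assms that by (intro power_decreasing) auto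
    then show ?thesis using assms by (simp add: field_simps power_add)
  qed
  have "(\<Sum>n. ennreal (q ^ n * (cmod ((\<xi> \<odot> A) m n))\<^sup>2))
     \<le> ennreal ((real (2 * K + 1))\<^sup>2 * C\<^sup>2 * (1 / q ^ K)) * (\<Sum>k. ennreal (q ^ k * (cmod (\<xi> m k))\<^sup>2))" for m
    unfolding mmul_banded_right[OF assms(3)] mult.commute[of "\<xi> m _"]
    using assms bdd_mat_nonneg[OF assms(4)] w
    by (intro banded_kernel_bound) (auto simp: bdd_mat_def)
  from suminf_le[OF this] show ?thesis
    by (simp only: nnorm2_def ennreal_suminf_cmult summableI
        ennreal_suminf_swap[of "\<lambda>n m. ennreal (q ^ n * (cmod (_ m n))\<^sup>2)"])
qed

text \<open>The inequality |a+b|^2 \<le> 2|a|^2 + 2|b|^2, summed termwise, takes the place of the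
  triangle inequality; constants are irrelevant for boundedness.\<close>

lemma nnorm2_add: "0 < q \<Longrightarrow> nnorm2 q (a + b) \<le> 2 * nnorm2 q a + 2 * nnorm2 q b"
proof -
  assume "0 < q"
  have *: "ennreal (q ^ n * (cmod ((a + b) m n))\<^sup>2)
     \<le> 2 * ennreal (q ^ n * (cmod (a m n))\<^sup>2) + 2 * ennreal (q ^ n * (cmod (b m n))\<^sup>2)" for m n
  proof -
    have "(cmod (a m n + b m n))\<^sup>2 \<le> (cmod (a m n) + cmod (b m n))\<^sup>2"
      by (intro power_mono norm_triangle_ineq) auto
    also have "\<dots> \<le> 2 * (cmod (a m n))\<^sup>2 + 2 * (cmod (b m n))\<^sup>2"
      using sum_squares_bound[of "cmod (a m n)" "cmod (b m n)"] by (simp add: power2_sum)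
    finally have "q ^ n * (cmod ((a + b) m n))\<^sup>2 \<le> q ^ n * (2 * (cmod (a m n))\<^sup>2 + 2 * (cmod (b m n))\<^sup>2)"
      using \<open>0 < q\<close> by (intro mult_left_mono) auto
    then have "ennreal (q ^ n * (cmod ((a + b) m n))\<^sup>2)
       \<le> ennreal (2 * (q ^ n * (cmod (a m n))\<^sup>2) + 2 * (q ^ n * (cmod (b m n))\<^sup>2))"
      by (intro ennreal_leI) (simp add: algebra_simps)
    then show ?thesis using \<open>0 < q\<close> by (simp add: ennreal_mult')
  qed
  have "nnorm2 q (a + b) \<le> (\<Sum>n. \<Sum>m. 2 * ennreal (q ^ n * (cmod (a m n))\<^sup>2)
     + 2 * ennreal (q ^ n * (cmod (b m n))\<^sup>2))"
    unfolding nnorm2_def by (intro suminf_le *) auto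
  then show ?thesis by (simp add: nnorm2_def suminf_add[symmetric])
qed

lemma nnorm2_msc: "nnorm2 q (c \<cdot> a) = ennreal ((cmod c)\<^sup>2) * nnorm2 q a"
proof -
  have "ennreal (q ^ n * (cmod ((c \<cdot> a) m n))\<^sup>2) = ennreal ((cmod c)\<^sup>2) * ennreal (q ^ n * (cmod (a m n))\<^sup>2)" for m n
    by (subst ennreal_mult'[symmetric]) (auto simp: msc_def norm_mult power_mult_distrib mult_ac)
  then show ?thesis by (simp add: nnorm2_def)
qed

lemma L2D_add: "0 < q \<Longrightarrow> a \<in> L2D q 1 \<Longrightarrow> b \<in> L2D q 1 \<Longrightarrow> a + b \<in> L2D q 1"
  using nnorm2_add[of q a b] by (auto simp: L2D_iff ennreal_mult_less_top intro: order_le_less_trans)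

lemma L2D_msc: "0 < q \<Longrightarrow> a \<in> L2D q 1 \<Longrightarrow> c \<cdot> a \<in> L2D q 1"
  by (auto simp: L2D_iff nnorm2_msc ennreal_mult_less_top)

lemma L2D_uminus: "0 < q \<Longrightarrow> a \<in> L2D q 1 \<Longrightarrow> - a \<in> L2D q 1"
  by (simp add: L2D_iff nnorm2_def)

lemma L2D_diff: "0 < q \<Longrightarrow> a \<in> L2D q 1 \<Longrightarrow> b \<in> L2D q 1 \<Longrightarrow> a - b \<in> L2D q 1"
  using L2D_add[of q a "- b"] L2D_uminus[of q b] by simp

lemma L2D_mmul_left: "0 < q \<Longrightarrow> banded K A \<Longrightarrow> bdd_mat C A \<Longrightarrow> a \<in> L2D q 1 \<Longrightarrow> A \<odot> a \<in> L2D q 1"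
  using nnorm2_mmul_left[of q K A C a]
  by (auto simp: L2D_iff ennreal_mult_less_top intro: order_le_less_trans)

lemma L2D_mmul_right:
  "0 < q \<Longrightarrow> q < 1 \<Longrightarrow> banded K A \<Longrightarrow> bdd_mat C A \<Longrightarrow> a \<in> L2D q 1 \<Longrightarrow> a \<odot> A \<in> L2D q 1"
  using nnorm2_mmul_right[of q K A C a]
  by (auto simp: L2D_iff ennreal_mult_less_top intro: order_le_less_trans)

text \<open>Column n contributes at most (2K+1) C^2 q^n, a geometric series.\<close>

lemma bdd_banded_L2D:
  assumes "0 < q" "q < 1" "banded K A" "bdd_mat C A"
  shows "A \<in> L2D q 1"
proof -
  have "C \<ge> 0" using assms bdd_mat_nonneg by blast
  have 1: "(\<Sum>m. ennreal (q ^ n * (cmod (A m n))\<^sup>2)) \<le> ennreal ((2 * K + 1) * C\<^sup>2 * q ^ n)" for n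
  proof -
    have "(\<Sum>m. ennreal (q ^ n * (cmod (A m n))\<^sup>2)) = (\<Sum>m\<in>{n-K..n+K}. ennreal (q ^ n * (cmod (A m n))\<^sup>2))"
      using assms(3) by (intro suminf_finite) (auto simp: banded_def)
    also have "\<dots> \<le> (\<Sum>m\<in>{n-K..n+K}. ennreal (q ^ n * C\<^sup>2))"
      using assms by (intro sum_mono ennreal_leI mult_left_mono power_mono) (auto simp: bdd_mat_def)
    also have "\<dots> = ennreal (real (n + K + 1 - (n - K)) * (q ^ n * C\<^sup>2))"
      using assms \<open>C \<ge> 0\<close> by (subst ennreal_mult) (auto simp: ennreal_of_nat_eq_real_of_nat)
    also have "\<dots> \<le> ennreal (real (2 * K + 1) * (q ^ n * C\<^sup>2))"
      using assms by (intro ennreal_leI mult_right_mono) (auto simp: of_nat_diff)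
    finally show ?thesis by (simp add: mult_ac)
  qed
  have "nnorm2 q A \<le> (\<Sum>n. ennreal ((2 * K + 1) * C\<^sup>2 * q ^ n))"
    unfolding nnorm2_def by (intro suminf_le 1) auto
  also have "\<dots> < \<infinity>"
  proof -
    have "summable (\<lambda>n. (2 * K + 1) * C\<^sup>2 * q ^ n)"
      using assms by (intro summable_mult summable_geometric) auto
    then have "(\<Sum>n. ennreal ((2 * K + 1) * C\<^sup>2 * q ^ n)) \<noteq> top"
      using assms by (intro ennreal_suminf_neq_top) auto
    then show ?thesis by (simp add: less_top)
  qed
  finally show ?thesis using assms by (simp add: L2D_iff)
qed

subsection \<open>The Hilbert space\<close>

definition entries_meas :: "matfun \<Rightarrow> bool" where
  "entries_meas \<psi> \<longleftrightarrow> (\<forall>m n. (\<lambda>t. \<psi> t m n) \<in> borel_measurable circle)"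

definition hh :: "real \<Rightarrow> matfun \<Rightarrow> ennreal" where
  "hh q \<psi> = (\<integral>\<^sup>+t. nnorm2 q (\<psi> t) \<partial>circle)"

lemma entries_measD: "entries_meas \<psi> \<Longrightarrow> (\<lambda>t. \<psi> t m n) \<in> borel_measurable circle"
  by (simp add: entries_meas_def)

lemma measurable_nnorm2:
  assumes "entries_meas \<psi>"
  shows "(\<lambda>t. nnorm2 q (\<psi> t)) \<in> borel_measurable circle"
proof -
  note [measurable] = entries_measD[OF assms]
  show ?thesis unfolding nnorm2_def by measurable
qed

lemma measurable_nsq:
  assumes "entries_meas \<psi>"
  shows "(\<lambda>t. nsq q (\<psi> t)) \<in> borel_measurable circle"
proof -
  note [measurable] = entries_measD[OF assms]
  show ?thesis unfolding nsq_def by measurable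
qed

lemma nn_integral_nsq:
  assumes "0 < q" "q < 1" "AE t in circle. \<psi> t \<in> L2D q 1" "entries_meas \<psi>"
  shows "(\<integral>\<^sup>+t. ennreal (nsq q (\<psi> t)) \<partial>circle) = ennreal (1 - q) * hh q \<psi>"
proof -
  have "(\<integral>\<^sup>+t. ennreal (nsq q (\<psi> t)) \<partial>circle) = (\<integral>\<^sup>+t. ennreal (1 - q) * nnorm2 q (\<psi> t) \<partial>circle)"
    using assms(3) by (intro nn_integral_cong_AE) (auto simp: L2D_iff[OF assms(1)] nsq_nnorm2[OF assms(1,2)] elim!: eventually_mono)
  then show ?thesis using assms(4) by (simp add: hh_def nn_integral_cmult measurable_nnorm2)
qed

text \<open>Outside \<open>L2D\<close> the real-valued norm takes default values, so its
  integrability alone says little. Both directions therefore pass through almost-everywhere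
  membership, which a finite integral of \<open>nnorm2\<close> provides.\<close>

lemma Hsp_iff:
  assumes "0 < q" "q < 1"
  shows "\<psi> \<in> Hsp q 1 \<longleftrightarrow> entries_meas \<psi> \<and> hh q \<psi> < \<infinity>"
proof
  assume H: "\<psi> \<in> Hsp q 1"
  then have m: "entries_meas \<psi>" and ae: "AE t in circle. \<psi> t \<in> L2D q 1"
    and i: "integrable circle (\<lambda>t. nsq q (\<psi> t))"
    by (simp_all add: Hsp_def entries_meas_def l2norm_sq[OF assms])
  have "(\<integral>\<^sup>+t. ennreal (nsq q (\<psi> t)) \<partial>circle) < \<infinity>"
    using i nsq_nonneg[OF assms(2)] by (simp add: integrable_iff_bounded)
  then show "entries_meas \<psi> \<and> hh q \<psi> < \<infinity>"
    using nn_integral_nsq[OF assms ae m] m assms by (auto simp: ennreal_mult_less_top)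
next
  assume H: "entries_meas \<psi> \<and> hh q \<psi> < \<infinity>"
  then have m: "entries_meas \<psi>" by simp
  have "AE t in circle. nnorm2 q (\<psi> t) \<noteq> \<infinity>"
    using H measurable_nnorm2[OF m] by (intro nn_integral_PInf_AE) (auto simp: hh_def)
  then have ae: "AE t in circle. \<psi> t \<in> L2D q 1"
    by eventually_elim (simp add: L2D_iff assms(1) less_top)
  have "(\<integral>\<^sup>+t. ennreal (nsq q (\<psi> t)) \<partial>circle) < \<infinity>"
    using H by (simp add: nn_integral_nsq[OF assms ae m] ennreal_mult_less_top)
  then have "integrable circle (\<lambda>t. nsq q (\<psi> t))"
    using measurable_nsq[OF m] nsq_nonneg[OF assms(2)] by (simp add: integrable_iff_bounded)
  then show "\<psi> \<in> Hsp q 1" using m ae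
    by (simp add: Hsp_def entries_meas_def l2norm_sq[OF assms])
qed

lemma hinner_self:
  assumes "0 < q" "q < 1" "\<psi> \<in> Hsp q 1"
  shows "0 \<le> Re (hinner q 1 \<psi> \<psi>)"
    "ennreal (Re (hinner q 1 \<psi> \<psi>)) = ennreal (1 - q) * hh q \<psi>"
proof -
  have m: "entries_meas \<psi>" and ae: "AE t in circle. \<psi> t \<in> L2D q 1"
    and i: "integrable circle (\<lambda>t. nsq q (\<psi> t))"
    using assms(3) by (simp_all add: Hsp_def entries_meas_def l2norm_sq[OF assms(1,2)])
  have eq: "Re (hinner q 1 \<psi> \<psi>) = (LINT t|circle. nsq q (\<psi> t))"
    by (simp add: hinner_def l2inner_self[OF assms(1)] del: of_real_mult)
  show "0 \<le> Re (hinner q 1 \<psi> \<psi>)" unfolding eq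
    using nsq_nonneg[OF assms(2)] by (intro integral_nonneg_AE) auto
  show "ennreal (Re (hinner q 1 \<psi> \<psi>)) = ennreal (1 - q) * hh q \<psi>" unfolding eq
    using nn_integral_eq_integral[OF i] nsq_nonneg[OF assms(2)] nn_integral_nsq[OF assms(1,2) ae m]
    by simp
qed

lemma ipnorm_hinner:
  assumes "0 < q" "q < 1" "\<psi> \<in> Hsp q 1"
  shows "ennreal ((ipnorm (hinner q 1) \<psi>)\<^sup>2) = ennreal (1 - q) * hh q \<psi>"
  using hinner_self[OF assms] by (simp add: ipnorm_def)

lemma ipnorm_hinner2:
  assumes "0 < q" "q < 1" "\<psi> \<in> Hsp q 1" "\<eta> \<in> Hsp q 1"
  shows "ennreal ((ipnorm (hinner2 q 1) (\<psi>, \<eta>))\<^sup>2) = ennreal (1 - q) * (hh q \<psi> + hh q \<eta>)"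
proof -
  note a = hinner_self[OF assms(1,2,3)] and b = hinner_self[OF assms(1,2,4)]
  have "ennreal ((ipnorm (hinner2 q 1) (\<psi>, \<eta>))\<^sup>2)
      = ennreal (Re (hinner q 1 \<psi> \<psi>) + Re (hinner q 1 \<eta> \<eta>))"
    using a(1) b(1) by (simp add: ipnorm_def hinner2_def)
  then show ?thesis using a b by (simp add: distrib_left)
qed

lemma hh_add:
  assumes "0 < q" "entries_meas \<psi>" "entries_meas \<eta>"
  shows "hh q (\<psi> + \<eta>) \<le> 2 * hh q \<psi> + 2 * hh q \<eta>"
proof -
  have "hh q (\<psi> + \<eta>) \<le> (\<integral>\<^sup>+t. 2 * nnorm2 q (\<psi> t) + 2 * nnorm2 q (\<eta> t) \<partial>circle)"
    unfolding hh_def plus_fun_apply[of \<psi> \<eta>] by (intro nn_integral_mono nnorm2_add assms)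
  moreover note [measurable] = measurable_nnorm2[OF assms(2)] measurable_nnorm2[OF assms(3)]
  have "(\<integral>\<^sup>+t. 2 * nnorm2 q (\<psi> t) + 2 * nnorm2 q (\<eta> t) \<partial>circle) = 2 * hh q \<psi> + 2 * hh q \<eta>"
    unfolding hh_def by (subst nn_integral_add) (auto simp: nn_integral_cmult)
  ultimately show ?thesis by simp
qed

lemma hh_le:
  assumes "AE t in circle. nnorm2 q (\<psi> t) \<le> ennreal M * nnorm2 q (\<eta> t)" "entries_meas \<eta>"
  shows "hh q \<psi> \<le> ennreal M * hh q \<eta>"
proof -
  have "hh q \<psi> \<le> (\<integral>\<^sup>+t. ennreal M * nnorm2 q (\<eta> t) \<partial>circle)"
    unfolding hh_def using assms(1) by (rule nn_integral_mono_AE)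
  then show ?thesis using assms(2)
    by (simp add: hh_def nn_integral_cmult measurable_nnorm2)
qed

lemma entries_meas_add: "entries_meas \<psi> \<Longrightarrow> entries_meas \<eta> \<Longrightarrow> entries_meas (\<psi> + \<eta>)"
  unfolding entries_meas_def plus_fun_apply by (intro allI borel_measurable_add) auto

text \<open>Boundedness is stated through \<open>hh\<close> rather than the norm, so that no membership in the Hilbert
  space has to be checked when operators are combined.\<close>

definition hbdd :: "real \<Rightarrow> (matfun \<Rightarrow> matfun) \<Rightarrow> bool" where
  "hbdd q T \<longleftrightarrow> (\<exists>M. \<forall>\<psi>. entries_meas \<psi> \<longrightarrow> entries_meas (T \<psi>) \<and> hh q (T \<psi>) \<le> ennreal M * hh q \<psi>)"

lemma hbddD: "hbdd q T \<Longrightarrow> entries_meas \<psi> \<Longrightarrow> entries_meas (T \<psi>)"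
  by (auto simp: hbdd_def)

lemma hbdd_comp:
  assumes "hbdd q T" "hbdd q U"
  shows "hbdd q (\<lambda>\<psi>. T (U \<psi>))"
proof -
  obtain M where M: "\<And>\<psi>. entries_meas \<psi> \<Longrightarrow> entries_meas (T \<psi>) \<and> hh q (T \<psi>) \<le> ennreal M * hh q \<psi>"
    using assms(1) by (auto simp: hbdd_def)
  obtain N where N: "\<And>\<psi>. entries_meas \<psi> \<Longrightarrow> entries_meas (U \<psi>) \<and> hh q (U \<psi>) \<le> ennreal N * hh q \<psi>"
    using assms(2) by (auto simp: hbdd_def)
  have "hh q (T (U \<psi>)) \<le> ennreal (max M 0 * max N 0) * hh q \<psi>" if "entries_meas \<psi>" for \<psi>
  proof -
    have "hh q (T (U \<psi>)) \<le> ennreal M * hh q (U \<psi>)" using M N that by blast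
    also have "\<dots> \<le> ennreal M * (ennreal N * hh q \<psi>)" using N that by (intro mult_left_mono) auto
    also have "\<dots> \<le> ennreal (max M 0) * (ennreal (max N 0) * hh q \<psi>)"
      by (intro mult_mono ennreal_leI) auto
    finally show ?thesis by (simp add: ennreal_mult mult.assoc)
  qed
  then show ?thesis unfolding hbdd_def using M N by blast
qed

lemma hbdd_add:
  assumes "0 < q" "hbdd q T" "hbdd q U"
  shows "hbdd q (\<lambda>\<psi>. T \<psi> + U \<psi>)"
proof -
  obtain M where M: "\<And>\<psi>. entries_meas \<psi> \<Longrightarrow> entries_meas (T \<psi>) \<and> hh q (T \<psi>) \<le> ennreal M * hh q \<psi>"
    using assms(2) by (auto simp: hbdd_def)
  obtain N where N: "\<And>\<psi>. entries_meas \<psi> \<Longrightarrow> entries_meas (U \<psi>) \<and> hh q (U \<psi>) \<le> ennreal N * hh q \<psi>"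
    using assms(3) by (auto simp: hbdd_def)
  have "hh q (T \<psi> + U \<psi>) \<le> ennreal (2 * max M 0 + 2 * max N 0) * hh q \<psi>" if "entries_meas \<psi>" for \<psi>
  proof -
    have "hh q (T \<psi> + U \<psi>) \<le> 2 * hh q (T \<psi>) + 2 * hh q (U \<psi>)" using M N that assms(1) hh_add by blast
    also have "\<dots> \<le> 2 * (ennreal M * hh q \<psi>) + 2 * (ennreal N * hh q \<psi>)"
      using M N that by (intro add_mono mult_left_mono) auto
    also have "\<dots> \<le> 2 * (ennreal (max M 0) * hh q \<psi>) + 2 * (ennreal (max N 0) * hh q \<psi>)"
      by (intro add_mono mult_mono ennreal_leI) auto
    finally show ?thesis by (simp add: ennreal_mult distrib_right mult.assoc)
  qed
  then show ?thesis unfolding hbdd_def using M N entries_meas_add by blast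
qed

text \<open>The bound holds only almost everywhere in \<open>t\<close>, because for the angular derivative it is extracted
  from square integrability over the circle.\<close>

definition ubanded :: "matfun \<Rightarrow> bool" where
  "ubanded X \<longleftrightarrow> entries_meas X \<and> (\<exists>K C. (\<forall>t. banded K (X t)) \<and> (AE t in circle. bdd_mat C (X t)))"

lemma hbdd_lmul:
  assumes "0 < q" "ubanded X"
  shows "hbdd q (lmul X)"
proof -
  obtain K C where X: "entries_meas X" "\<And>t. banded K (X t)" "AE t in circle. bdd_mat C (X t)"
    using assms(2) by (auto simp: ubanded_def)
  have "entries_meas (lmul X \<psi>)" if "entries_meas \<psi>" for \<psi>
    using X(1) that unfolding entries_meas_def lmul_def mmul_banded_left[OF X(2)]
    by (intro allI borel_measurable_sum borel_measurable_times) auto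
  moreover have "hh q (lmul X \<psi>) \<le> ennreal ((real (2 * K + 1))\<^sup>2 * C\<^sup>2) * hh q \<psi>" if "entries_meas \<psi>" for \<psi>
  proof (rule hh_le[OF _ that])
    show "AE t in circle. nnorm2 q (lmul X \<psi> t) \<le> ennreal ((real (2 * K + 1))\<^sup>2 * C\<^sup>2) * nnorm2 q (\<psi> t)"
      using X(3) unfolding lmul_def by eventually_elim (rule nnorm2_mmul_left[OF assms(1) X(2)])
  qed
  ultimately show ?thesis unfolding hbdd_def by blast
qed

lemma hbdd_rmul:
  assumes "0 < q" "q < 1" "banded K A" "bdd_mat C A"
  shows "hbdd q (\<lambda>\<psi> t. \<psi> t \<odot> A)"
proof -
  have "entries_meas (\<lambda>t. \<psi> t \<odot> A)" if "entries_meas \<psi>" for \<psi>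
    using that unfolding entries_meas_def mmul_banded_right[OF assms(3)]
    by (intro allI borel_measurable_sum borel_measurable_times borel_measurable_const) auto
  moreover have "hh q (\<lambda>t. \<psi> t \<odot> A) \<le> ennreal ((real (2 * K + 1))\<^sup>2 * C\<^sup>2 * (1 / q ^ K)) * hh q \<psi>"
    if "entries_meas \<psi>" for \<psi>
    by (rule hh_le[OF AE_I2 that]) (rule nnorm2_mmul_right[OF assms])
  ultimately show ?thesis unfolding hbdd_def by blast
qed

lemma hbdd_scale:
  assumes "u \<in> borel_measurable circle" "\<And>t. cmod (u t) \<le> C"
  shows "hbdd q (\<lambda>\<psi> t. u t \<cdot> \<psi> t)"
proof -
  have "entries_meas (\<lambda>t. u t \<cdot> \<psi> t)" if "entries_meas \<psi>" for \<psi>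
    using that assms(1) unfolding entries_meas_def msc_def
    by (intro allI borel_measurable_times) auto
  moreover have "hh q (\<lambda>t. u t \<cdot> \<psi> t) \<le> ennreal (C\<^sup>2) * hh q \<psi>" if "entries_meas \<psi>" for \<psi>
  proof (rule hh_le[OF AE_I2 that])
    fix t
    show "nnorm2 q (u t \<cdot> \<psi> t) \<le> ennreal (C\<^sup>2) * nnorm2 q (\<psi> t)" unfolding nnorm2_msc
      using assms(2)[of t] by (intro mult_right_mono ennreal_leI power_mono) auto
  qed
  ultimately show ?thesis unfolding hbdd_def by blast
qed

text \<open>The block form is required only on S, because the twisted commutator agrees with its
  bounded expression only where the Leibniz rule applies. Membership of the image in the Hilbert
  space is a consequence of the bound.\<close>

lemma bounded_op_hinner2I:
  assumes q: "0 < q" "q < 1" and S: "S \<subseteq> Hsp q 1 \<times> Hsp q 1"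
    and T: "hbdd q T11" "hbdd q T12" "hbdd q T21" "hbdd q T22"
    and eq: "\<And>\<psi> \<eta>. (\<psi>, \<eta>) \<in> S \<Longrightarrow> T (\<psi>, \<eta>) = (T11 \<psi> + T12 \<eta>, T21 \<psi> + T22 \<eta>)"
  shows "bounded_op (hinner2 q 1) (Hsp q 1 \<times> Hsp q 1) S T"
proof -
  let ?b = "\<lambda>M T. \<forall>\<psi>. entries_meas \<psi> \<longrightarrow> hh q (T \<psi>) \<le> ennreal M * hh q \<psi>"
  have "\<exists>M\<ge>0. ?b M T" if T: "hbdd q T" for T
  proof -
    obtain M where M: "?b M T" using T by (auto simp: hbdd_def)
    have "ennreal M \<le> ennreal (max M 0)" by (intro ennreal_leI) auto
    then have "?b (max M 0) T" using M by (meson mult_right_mono order_trans zero_le)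
    then show ?thesis by (intro exI[of _ "max M 0"]) auto
  qed
  then obtain M11 M12 M21 M22 where
    M: "M11 \<ge> 0" "?b M11 T11" "M12 \<ge> 0" "?b M12 T12" "M21 \<ge> 0" "?b M21 T21" "M22 \<ge> 0" "?b M22 T22"
    using T by metis
  \<comment> \<open>The factor 2 is the one from \<open>hh_add\<close>.\<close>
  define M where "M = 2 * (M11 + M12 + M21 + M22)"
  have "M \<ge> 0" using M by (simp add: M_def)
  have *: "T (\<psi>, \<eta>) \<in> Hsp q 1 \<times> Hsp q 1 \<and>
      ipnorm (hinner2 q 1) (T (\<psi>, \<eta>)) \<le> sqrt M * ipnorm (hinner2 q 1) (\<psi>, \<eta>)"
    if in_S: "(\<psi>, \<eta>) \<in> S" for \<psi> \<eta>
  proof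
    have H: "\<psi> \<in> Hsp q 1" "\<eta> \<in> Hsp q 1" using S in_S by auto
    then have m: "entries_meas \<psi>" "entries_meas \<eta>" by (auto simp: Hsp_iff[OF q])
    let ?a = "T11 \<psi> + T12 \<eta>" and ?b = "T21 \<psi> + T22 \<eta>"
    have h: "hh q ?a + hh q ?b \<le> ennreal M * (hh q \<psi> + hh q \<eta>)"
    proof -
      have "hh q ?a + hh q ?b \<le> (2 * hh q (T11 \<psi>) + 2 * hh q (T12 \<eta>)) + (2 * hh q (T21 \<psi>) + 2 * hh q (T22 \<eta>))"
        using hbddD[OF T(1) m(1)] hbddD[OF T(2) m(2)] hbddD[OF T(3) m(1)] hbddD[OF T(4) m(2)] q(1)
        by (intro add_mono hh_add)
      also have "\<dots> \<le> (2 * (ennreal M11 * hh q \<psi>) + 2 * (ennreal M12 * hh q \<eta>))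
          + (2 * (ennreal M21 * hh q \<psi>) + 2 * (ennreal M22 * hh q \<eta>))"
        using M m by (intro add_mono mult_left_mono) auto
      also have "\<dots> \<le> (2 * (ennreal M11 * (hh q \<psi> + hh q \<eta>)) + 2 * (ennreal M12 * (hh q \<psi> + hh q \<eta>)))
          + (2 * (ennreal M21 * (hh q \<psi> + hh q \<eta>)) + 2 * (ennreal M22 * (hh q \<psi> + hh q \<eta>)))"
        by (intro add_mono mult_left_mono) auto
      also have "\<dots> = ennreal M * (hh q \<psi> + hh q \<eta>)"
      proof -
        have "ennreal M = 2 * (ennreal M11 + ennreal M12 + ennreal M21 + ennreal M22)"
          using M by (simp add: M_def ennreal_mult)
        then show ?thesis by (simp only: distrib_left distrib_right mult.assoc add_ac)
      qed
      finally show ?thesis .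
    qed
    have fin: "hh q \<psi> + hh q \<eta> < \<infinity>" using H by (auto simp: Hsp_iff[OF q])
    then have "hh q ?a + hh q ?b < \<infinity>"
      by (intro order_le_less_trans[OF h]) (auto simp: ennreal_mult_less_top)
    then have H': "?a \<in> Hsp q 1" "?b \<in> Hsp q 1"
      using entries_meas_add[OF hbddD[OF T(1) m(1)] hbddD[OF T(2) m(2)]]
        entries_meas_add[OF hbddD[OF T(3) m(1)] hbddD[OF T(4) m(2)]]
      by (auto simp: Hsp_iff[OF q])
    then show "T (\<psi>, \<eta>) \<in> Hsp q 1 \<times> Hsp q 1" using eq[OF in_S] by simp
    have "ennreal ((ipnorm (hinner2 q 1) (T (\<psi>, \<eta>)))\<^sup>2) = ennreal (1 - q) * (hh q ?a + hh q ?b)"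
      unfolding eq[OF in_S] by (rule ipnorm_hinner2[OF q H'])
    also have "\<dots> \<le> ennreal (1 - q) * (ennreal M * (hh q \<psi> + hh q \<eta>))"
      using h by (rule mult_left_mono) simp
    also have "\<dots> = ennreal M * ennreal ((ipnorm (hinner2 q 1) (\<psi>, \<eta>))\<^sup>2)"
      unfolding ipnorm_hinner2[OF q H] by (simp only: mult_ac)
    also have "\<dots> = ennreal ((sqrt M * ipnorm (hinner2 q 1) (\<psi>, \<eta>))\<^sup>2)"
      using \<open>M \<ge> 0\<close> by (simp add: ennreal_mult power_mult_distrib)
    finally have "(ipnorm (hinner2 q 1) (T (\<psi>, \<eta>)))\<^sup>2 \<le> (sqrt M * ipnorm (hinner2 q 1) (\<psi>, \<eta>))\<^sup>2"
      by simp
    moreover have "0 \<le> ipnorm (hinner2 q 1) (\<psi>, \<eta>)"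
      unfolding ipnorm_def using hinner_self(1)[OF q H(1)] hinner_self(1)[OF q H(2)]
      by (simp add: hinner2_def)
    ultimately show "ipnorm (hinner2 q 1) (T (\<psi>, \<eta>)) \<le> sqrt M * ipnorm (hinner2 q 1) (\<psi>, \<eta>)"
      using \<open>M \<ge> 0\<close> by (meson power2_le_imp_le mult_nonneg_nonneg real_sqrt_ge_zero)
  qed
  then have **: "T x \<in> Hsp q 1 \<times> Hsp q 1"
      "ipnorm (hinner2 q 1) (T x) \<le> sqrt M * ipnorm (hinner2 q 1) x" if "x \<in> S" for x
    using that by (cases x, simp only:)+
  show ?thesis unfolding bounded_op_def
    using S image_subsetI[of S T, OF **(1)] **(2) by blast
qed

subsection \<open>Functions on the circle\<close>

lemma space_circle [simp]: "space circle = {-pi..pi}"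
  by (simp add: circle_def)

lemma emeasure_circle: "emeasure circle (space circle) = ennreal (2 * pi)"
  by (simp add: circle_def emeasure_restrict_space)

lemma AE_circle: "(\<And>t. t \<in> {-pi..pi} \<Longrightarrow> P t) \<Longrightarrow> AE t in circle. P t"
  by (rule AE_I2) simp

lemma AE_circle_neq: "AE t in circle. t \<noteq> (a :: real)"
proof -
  have "AE t in lebesgue. t \<noteq> a"
    by (rule AE_I'[of "{a}"]) (auto simp: negligible_iff_null_sets[symmetric])
  then show ?thesis unfolding circle_def by (subst AE_restrict_space_iff) (auto elim: eventually_mono)
qed

lemma continuous_measurable_circle:
  fixes g :: "real \<Rightarrow> 'a :: euclidean_space"
  shows "continuous_on UNIV g \<Longrightarrow> g \<in> borel_measurable circle"
  unfolding circle_def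
  by (intro continuous_imp_measurable_on_sets_lebesgue) (auto intro: continuous_on_subset)

lemma C1S_deriv:
  assumes "g \<in> C1S"
  shows "(g has_vector_derivative vector_derivative g (at t)) (at t)"
    "continuous_on UNIV g" "continuous_on UNIV (\<lambda>t. vector_derivative g (at t))"
  using assms by (auto simp: C1S_def C1_differentiable_on_eq vector_derivative_works
      intro!: differentiable_imp_continuous_on differentiable_at_imp_differentiable_on)

lemma C1S_I:
  assumes "\<And>t. g (t + 2 * pi) = g t" "\<And>t. (g has_vector_derivative g' t) (at t)" "continuous_on UNIV g'"
  shows "g \<in> C1S"
  using assms unfolding C1S_def C1_differentiable_on_def by blast

lemma C1S_const: "(\<lambda>t. c) \<in> C1S"
  by (simp add: C1S_def)

lemma C1S_add: "f \<in> C1S \<Longrightarrow> g \<in> C1S \<Longrightarrow> (\<lambda>t. f t + g t) \<in> C1S"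
  by (simp add: C1S_def)

lemma C1S_mult: "f \<in> C1S \<Longrightarrow> g \<in> C1S \<Longrightarrow> (\<lambda>t. f t * g t) \<in> C1S"
  by (simp add: C1S_def)

lemma C1S_exp: "(\<lambda>t. exp (\<i> * complex_of_real t)) \<in> C1S"
proof (rule C1S_I)
  show "exp (\<i> * complex_of_real (t + 2 * pi)) = exp (\<i> * complex_of_real t)" for t
    using exp_two_pi_i' by (simp add: exp_add distrib_left mult.commute[of 2])
  show "((\<lambda>t. exp (\<i> * complex_of_real t)) has_vector_derivative \<i> * exp (\<i> * complex_of_real t)) (at t)" for t
    by (auto intro!: derivative_eq_intros has_vector_derivative_real_field)
  show "continuous_on UNIV (\<lambda>t. \<i> * exp (\<i> * complex_of_real t))"
    by (intro continuous_intros)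
qed

section \<open>Density of periodic C^1 functions in L_2 of the circle\<close>

definition approximable :: "(real \<Rightarrow> complex) \<Rightarrow> bool" where
  "approximable h \<longleftrightarrow> (\<forall>\<epsilon>>0. \<exists>g\<in>C1S. (\<integral>\<^sup>+t. ennreal ((cmod (h t - g t))\<^sup>2) \<partial>circle) < \<epsilon>)"

lemma cmod_diff_sq_le: "(cmod (a - c))\<^sup>2 \<le> 2 * (cmod (a - b))\<^sup>2 + 2 * (cmod (b - c))\<^sup>2"
proof -
  have "(cmod (a - c))\<^sup>2 \<le> (cmod (a - b) + cmod (b - c))\<^sup>2"
    by (intro power_mono) (auto intro: order_trans[OF _ norm_triangle_ineq])
  also have "\<dots> \<le> 2 * (cmod (a - b))\<^sup>2 + 2 * (cmod (b - c))\<^sup>2"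
    using sum_squares_bound[of "cmod (a - b)" "cmod (b - c)"] by (simp add: power2_sum)
  finally show ?thesis .
qed

text \<open>Dominated convergence closes the class under limits. It is applied along a chain:
  continuous functions of cis t, bounded continuous functions on the line, bounded measurable
  functions, square-integrable functions.\<close>

lemma approximable_limit:
  assumes h: "h \<in> borel_measurable circle" and hn: "\<And>n. f n \<in> borel_measurable circle"
    and w: "w \<in> borel_measurable circle"
    and lim: "AE t in circle. (\<lambda>n. f n t) \<longlonglongrightarrow> h t"
    and dom: "\<And>n. AE t in circle. cmod (f n t) \<le> w t" "AE t in circle. cmod (h t) \<le> w t"
    and fin: "(\<integral>\<^sup>+t. ennreal ((w t)\<^sup>2) \<partial>circle) < \<infinity>"
    and appr: "\<And>n. approximable (f n)"
  shows "approximable h"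
  unfolding approximable_def
proof (intro allI impI)
  fix \<epsilon> :: ennreal assume "\<epsilon> > 0"
  note [measurable] = h hn w
  have "(\<lambda>n. \<integral>\<^sup>+t. ennreal ((cmod (h t - f n t))\<^sup>2) \<partial>circle) \<longlonglongrightarrow> (\<integral>\<^sup>+t. 0 \<partial>circle)"
  proof (rule nn_integral_dominated_convergence)
    show "AE t in circle. ennreal ((cmod (h t - f n t))\<^sup>2) \<le> 4 * ennreal ((w t)\<^sup>2)" for n
      using dom(1)[of n] dom(2)
    proof eventually_elim
      case (elim t)
      then have "(cmod (h t - f n t))\<^sup>2 \<le> (2 * w t)\<^sup>2"
        by (intro power_mono order_trans[OF norm_triangle_ineq4]) auto
      then show ?case by (simp add: ennreal_mult'[symmetric] ennreal_leI power_mult_distrib flip: ennreal_numeral)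
    qed
    show "(\<integral>\<^sup>+t. 4 * ennreal ((w t)\<^sup>2) \<partial>circle) < \<infinity>"
      using fin by (simp add: nn_integral_cmult ennreal_mult_less_top)
    show "AE t in circle. (\<lambda>n. ennreal ((cmod (h t - f n t))\<^sup>2)) \<longlonglongrightarrow> 0"
      using lim
    proof eventually_elim
      case (elim t)
      then have "(\<lambda>n. (cmod (h t - f n t))\<^sup>2) \<longlonglongrightarrow> (cmod (h t - h t))\<^sup>2"
        by (intro tendsto_intros)
      then show ?case by (intro tendsto_ennrealI[of _ 0, simplified]) simp
    qed
  qed measurable
  moreover have "0 < \<epsilon> / 4" using \<open>\<epsilon> > 0\<close> by (simp add: ennreal_zero_less_divide)
  ultimately have "eventually (\<lambda>n. (\<integral>\<^sup>+t. ennreal ((cmod (h t - f n t))\<^sup>2) \<partial>circle) < \<epsilon> / 4) sequentially"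
    by (intro order_tendstoD) auto
  then obtain n where n: "(\<integral>\<^sup>+t. ennreal ((cmod (h t - f n t))\<^sup>2) \<partial>circle) < \<epsilon> / 4"
    by (auto simp: eventually_sequentially)
  obtain g where g: "g \<in> C1S" "(\<integral>\<^sup>+t. ennreal ((cmod (f n t - g t))\<^sup>2) \<partial>circle) < \<epsilon> / 4"
    using appr[of n] \<open>0 < \<epsilon> / 4\<close> unfolding approximable_def by blast
  have [measurable]: "g \<in> borel_measurable circle"
    using g(1) C1S_deriv(2) continuous_measurable_circle by blast
  have "(\<integral>\<^sup>+t. ennreal ((cmod (h t - g t))\<^sup>2) \<partial>circle)
     \<le> (\<integral>\<^sup>+t. 2 * ennreal ((cmod (h t - f n t))\<^sup>2) + 2 * ennreal ((cmod (f n t - g t))\<^sup>2) \<partial>circle)"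
  proof (rule nn_integral_mono)
    fix t
    have "ennreal ((cmod (h t - g t))\<^sup>2) \<le> ennreal (2 * (cmod (h t - f n t))\<^sup>2 + 2 * (cmod (f n t - g t))\<^sup>2)"
      by (intro ennreal_leI cmod_diff_sq_le)
    then show "ennreal ((cmod (h t - g t))\<^sup>2) \<le> 2 * ennreal ((cmod (h t - f n t))\<^sup>2) + 2 * ennreal ((cmod (f n t - g t))\<^sup>2)"
      by (simp add: ennreal_mult')
  qed
  also have "\<dots> = 2 * (\<integral>\<^sup>+t. ennreal ((cmod (h t - f n t))\<^sup>2) \<partial>circle) + 2 * (\<integral>\<^sup>+t. ennreal ((cmod (f n t - g t))\<^sup>2) \<partial>circle)"
    by (subst nn_integral_add) (auto simp: nn_integral_cmult)
  also have "\<dots> < 2 * (\<epsilon> / 4) + 2 * (\<epsilon> / 4)"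
    using n g(2) by (intro add_strict_mono ennreal_mult_strict_left_mono) auto
  also have "\<dots> = \<epsilon>"
  proof -
    have "2 * (\<epsilon> / 4) + 2 * (\<epsilon> / 4) = (4 * \<epsilon>) / 4"
      by (simp add: ennreal_times_divide mult_2[symmetric] mult.assoc[symmetric] flip: distrib_right add_divide_distrib_ennreal)
    also have "\<dots> = \<epsilon>" by (subst mult.commute) (simp add: ennreal_mult_divide_eq)
    finally show ?thesis .
  qed
  finally show "\<exists>g\<in>C1S. (\<integral>\<^sup>+t. ennreal ((cmod (h t - g t))\<^sup>2) \<partial>circle) < \<epsilon>" using g(1) by blast
qed

lemma finite_measure_circle: "(\<integral>\<^sup>+t. ennreal (c\<^sup>2) \<partial>circle) < \<infinity>"
  using emeasure_circle by (simp add: ennreal_mult_less_top)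

text \<open>Stone-Weierstrass for the algebra of continuous functions on the unit circle whose
  pullback along cis is C^1; Re and Im belong to it and separate points.\<close>

lemma trig_approx_real:
  fixes F :: "complex \<Rightarrow> real"
  assumes "continuous_on (sphere 0 1) F" "0 < e"
  shows "\<exists>p. (\<lambda>t. complex_of_real (p (cis t))) \<in> C1S \<and> (\<forall>x\<in>sphere 0 1. \<bar>F x - p x\<bar> < e)"
proof -
  let ?P = "\<lambda>p. continuous_on (sphere 0 1) p \<and> (\<lambda>t. complex_of_real (p (cis t))) \<in> C1S"
  have per: "cis (t + 2 * pi) = cis t" for t by (simp add: cis.ctr)
  have re: "?P Re"
  proof (intro conjI C1S_I)
    show "((\<lambda>t. complex_of_real (Re (cis t))) has_vector_derivative complex_of_real (- sin t)) (at t)" for t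
      by (auto intro!: derivative_eq_intros)
  qed (auto simp: per intro!: continuous_intros)
  have im: "?P Im"
  proof (intro conjI C1S_I)
    show "((\<lambda>t. complex_of_real (Im (cis t))) has_vector_derivative complex_of_real (cos t)) (at t)" for t
      by (auto intro!: derivative_eq_intros)
  qed (auto simp: per intro!: continuous_intros)
  have "\<exists>p. ?P p \<and> (\<forall>x\<in>sphere 0 1. \<bar>F x - p x\<bar> < e)"
  proof (rule Stone_Weierstrass_HOL[OF compact_sphere])
    show "\<exists>f. ?P f \<and> f x \<noteq> f y" if "x \<in> sphere 0 1 \<and> y \<in> sphere 0 1 \<and> x \<noteq> y" for x y
      using re im that complex_eq_iff by metis
  qed (use assms in \<open>auto simp: C1S_const intro!: continuous_intros C1S_add C1S_mult\<close>)
  then show ?thesis by blast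
qed

lemma trig_approx:
  fixes G :: "complex \<Rightarrow> complex"
  assumes "continuous_on (sphere 0 1) G" "0 < e"
  shows "\<exists>g\<in>C1S. \<forall>t. cmod (G (cis t) - g t) < e"
proof -
  have "continuous_on (sphere 0 1) (\<lambda>x. Re (G x))" "continuous_on (sphere 0 1) (\<lambda>x. Im (G x))"
    using assms(1) by (auto intro!: continuous_intros)
  then obtain p r where p: "(\<lambda>t. complex_of_real (p (cis t))) \<in> C1S" "\<And>x. x \<in> sphere 0 1 \<Longrightarrow> \<bar>Re (G x) - p x\<bar> < e / 2"
    and r: "(\<lambda>t. complex_of_real (r (cis t))) \<in> C1S" "\<And>x. x \<in> sphere 0 1 \<Longrightarrow> \<bar>Im (G x) - r x\<bar> < e / 2"
    using trig_approx_real[of _ "e / 2"] assms(2) by (metis half_gt_zero)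
  let ?g = "\<lambda>t. complex_of_real (p (cis t)) + \<i> * complex_of_real (r (cis t))"
  have "?g \<in> C1S" by (intro C1S_add C1S_mult C1S_const p r)
  moreover have "cmod (G (cis t) - ?g t) < e" for t
  proof -
    have "cmod (G (cis t) - ?g t) \<le> \<bar>Re (G (cis t) - ?g t)\<bar> + \<bar>Im (G (cis t) - ?g t)\<bar>"
      by (rule cmod_le)
    also have "\<dots> < e / 2 + e / 2" using p(2)[of "cis t"] r(2)[of "cis t"]
      by (intro add_strict_mono) auto
    finally show ?thesis by simp
  qed
  ultimately show ?thesis by (intro bexI[of _ ?g]) blast
qed

lemma approximable_cis:
  assumes "continuous_on (sphere 0 1) G"
  shows "approximable (\<lambda>t. G (cis t))"
proof -
  have "\<exists>g\<in>C1S. \<forall>t. cmod (G (cis t) - g t) < 1 / real (Suc n)" for n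
    using assms by (intro trig_approx) auto
  then obtain g where g: "\<And>n. g n \<in> C1S" "\<And>n t. cmod (G (cis t) - g n t) < 1 / real (Suc n)" by metis
  have c: "continuous_on UNIV (\<lambda>t. G (cis t))"
    by (rule continuous_on_compose2[OF assms]) (auto intro!: continuous_intros)
  have "compact (G ` sphere 0 1)" using assms by (intro compact_continuous_image) auto
  then have "bounded (G ` sphere 0 1)" by (rule compact_imp_bounded)
  then obtain B where "\<forall>x\<in>G ` sphere 0 1. cmod x \<le> B" unfolding bounded_iff by blast
  then have B: "cmod (G (cis t)) \<le> B" for t by simp
  show ?thesis
  proof (rule approximable_limit[where f = g and w = "\<lambda>_. B + 1"])
    show "(\<lambda>t. G (cis t)) \<in> borel_measurable circle" by (rule continuous_measurable_circle[OF c])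
    show "g n \<in> borel_measurable circle" for n by (rule continuous_measurable_circle[OF C1S_deriv(2)[OF g(1)]])
    show "AE t in circle. (\<lambda>n. g n t) \<longlonglongrightarrow> G (cis t)"
    proof (rule AE_circle)
      fix t
      show "(\<lambda>n. g n t) \<longlonglongrightarrow> G (cis t)"
      proof (rule Lim_transform2[OF tendsto_const])
        show "(\<lambda>n. G (cis t) - g n t) \<longlonglongrightarrow> 0"
          by (rule Lim_null_comparison[OF _ LIMSEQ_Suc[OF lim_1_over_n]])
            (use g(2) in \<open>auto intro!: always_eventually less_imp_le\<close>)
      qed
    qed
    show "AE t in circle. cmod (g n t) \<le> B + 1" for n
    proof (rule AE_circle)
      fix t
      have "cmod (g n t) \<le> cmod (G (cis t)) + cmod (G (cis t) - g n t)"
        by (metis norm_minus_commute norm_triangle_sub add.commute)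
      moreover have "1 / real (Suc n) \<le> 1" by simp
      ultimately show "cmod (g n t) \<le> B + 1" using B[of t] g(2)[of t n] by linarith
    qed
    show "AE t in circle. cmod (G (cis t)) \<le> B + 1"
      by (rule AE_circle) (use B in \<open>auto intro: add_increasing2\<close>)
    show "approximable (g n)" for n unfolding approximable_def
      by (intro allI impI bexI[of _ "g n"]) (auto simp: g(1))
  qed (use finite_measure_circle in auto)
qed

text \<open>A continuous function on the line does not descend to the circle, since its values at
  -\<pi> and \<pi> may differ. Multiplication by a cutoff \<open>\<nu> n\<close> that vanishes at -1
  removes the jump of Arg, and the cutoffs tend to 1 off the two end points.\<close>

lemma approximable_continuous:
  assumes k: "continuous_on UNIV k" and B: "\<And>t. cmod (k t) \<le> B"
  shows "approximable k"
proof -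
  define \<nu> where "\<nu> n w = complex_of_real (min 1 (real n * cmod (w + 1)))" for n :: nat and w :: complex
  define G where "G n w = k (Arg w) * \<nu> n w" for n w
  have chi: "cmod (\<nu> n w) \<le> 1" for n w by (simp add: \<nu>_def)
  have "continuous_on (sphere 0 1) (G n)" for n
  proof (rule continuous_at_imp_continuous_on, rule ballI)
    fix w :: complex assume w: "w \<in> sphere 0 1"
    have c\<nu>: "isCont (\<nu> n) w" unfolding \<nu>_def by (intro continuous_intros)
    show "isCont (G n) w"
    proof (cases "w = -1")
      case True
      have "\<nu> n \<midarrow>w\<rightarrow> 0" using c\<nu> by (simp add: isCont_def True \<nu>_def)
      then have "(\<lambda>w. B * cmod (\<nu> n w)) \<midarrow>w\<rightarrow> 0" by (intro tendsto_mult_right_zero tendsto_norm_zero)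
      then have "G n \<midarrow>w\<rightarrow> 0"
        by (rule Lim_null_comparison[rotated]) (auto simp: G_def norm_mult intro!: always_eventually mult_right_mono B)
      then show ?thesis by (simp add: isCont_def G_def True \<nu>_def)
    next
      case False
      have "w \<notin> \<real>\<^sub>\<le>\<^sub>0"
      proof
        assume "w \<in> \<real>\<^sub>\<le>\<^sub>0"
        then obtain x where "w = complex_of_real x" "x \<le> 0" by (auto elim: nonpos_Reals_cases)
        with w False show False by auto
      qed
      then have "isCont Arg w" by (rule continuous_at_Arg)
      moreover have "isCont k (Arg w)" using k by (simp add: continuous_on_eq_continuous_at)
      ultimately have "isCont (\<lambda>w. k (Arg w)) w" by (rule isCont_o2)
      then show ?thesis unfolding G_def using c\<nu> by (intro continuous_mult)
    qed
  qed
  then have app: "approximable (\<lambda>t. G n (cis t))" for n by (rule approximable_cis)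
  have cc: "continuous_on UNIV (\<lambda>t. k t * \<nu> n (cis t))" for n
    unfolding \<nu>_def using k by (intro continuous_intros)
  \<comment> \<open>At t = -\<pi> the argument of cis t is \<pi>, not t, but the cutoff makes both
    sides 0 there.\<close>
  have eq: "G n (cis t) = k t * \<nu> n (cis t)" if "t \<in> {-pi..pi}" for n t
  proof (cases "t = -pi")
    case True
    then have "cis t = -1" by (simp add: cis.ctr complex_eq_iff)
    then show ?thesis by (simp add: G_def \<nu>_def)
  next
    case False
    then show ?thesis using that by (simp add: G_def Arg_cis)
  qed
  have app': "approximable (\<lambda>t. k t * \<nu> n (cis t))" for n
  proof -
    have "(\<integral>\<^sup>+t. ennreal ((cmod (k t * \<nu> n (cis t) - g t))\<^sup>2) \<partial>circle)
        = (\<integral>\<^sup>+t. ennreal ((cmod (G n (cis t) - g t))\<^sup>2) \<partial>circle)" for g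
      by (rule nn_integral_cong) (simp add: eq)
    then show ?thesis using app[of n] by (simp add: approximable_def)
  qed
  have "B \<ge> 0" using B[of 0] norm_ge_zero order_trans by blast
  show ?thesis
  proof (rule approximable_limit[where f = "\<lambda>n t. k t * \<nu> n (cis t)" and w = "\<lambda>_. B"])
    show "k \<in> borel_measurable circle" by (rule continuous_measurable_circle[OF k])
    show "(\<lambda>t. k t * \<nu> n (cis t)) \<in> borel_measurable circle" for n by (rule continuous_measurable_circle[OF cc])
    show "AE t in circle. (\<lambda>n. k t * \<nu> n (cis t)) \<longlonglongrightarrow> k t"
      using AE_circle_neq[of pi] AE_circle_neq[of "-pi"] AE_space
    proof eventually_elim
      case (elim t)
      have "cis t \<noteq> -1"
      proof
        assume *: "cis t = -1"
        have "Arg (cis t) = t" using elim by (intro Arg_cis) auto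
        moreover have "Arg (cis pi) = pi" by (intro Arg_cis) (auto intro: pi_gt_zero order_less_trans)
        ultimately show False using * elim by simp
      qed
      then have pos: "0 < cmod (cis t + 1)" by (simp add: add_eq_0_iff2)
      then obtain N where N: "1 < real N * cmod (cis t + 1)" using reals_Archimedean3 by blast
      have "\<nu> n (cis t) = 1" if "n \<ge> N" for n
      proof -
        have "real N * cmod (cis t + 1) \<le> real n * cmod (cis t + 1)" using that by (intro mult_right_mono) auto
        then show ?thesis using N by (simp add: \<nu>_def)
      qed
      then have "eventually (\<lambda>n. k t * \<nu> n (cis t) = k t) sequentially"
        by (auto simp: eventually_sequentially intro!: exI[of _ N])
      then show ?case by (rule tendsto_eventually)
    qed
    show "AE t in circle. cmod (k t * \<nu> n (cis t)) \<le> B" for n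
    proof (rule AE_circle)
      fix t
      show "cmod (k t * \<nu> n (cis t)) \<le> B"
        using mult_mono[OF B[of t] chi[of n "cis t"]] \<open>B \<ge> 0\<close> by (simp add: norm_mult)
    qed
  qed (use B finite_measure_circle app' in auto)
qed

text \<open>Measurability gives continuous functions converging almost everywhere, possibly without
  a common bound. Composition with the nearest-point projection onto the ball of radius B bounds
  them, keeps continuity and fixes the limit.\<close>

lemma approximable_bounded:
  assumes h: "h \<in> borel_measurable circle" and B: "\<And>t. cmod (h t) \<le> B"
  shows "approximable h"
proof -
  have "B \<ge> 0" using B[of 0] norm_ge_zero order_trans by blast
  have "h measurable_on {-pi..pi}"
    using h unfolding circle_def by (subst measurable_on_iff_borel_measurable) auto
  then obtain N g where N: "negligible N" and g: "\<And>n. continuous_on UNIV (g n)"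
    and lim: "\<And>x. x \<notin> N \<Longrightarrow> (\<lambda>n. g n x) \<longlonglongrightarrow> (if x \<in> {-pi..pi} then h x else 0)"
    unfolding measurable_on_def by blast
  let ?c = "closest_point (cball 0 B) :: complex \<Rightarrow> complex"
  have ne: "cball 0 B \<noteq> ({} :: complex set)" using \<open>B \<ge> 0\<close> by auto
  have cc: "continuous_on UNIV ?c" by (rule continuous_on_closest_point) (use ne in auto)
  have cB: "cmod (?c x) \<le> B" for x using closest_point_in_set[OF closed_cball ne, of x] by simp
  have c: "continuous_on UNIV (\<lambda>t. ?c (g n t))" for n
    by (rule continuous_on_compose2[OF cc g]) auto
  show ?thesis
  proof (rule approximable_limit[where f = "\<lambda>n t. ?c (g n t)" and w = "\<lambda>_. B"])
    show "h \<in> borel_measurable circle" by (rule h)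
    show "(\<lambda>t. ?c (g n t)) \<in> borel_measurable circle" for n by (rule continuous_measurable_circle[OF c])
    have "AE t in lebesgue. t \<notin> N"
      using N by (auto simp: negligible_iff_null_sets intro!: AE_not_in)
    then have "AE t in circle. t \<notin> N" unfolding circle_def
      by (subst AE_restrict_space_iff) (auto elim: eventually_mono)
    then show "AE t in circle. (\<lambda>n. ?c (g n t)) \<longlonglongrightarrow> h t"
      using AE_space
    proof eventually_elim
      case (elim t)
      have "(\<lambda>n. g n t) \<longlonglongrightarrow> h t" using lim[of t] elim by simp
      then have "(\<lambda>n. ?c (g n t)) \<longlonglongrightarrow> ?c (h t)"
        using cc by (intro isCont_tendsto_compose[of _ ?c]) (auto simp: continuous_on_eq_continuous_at)
      then show ?case using B[of t] by (simp add: closest_point_self)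
    qed
    show "approximable (\<lambda>t. ?c (g n t))" for n by (rule approximable_continuous[OF c cB])
  qed (use B cB finite_measure_circle in auto)
qed

lemma approximable_L2:
  assumes h: "h \<in> borel_measurable circle" and fin: "(\<integral>\<^sup>+t. ennreal ((cmod (h t))\<^sup>2) \<partial>circle) < \<infinity>"
  shows "approximable h"
proof (rule approximable_limit[where f = "\<lambda>n t. if cmod (h t) \<le> real n then h t else 0" and w = "\<lambda>t. cmod (h t)"])
  note [measurable] = h
  show m: "(\<lambda>t. if cmod (h t) \<le> real n then h t else 0) \<in> borel_measurable circle" for n by measurable
  show "approximable (\<lambda>t. if cmod (h t) \<le> real n then h t else 0)" for n
    by (rule approximable_bounded[OF m, of _ n]) auto
  show "AE t in circle. (\<lambda>n. if cmod (h t) \<le> real n then h t else 0) \<longlonglongrightarrow> h t"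
  proof (rule AE_circle)
    fix t
    obtain N where "cmod (h t) \<le> real N" using real_arch_simple by blast
    then have "eventually (\<lambda>n. (if cmod (h t) \<le> real n then h t else 0) = h t) sequentially"
      by (auto simp: eventually_sequentially intro!: exI[of _ N])
    then show "(\<lambda>n. if cmod (h t) \<le> real n then h t else 0) \<longlonglongrightarrow> h t" by (rule tendsto_eventually)
  qed
qed (use h fin in auto)

subsection \<open>Tensor products\<close>

text \<open>Periodicity is dropped: the derivatives of C^1 functions enter only through their
  continuity, and all estimates are made on one period.\<close>

definition CT :: "(real \<Rightarrow> complex) set" where
  "CT = {g. continuous_on UNIV g}"

lemma C1S_subset_CT: "C1S \<subseteq> CT"
  using C1S_deriv(2) by (auto simp: CT_def)

lemma tensorE:
  assumes "\<phi> \<in> tensor A B"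
  obtains N :: nat and f g where "\<phi> = (\<lambda>t m n. \<Sum>j<N. f j m n * g j t)"
    "\<And>j. j < N \<Longrightarrow> f j \<in> A" "\<And>j. j < N \<Longrightarrow> g j \<in> B"
  using assms unfolding tensor_def by blast

lemma tensorI:
  fixes N :: nat
  assumes "\<And>j. j < N \<Longrightarrow> f j \<in> A" "\<And>j. j < N \<Longrightarrow> g j \<in> B"
  shows "(\<lambda>t m n. \<Sum>j<N. f j m n * g j t) \<in> tensor A B"
  using assms unfolding tensor_def by blast

lemma tensor_mono: "A \<subseteq> A' \<Longrightarrow> B \<subseteq> B' \<Longrightarrow> tensor A B \<subseteq> tensor A' B'"
  unfolding tensor_def by blast

lemma tensor_finite:
  assumes "finite J" "\<And>j. j \<in> J \<Longrightarrow> f j \<in> A" "\<And>j. j \<in> J \<Longrightarrow> g j \<in> B"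
  shows "(\<lambda>t m n. \<Sum>j\<in>J. f j m n * g j t) \<in> tensor A B"
proof -
  obtain h where h: "bij_betw h {0..<card J} J" using ex_bij_betw_nat_finite[OF assms(1)] by blast
  have eq: "(\<Sum>j\<in>J. f j m n * g j t) = (\<Sum>j<card J. f (h j) m n * g (h j) t)" for t m n
    using sum.reindex_bij_betw[OF h, of "\<lambda>j. f j m n * g j t"] by (simp add: atLeast0LessThan)
  show ?thesis unfolding eq
    using assms(2,3) bij_betwE[OF h] by (intro tensorI) auto
qed

lemma tensor_single: "f \<in> A \<Longrightarrow> g \<in> B \<Longrightarrow> (\<lambda>t m n. f m n * g t) \<in> tensor A B"
  using tensor_finite[of "{()}" "\<lambda>_. f" A "\<lambda>_. g" B] by simp

text \<open>Linearity in exactly the shape that a tensor has at fixed t, so that a map on matrices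
  can be applied pointwise in t and the result is again a tensor.\<close>

definition tlin :: "(mat \<Rightarrow> mat) \<Rightarrow> bool" where
  "tlin L \<longleftrightarrow> (\<forall>N f a. L (\<lambda>m n. \<Sum>j<(N :: nat). f j m n * a j) = (\<lambda>m n. \<Sum>j<N. L (f j) m n * a j))"

lemma tlin_mmul_left: "banded K C \<Longrightarrow> tlin (\<lambda>f. C \<odot> f)"
  by (simp add: tlin_def mmul_sum_right)

lemma tlin_mmul_right: "banded K C \<Longrightarrow> tlin (\<lambda>f. f \<odot> C)"
  by (simp add: tlin_def mmul_sum_left)

lemma tlin_id: "tlin (\<lambda>f. f)"
  by (simp add: tlin_def)

lemma tlin_comp: "tlin L \<Longrightarrow> tlin M \<Longrightarrow> tlin (\<lambda>f. L (M f))"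
  by (simp add: tlin_def)

lemma tlin_msc: "tlin (\<lambda>f. c \<cdot> f)"
  by (simp add: tlin_def msc_def fun_eq_iff sum_distrib_left mult_ac)

lemma tlin_diff: "tlin L \<Longrightarrow> tlin M \<Longrightarrow> tlin (\<lambda>f. L f - M f)"
  by (simp add: tlin_def fun_eq_iff left_diff_distrib sum_subtractf)

lemma tlin_sig: "tlin (sig q \<beta>)"
  by (simp add: tlin_def sig_def fun_eq_iff sum_distrib_left mult.assoc)

lemma tlin_dz: "tlin (dz q)"
  unfolding dz_def mcomm_def
  by (intro tlin_comp[OF tlin_msc] tlin_comp[OF tlin_mmul_left[OF banded_ypow]] tlin_diff
      tlin_mmul_left[OF banded_zstar] tlin_mmul_right[OF banded_zstar])

lemma tlin_dzbar: "tlin (dzbar q)"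
  unfolding dzbar_def mcomm_def
  by (intro tlin_comp[OF tlin_msc] tlin_comp[OF tlin_mmul_left[OF banded_ypow]] tlin_diff
      tlin_mmul_left[OF banded_zop] tlin_mmul_right[OF banded_zop])

lemma tensor_map:
  assumes "tlin L" "\<phi> \<in> tensor A B" "\<And>f. f \<in> A \<Longrightarrow> L f \<in> A'"
  shows "(\<lambda>t. L (\<phi> t)) \<in> tensor A' B"
proof -
  obtain N :: nat and f g where \<phi>: "\<phi> = (\<lambda>t m n. \<Sum>j<N. f j m n * g j t)"
    and fg: "\<And>j. j < N \<Longrightarrow> f j \<in> A" "\<And>j. j < N \<Longrightarrow> g j \<in> B"
    by (rule tensorE[OF assms(2)]) (rule that)
  have "(\<lambda>t. L (\<phi> t)) = (\<lambda>t m n. \<Sum>j<N. L (f j) m n * g j t)"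
    using assms(1) by (simp add: \<phi> tlin_def)
  then show ?thesis using tensorI[of N "\<lambda>j. L (f j)" A' g B] fg assms(3) by simp
qed

lemma CT_bounded:
  assumes "g \<in> CT"
  obtains C where "0 \<le> C" "\<And>t. t \<in> {-pi..pi} \<Longrightarrow> cmod (g t) \<le> C"
proof -
  have "compact (g ` {-pi..pi})"
    using assms by (intro compact_continuous_image) (auto simp: CT_def intro: continuous_on_subset)
  then have "bounded (g ` {-pi..pi})" by (rule compact_imp_bounded)
  then obtain C where C: "\<forall>x\<in>g ` {-pi..pi}. cmod x \<le> C" unfolding bounded_iff by blast
  have "0 \<in> {-pi..pi}" by simp
  then have "0 \<le> C" using C norm_ge_zero order_trans by blast
  with C that show thesis by blast
qed

lemma tensor_CT_meas:
  assumes "\<phi> \<in> tensor A CT" shows "entries_meas \<phi>"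
proof -
  obtain N :: nat and f g where \<phi>: "\<phi> = (\<lambda>t m n. \<Sum>j<N. f j m n * g j t)"
    and fg: "\<And>j. j < N \<Longrightarrow> f j \<in> A" "\<And>j. j < N \<Longrightarrow> g j \<in> CT"
    by (rule tensorE[OF assms]) (rule that)
  show ?thesis unfolding entries_meas_def \<phi> using fg
    by (intro allI borel_measurable_sum borel_measurable_times borel_measurable_const)
      (auto simp: CT_def intro!: continuous_measurable_circle)
qed

lemma tensor_Hsp:
  assumes q: "0 < q" "q < 1" and "\<phi> \<in> tensor (L2D q 1) CT"
  shows "\<phi> \<in> Hsp q 1"
proof -
  have "hh q (\<lambda>t m n. \<Sum>j<N. f j m n * g j t) < \<infinity>"
    if "\<And>j. j < N \<Longrightarrow> f j \<in> L2D q 1" "\<And>j. j < N \<Longrightarrow> g j \<in> CT" for N :: nat and f :: "nat \<Rightarrow> mat" and g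
    using that
  proof (induction N)
    case 0
    then show ?case by (simp add: hh_def nnorm2_def)
  next
    case (Suc N)
    let ?p = "\<lambda>t m n. \<Sum>j<N. f j m n * g j t" and ?s = "\<lambda>t m n. f N m n * g N t"
    have "?p \<in> tensor (L2D q 1) CT" "?s \<in> tensor (L2D q 1) CT"
      using Suc.prems by (auto intro: tensorI tensor_single)
    then have m: "entries_meas ?p" "entries_meas ?s" by (auto intro: tensor_CT_meas)
    obtain C where C: "0 \<le> C" "\<And>t. t \<in> {-pi..pi} \<Longrightarrow> cmod (g N t) \<le> C"
      using CT_bounded Suc.prems(2) by blast
    have "hh q ?s \<le> (\<integral>\<^sup>+t. ennreal (C\<^sup>2) * nnorm2 q (f N) \<partial>circle)"
      unfolding hh_def
    proof (rule nn_integral_mono)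
      fix t assume "t \<in> space circle"
      have "?s t = g N t \<cdot> f N" by (simp add: msc_def fun_eq_iff mult.commute)
      then show "nnorm2 q (?s t) \<le> ennreal (C\<^sup>2) * nnorm2 q (f N)"
        using C \<open>t \<in> space circle\<close> by (simp add: nnorm2_msc) (intro mult_right_mono ennreal_leI power_mono; simp)
    qed
    also have "\<dots> < \<infinity>"
      using Suc.prems(1)[of N] q emeasure_circle by (simp add: L2D_iff ennreal_mult_less_top)
    finally have "2 * hh q ?p + 2 * hh q ?s < \<infinity>"
      using Suc by (simp add: ennreal_mult_less_top)
    then have "hh q (?p + ?s) < \<infinity>"
      using hh_add[OF q(1) m] by (rule order_le_less_trans[rotated])
    then show ?case by (simp add: plus_fun_def)
  qed
  moreover obtain N :: nat and f g where "\<phi> = (\<lambda>t m n. \<Sum>j<N. f j m n * g j t)"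
    "\<And>j. j < N \<Longrightarrow> f j \<in> L2D q 1" "\<And>j. j < N \<Longrightarrow> g j \<in> CT"
    by (rule tensorE[OF assms(3)]) (rule that)
  ultimately have "hh q \<phi> < \<infinity>" by blast
  then show ?thesis using tensor_CT_meas[OF assms(3)] by (simp add: Hsp_iff q)
qed

lemma ubanded_tensor:
  assumes q: "0 < q" "q < 1" and "\<phi> \<in> tensor (FD q) CT"
  shows "ubanded \<phi>"
proof -
  obtain N :: nat and f g where \<phi>: "\<phi> = (\<lambda>t m n. \<Sum>j<N. f j m n * g j t)"
    and fg: "\<And>j. j < N \<Longrightarrow> f j \<in> FD q" "\<And>j. j < N \<Longrightarrow> g j \<in> CT"
    by (rule tensorE[OF assms(3)]) (rule that)
  have "\<forall>j. \<exists>K C. j < N \<longrightarrow> banded K (f j) \<and> bdd_mat C (f j)" using fg(1) FD_iff[OF q] by blast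
  then obtain K C where KC: "\<And>j. j < N \<Longrightarrow> banded (K j) (f j)" "\<And>j. j < N \<Longrightarrow> bdd_mat (C j) (f j)" by metis
  have "\<forall>j. \<exists>D. j < N \<longrightarrow> 0 \<le> D \<and> (\<forall>t\<in>{-pi..pi}. cmod (g j t) \<le> D)" using fg(2) CT_bounded by metis
  then obtain D where D: "\<And>j. j < N \<Longrightarrow> 0 \<le> D j" "\<And>j t. j < N \<Longrightarrow> t \<in> {-pi..pi} \<Longrightarrow> cmod (g j t) \<le> D j" by metis
  \<comment> \<open>The sum of the bandwidths dominates each of them, which gives one bandwidth
    valid for all t.\<close>
  have "banded (\<Sum>j<N. K j) (\<phi> t)" for t
    unfolding banded_def
  proof (intro allI impI)
    fix m n assume mn: "m + (\<Sum>j<N. K j) < n \<or> n + (\<Sum>j<N. K j) < m"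
    have "f j m n = 0" if "j < N" for j
    proof (rule bandedD[OF KC(1)[OF that]])
      have "K j \<le> (\<Sum>j<N. K j)" using that by (intro member_le_sum) auto
      with mn show "m + K j < n \<or> n + K j < m" by linarith
    qed
    then show "\<phi> t m n = 0" by (simp add: \<phi>)
  qed
  moreover have "AE t in circle. bdd_mat (\<Sum>j<N. C j * D j) (\<phi> t)"
  proof (rule AE_circle)
    fix t assume t: "t \<in> {-pi..pi}"
    show "bdd_mat (\<Sum>j<N. C j * D j) (\<phi> t)" unfolding bdd_mat_def
    proof (intro allI)
      fix m n
      show "cmod (\<phi> t m n) \<le> (\<Sum>j<N. C j * D j)" unfolding \<phi>
        using KC(2) D t bdd_mat_nonneg[OF KC(2)]
        by (intro order_trans[OF norm_sum] sum_mono) (auto simp: norm_mult bdd_mat_def intro!: mult_mono)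
    qed
  qed
  ultimately show ?thesis
    unfolding ubanded_def using tensor_CT_meas[OF assms(3)] by blast
qed

lemma ddt_tensor:
  fixes N :: nat
  assumes "\<And>j. j < N \<Longrightarrow> g j \<in> C1S"
  shows "((\<lambda>\<tau>. \<Sum>j<N. f j m n * g j \<tau>) has_vector_derivative
      (\<Sum>j<N. f j m n * vector_derivative (g j) (at t))) (at t)"
    "ddt (\<lambda>t m n. \<Sum>j<N. f j m n * g j t) = (\<lambda>t m n. \<Sum>j<N. f j m n * vector_derivative (g j) (at t))"
proof -
  show *: "((\<lambda>\<tau>. \<Sum>j<N. f j m n * g j \<tau>) has_vector_derivative
      (\<Sum>j<N. f j m n * vector_derivative (g j) (at t))) (at t)" for m n t
    using C1S_deriv(1)[OF assms]
    by (intro has_vector_derivative_sum) (auto intro!: has_vector_derivative_mult_right)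
  show "ddt (\<lambda>t m n. \<Sum>j<N. f j m n * g j t) = (\<lambda>t m n. \<Sum>j<N. f j m n * vector_derivative (g j) (at t))"
    unfolding ddt_def by (intro ext vector_derivative_at *)
qed

lemma ddt_in_tensor:
  assumes "\<phi> \<in> tensor A C1S" shows "ddt \<phi> \<in> tensor A CT"
proof -
  obtain N :: nat and f g where \<phi>: "\<phi> = (\<lambda>t m n. \<Sum>j<N. f j m n * g j t)"
    and fg: "\<And>j. j < N \<Longrightarrow> f j \<in> A" "\<And>j. j < N \<Longrightarrow> g j \<in> C1S"
    by (rule tensorE[OF assms]) (rule that)
  have d: "ddt \<phi> = (\<lambda>t m n. \<Sum>j<N. f j m n * vector_derivative (g j) (at t))"
    unfolding \<phi> by (rule ddt_tensor(2)) (rule fg(2))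
  show ?thesis unfolding d
    using fg C1S_deriv(3) by (intro tensorI) (auto simp: CT_def)
qed

lemma tensor_has_derivative:
  assumes "\<phi> \<in> tensor A C1S"
  shows "((\<lambda>\<tau>. \<phi> \<tau> m n) has_vector_derivative ddt \<phi> t m n) (at t)"
proof -
  obtain N :: nat and f g where \<phi>: "\<phi> = (\<lambda>t m n. \<Sum>j<N. f j m n * g j t)"
    and fg: "\<And>j. j < N \<Longrightarrow> f j \<in> A" "\<And>j. j < N \<Longrightarrow> g j \<in> C1S"
    by (rule tensorE[OF assms]) (rule that)
  have d: "ddt \<phi> = (\<lambda>t m n. \<Sum>j<N. f j m n * vector_derivative (g j) (at t))"
    unfolding \<phi> by (rule ddt_tensor(2)) (rule fg(2))
  show ?thesis unfolding d unfolding \<phi> by (rule ddt_tensor(1)) (rule fg(2))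
qed

lemma tensor_uniform_banded:
  assumes "\<phi> \<in> tensor A C1S" "\<And>f. f \<in> A \<Longrightarrow> \<exists>K. banded K f"
  obtains K where "\<And>t. banded K (\<phi> t)" "\<And>t. banded K (ddt \<phi> t)"
proof -
  obtain N :: nat and f g where \<phi>: "\<phi> = (\<lambda>t m n. \<Sum>j<N. f j m n * g j t)"
    and fg: "\<And>j. j < N \<Longrightarrow> f j \<in> A" "\<And>j. j < N \<Longrightarrow> g j \<in> C1S"
    by (rule tensorE[OF assms(1)]) (rule that)
  have "\<forall>j. \<exists>K. j < N \<longrightarrow> banded K (f j)" using fg assms by blast
  then obtain K where K: "\<And>j. j < N \<Longrightarrow> banded (K j) (f j)" by metis
  have z: "f j m n = 0" if "m + (\<Sum>j<N. K j) < n \<or> n + (\<Sum>j<N. K j) < m" "j < N" for m n j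
  proof (rule bandedD[OF K[OF that(2)]])
    have "K j \<le> (\<Sum>j<N. K j)" using that by (intro member_le_sum) auto
    with that(1) show "m + K j < n \<or> n + K j < m" by linarith
  qed
  have d: "ddt \<phi> = (\<lambda>t m n. \<Sum>j<N. f j m n * vector_derivative (g j) (at t))"
    unfolding \<phi> by (rule ddt_tensor(2)) (rule fg(2))
  show thesis
    by (rule that[of "\<Sum>j<N. K j"]) (auto simp: banded_def z d, auto simp: z \<phi>)
qed

lemma tensor_lmul:
  assumes "\<phi> \<in> tensor A B" "\<psi> \<in> tensor A' B"
    and "\<And>f. f \<in> A \<Longrightarrow> \<exists>K. banded K f" "\<And>f. f \<in> A' \<Longrightarrow> \<exists>K. banded K f"
    and "\<And>f g. f \<in> A \<Longrightarrow> g \<in> A' \<Longrightarrow> f \<odot> g \<in> A''"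
    and "\<And>u v. u \<in> B \<Longrightarrow> v \<in> B \<Longrightarrow> (\<lambda>t. u t * v t) \<in> B"
  shows "lmul \<phi> \<psi> \<in> tensor A'' B"
proof -
  obtain N :: nat and f g where \<phi>: "\<phi> = (\<lambda>t m n. \<Sum>j<N. f j m n * g j t)"
    and fg: "\<And>j. j < N \<Longrightarrow> f j \<in> A" "\<And>j. j < N \<Longrightarrow> g j \<in> B"
    by (rule tensorE[OF assms(1)]) (rule that)
  obtain N' :: nat and f' g' where \<psi>: "\<psi> = (\<lambda>t m n. \<Sum>j<N'. f' j m n * g' j t)"
    and fg': "\<And>j. j < N' \<Longrightarrow> f' j \<in> A'" "\<And>j. j < N' \<Longrightarrow> g' j \<in> B"
    by (rule tensorE[OF assms(2)]) (rule that)
  have 1: "f j \<odot> \<psi> t = (\<lambda>m n. \<Sum>k<N'. (f j \<odot> f' k) m n * g' k t)" if j: "j < N" for j t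
  proof -
    obtain K where "banded K (f j)" using assms(3)[OF fg(1)[OF j]] by blast
    then show ?thesis unfolding \<psi> by (rule mmul_sum_right)
  qed
  have "\<phi> t \<odot> \<psi> t = (\<lambda>m n. \<Sum>j<N. (f j \<odot> \<psi> t) m n * g j t)" for t
  proof -
    have "\<forall>k. \<exists>K. k < N' \<longrightarrow> banded K (f' k)" using fg' assms by blast
    then obtain K where K: "\<And>k. k < N' \<Longrightarrow> banded (K k) (f' k)" by metis
    have "banded (\<Sum>k<N'. K k) (\<psi> t)" unfolding banded_def
    proof (intro allI impI)
      fix m n assume mn: "m + (\<Sum>j<N'. K j) < n \<or> n + (\<Sum>j<N'. K j) < m"
      have "f' j m n = 0" if "j < N'" for j
      proof (rule bandedD[OF K[OF that]])
        have "K j \<le> (\<Sum>j<N'. K j)" using that by (intro member_le_sum) auto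
        with mn show "m + K j < n \<or> n + K j < m" by linarith
      qed
      then show "\<psi> t m n = 0" by (simp add: \<psi>)
    qed
    then show ?thesis unfolding \<phi> by (rule mmul_sum_left)
  qed
  then have "lmul \<phi> \<psi> = (\<lambda>t m n. \<Sum>j<N. \<Sum>k<N'. (f j \<odot> f' k) m n * (g j t * g' k t))"
    by (auto simp: lmul_def fun_eq_iff 1 sum_distrib_right sum_distrib_left mult_ac intro!: sum.cong)
  also have "\<dots> = (\<lambda>t m n. \<Sum>p\<in>{..<N}\<times>{..<N'}. (f (fst p) \<odot> f' (snd p)) m n * (g (fst p) t * g' (snd p) t))"
    by (simp add: sum.cartesian_product case_prod_unfold)
  also have "\<dots> \<in> tensor A'' B"
    using fg fg' assms(5,6) by (intro tensor_finite) auto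
  finally show ?thesis .
qed

text \<open>A bandwidth independent of t turns each entry of the product into a finite sum over a
  fixed index set, to which the product rule applies term by term.\<close>

lemma ddt_lmul:
  assumes "\<phi> \<in> tensor A C1S" "\<psi> \<in> tensor A' C1S" "\<And>f. f \<in> A \<Longrightarrow> \<exists>K. banded K f"
  shows "ddt (lmul \<phi> \<psi>) = lmul (ddt \<phi>) \<psi> + lmul \<phi> (ddt \<psi>)"
proof (intro ext)
  fix t m n
  obtain K where K: "\<And>t. banded K (\<phi> t)" "\<And>t. banded K (ddt \<phi> t)"
    by (rule tensor_uniform_banded[OF assms(1)]; blast intro: assms(3) that)
  have "((\<lambda>\<tau>. \<Sum>k\<in>{m-K..m+K}. \<phi> \<tau> m k * \<psi> \<tau> k n) has_vector_derivative
     (\<Sum>k\<in>{m-K..m+K}. \<phi> t m k * ddt \<psi> t k n + ddt \<phi> t m k * \<psi> t k n)) (at t)"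
    by (intro has_vector_derivative_sum has_vector_derivative_mult
        tensor_has_derivative[OF assms(1)] tensor_has_derivative[OF assms(2)])
  then have "((\<lambda>\<tau>. lmul \<phi> \<psi> \<tau> m n) has_vector_derivative (lmul (ddt \<phi>) \<psi> + lmul \<phi> (ddt \<psi>)) t m n) (at t)"
    by (simp add: lmul_def mmul_banded_left[OF K(1)] mmul_banded_left[OF K(2)] sum.distrib add.commute)
  then show "ddt (lmul \<phi> \<psi>) t m n = (lmul (ddt \<phi>) \<psi> + lmul \<phi> (ddt \<psi>)) t m n"
    unfolding ddt_def[of "lmul \<phi> \<psi>"] by (rule vector_derivative_at)
qed

subsection \<open>Density\<close>

definition unit_mat :: "nat \<Rightarrow> nat \<Rightarrow> mat" where
  "unit_mat i j = (\<lambda>m n. if m = i \<and> n = j then 1 else 0)"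

text \<open>The squared norm is a series over the matrix entries. Entries beyond the first L
  contribute less than \<epsilon>/2 and are replaced by 0; each of the remaining ones is
  approximated in L_2 of the circle by a C^1 function, which is attached to its matrix unit.\<close>

lemma tensor_dense:
  assumes q: "0 < q" "q < 1" and A: "\<And>i j. unit_mat i j \<in> A"
    and \<psi>: "\<psi> \<in> Hsp q 1" and "0 < \<epsilon>" "\<epsilon> \<noteq> top"
  shows "\<exists>\<eta>\<in>tensor A C1S. hh q (\<psi> - \<eta>) < \<epsilon>"
proof -
  have m: "entries_meas \<psi>" and fin: "hh q \<psi> < \<infinity>" using \<psi> by (auto simp: Hsp_iff q)
  define en where "en \<phi> p = (\<integral>\<^sup>+t. ennreal (q ^ snd p * (cmod (\<phi> t (fst p) (snd p)))\<^sup>2) \<partial>circle)" for \<phi> :: matfun and p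
  have hh_en: "hh q \<phi> = (\<Sum>i. en \<phi> (prod.swap (prod_decode i)))" if "entries_meas \<phi>" for \<phi>
  proof -
    note [measurable] = entries_measD[OF that]
    have "hh q \<phi> = (\<Sum>n. \<integral>\<^sup>+t. (\<Sum>m. ennreal (q ^ n * (cmod (\<phi> t m n))\<^sup>2)) \<partial>circle)"
      unfolding hh_def nnorm2_def by (rule nn_integral_suminf) measurable
    also have "\<dots> = (\<Sum>n. \<Sum>m. en \<phi> (m, n))"
      unfolding en_def by (subst nn_integral_suminf) auto
    also have "\<dots> = (\<Sum>i. en \<phi> (prod.swap (prod_decode i)))"
      by (rule suminf_ennreal_2dimen[symmetric, of _ "\<lambda>p. en \<phi> (prod.swap p)"]) simp
    finally show ?thesis .
  qed
  let ?p = "\<lambda>i. prod.swap (prod_decode i)"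
  have "(\<lambda>L. (\<Sum>i. en \<psi> (?p i)) - (\<Sum>i<L. en \<psi> (?p i))) \<longlonglongrightarrow> (\<Sum>i. en \<psi> (?p i)) - (\<Sum>i. en \<psi> (?p i))"
    using fin by (intro tendsto_diff_ennreal summable_LIMSEQ tendsto_const) (auto simp: hh_en[OF m])
  moreover have "(\<Sum>i. en \<psi> (?p i)) - (\<Sum>i. en \<psi> (?p i)) = 0"
    using fin by (simp add: hh_en[OF m])
  moreover have e2: "0 < \<epsilon> / 2" using \<open>0 < \<epsilon>\<close> by (simp add: ennreal_zero_less_divide)
  ultimately have "eventually (\<lambda>L. (\<Sum>i. en \<psi> (?p i)) - (\<Sum>i<L. en \<psi> (?p i)) < \<epsilon> / 2) sequentially"
    by (intro order_tendstoD(2)) auto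
  then obtain L where L: "(\<Sum>i. en \<psi> (?p i)) - (\<Sum>i<L. en \<psi> (?p i)) < \<epsilon> / 2"
    by (auto simp: eventually_sequentially)
  have tail: "(\<Sum>i. en \<psi> (?p (i + L))) < \<epsilon> / 2"
  proof -
    have f: "(\<Sum>i<L. en \<psi> (?p i)) \<noteq> top"
    proof -
      have "(\<Sum>i<L. en \<psi> (?p i)) \<le> (\<Sum>i. en \<psi> (?p i))" by (intro sum_le_suminf) auto
      also have "\<dots> < top" using fin by (simp add: hh_en[OF m])
      finally show ?thesis by (rule less_imp_neq)
    qed
    have "(\<Sum>i. en \<psi> (?p i)) = (\<Sum>i. en \<psi> (?p (i + L))) + (\<Sum>i<L. en \<psi> (?p i))"
      by (rule suminf_offset) simp
    then show ?thesis using L f by simp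
  qed
  \<comment> \<open>The tolerance \<epsilon>/2 is shared among L entries; L+1 in the denominator
    also covers L = 0.\<close>
  have "\<exists>g\<in>C1S. (\<integral>\<^sup>+t. ennreal ((cmod (\<psi> t m n - g t))\<^sup>2) \<partial>circle) < \<epsilon> / 2 / ennreal (real (Suc L))" for m n
  proof -
    note [measurable] = entries_measD[OF m]
    have "(\<integral>\<^sup>+t. ennreal ((cmod (\<psi> t m n))\<^sup>2) \<partial>circle) < \<infinity>"
    proof -
      have "en \<psi> (?p (prod_encode (n, m))) \<le> (\<Sum>i. en \<psi> (?p i))"
        using sum_le_suminf[of "\<lambda>i. en \<psi> (?p i)" "{prod_encode (n, m)}"] by simp
      then have "en \<psi> (m, n) < \<infinity>" using fin by (simp add: hh_en[OF m] order_le_less_trans)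
      then have "ennreal (q ^ n) * (\<integral>\<^sup>+t. ennreal ((cmod (\<psi> t m n))\<^sup>2) \<partial>circle) < \<infinity>"
        using q(1) by (simp add: en_def ennreal_mult nn_integral_cmult)
      then show ?thesis using q(1) by (auto simp: ennreal_mult_less_top)
    qed
    then have "approximable (\<lambda>t. \<psi> t m n)"
      using entries_measD[OF m] by (intro approximable_L2)
    moreover have "0 < \<epsilon> / 2 / ennreal (real (Suc L))"
      using e2 by (simp add: ennreal_zero_less_divide del: of_nat_Suc)
    ultimately show ?thesis unfolding approximable_def by blast
  qed
  then obtain g where g: "\<And>m n. g m n \<in> C1S"
    "\<And>m n. (\<integral>\<^sup>+t. ennreal ((cmod (\<psi> t m n - g m n t))\<^sup>2) \<partial>circle) < \<epsilon> / 2 / ennreal (real (Suc L))"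
    by metis
  define \<eta> where "\<eta> = (\<lambda>t m n. \<Sum>i<L. unit_mat (fst (?p i)) (snd (?p i)) m n * g (fst (?p i)) (snd (?p i)) t)"
  have \<eta>_T: "\<eta> \<in> tensor A C1S" unfolding \<eta>_def by (intro tensorI A g)
  have \<eta>: "\<eta> t m n = (if prod_encode (n, m) < L then g m n t else 0)" for t m n
  proof -
    have "\<eta> t m n = (\<Sum>i<L. if i = prod_encode (n, m) then g m n t else 0)"
      unfolding \<eta>_def
    proof (rule sum.cong[OF refl])
      fix i
      have "(m = fst (?p i) \<and> n = snd (?p i)) \<longleftrightarrow> i = prod_encode (n, m)"
        by (metis fst_conv snd_conv fst_swap snd_swap prod_decode_inverse prod_encode_inverse prod.collapse)
      then show "unit_mat (fst (?p i)) (snd (?p i)) m n * g (fst (?p i)) (snd (?p i)) t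
        = (if i = prod_encode (n, m) then g m n t else 0)"
        by (auto simp: unit_mat_def)
    qed
    then show ?thesis by simp
  qed
  have m\<eta>: "entries_meas \<eta>" using \<eta>_T tensor_mono[OF order_refl C1S_subset_CT] tensor_CT_meas by blast
  have md: "entries_meas (\<psi> - \<eta>)"
    unfolding entries_meas_def fun_diff_def
    by (intro allI borel_measurable_diff entries_measD m m\<eta>)
  have "hh q (\<psi> - \<eta>) = (\<Sum>i. en (\<psi> - \<eta>) (?p (i + L))) + (\<Sum>i<L. en (\<psi> - \<eta>) (?p i))"
    unfolding hh_en[OF md] by (rule suminf_offset) simp
  also have "(\<Sum>i. en (\<psi> - \<eta>) (?p (i + L))) = (\<Sum>i. en \<psi> (?p (i + L)))"
    by (simp add: en_def \<eta>)
  also have "(\<Sum>i<L. en (\<psi> - \<eta>) (?p i)) \<le> (\<Sum>i<L. \<epsilon> / 2 / ennreal (real (Suc L)))"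
  proof (rule sum_mono)
    fix i assume "i \<in> {..<L}"
    define mm nn where "mm = fst (?p i)" and "nn = snd (?p i)"
    have i: "prod_encode (nn, mm) < L" using \<open>i \<in> {..<L}\<close> by (simp add: mm_def nn_def)
    have "en (\<psi> - \<eta>) (?p i) \<le> (\<integral>\<^sup>+t. ennreal ((cmod (\<psi> t mm nn - g mm nn t))\<^sup>2) \<partial>circle)"
      unfolding en_def mm_def[symmetric] nn_def[symmetric]
    proof (intro nn_integral_mono ennreal_leI)
      fix t
      have "q ^ nn \<le> 1" using q by (simp add: power_le_one)
      then have "q ^ nn * (cmod (\<psi> t mm nn - g mm nn t))\<^sup>2 \<le> 1 * (cmod (\<psi> t mm nn - g mm nn t))\<^sup>2"
        by (intro mult_right_mono) auto
      then show "q ^ nn * (cmod ((\<psi> - \<eta>) t mm nn))\<^sup>2 \<le> (cmod (\<psi> t mm nn - g mm nn t))\<^sup>2"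
        using i by (simp add: \<eta>)
    qed
    then show "en (\<psi> - \<eta>) (?p i) \<le> \<epsilon> / 2 / ennreal (real (Suc L))" using g(2)[of mm nn] by simp
  qed
  also have "(\<Sum>i<L. \<epsilon> / 2 / ennreal (real (Suc L))) \<le> \<epsilon> / 2"
  proof -
    have "(\<Sum>i<L. \<epsilon> / 2 / ennreal (real (Suc L))) = ennreal (real L) * (\<epsilon> / 2 / ennreal (real (Suc L)))"
      by (simp add: ennreal_of_nat_eq_real_of_nat)
    also have "\<dots> \<le> ennreal (real (Suc L)) * (\<epsilon> / 2 / ennreal (real (Suc L)))"
      by (intro mult_right_mono ennreal_leI) auto
    also have "\<dots> = \<epsilon> / 2"
      by (subst ennreal_times_divide, subst mult.commute, rule ennreal_mult_divide_eq) auto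
    finally show ?thesis .
  qed
  also have "(\<Sum>i. en \<psi> (?p (i + L))) + \<epsilon> / 2 < \<epsilon>"
  proof -
    have "\<epsilon> / 2 \<noteq> top" using \<open>\<epsilon> \<noteq> top\<close> by (simp add: ennreal_divide_eq_top_iff)
    then have "\<epsilon> / 2 + (\<Sum>i. en \<psi> (?p (i + L))) < \<epsilon> / 2 + \<epsilon> / 2"
      unfolding ennreal_add_left_cancel_less infinity_ennreal_def using tail by blast
    then have "(\<Sum>i. en \<psi> (?p (i + L))) + \<epsilon> / 2 < \<epsilon> / 2 + \<epsilon> / 2"
      by (simp only: add.commute)
    also have "\<dots> = \<epsilon>" by (subst mult_2[symmetric], subst ennreal_times_divide, subst mult.commute, rule ennreal_mult_divide_eq) auto
    finally show ?thesis .
  qed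
  finally have "hh q (\<psi> - \<eta>) < \<epsilon>" by (meson add_left_mono)
  then show ?thesis using \<eta>_T by blast
qed

subsection \<open>Differentiable elements\<close>

lemma sig_sig: "0 < q \<Longrightarrow> sig q \<alpha> (sig q \<beta> A) = sig q (\<alpha> + \<beta>) A"
  by (auto simp: sig_def fun_eq_iff algebra_simps simp flip: of_real_mult powr_add)

lemma sig_0: "0 < q \<Longrightarrow> sig q 0 A = A"
  by (simp add: sig_def)

text \<open>Here \<open>sig q 2\<close> arises: the diagonal m - n = k of A is scaled by the
  quotient of \<open>y^(-2)\<close> at row and column, q^(-2k).\<close>

lemma ypow_sig: "0 < q \<Longrightarrow> ypow q (-2) \<odot> A = sig q 2 A \<odot> ypow q (-2)"
  using sig_ypow[of q "sig q 2 A" "-2"] by (simp add: sig_sig sig_0)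

lemma ypow_mmul:
  assumes "0 < q" "banded K A" "banded L B"
  shows "ypow q (-2) \<odot> (A \<odot> B) = sig q 2 A \<odot> (ypow q (-2) \<odot> B)"
  using assms by (simp add: mmul_assoc[OF banded_ypow assms(3), symmetric] ypow_sig
      mmul_assoc[OF banded_sig[OF assms(2)] assms(3)])

lemma FD_banded: "0 < q \<Longrightarrow> q < 1 \<Longrightarrow> A \<in> FD q \<Longrightarrow> \<exists>K. banded K A"
  using FD_iff by blast

lemma FD_add: "0 < q \<Longrightarrow> q < 1 \<Longrightarrow> A \<in> FD q \<Longrightarrow> B \<in> FD q \<Longrightarrow> A + B \<in> FD q"
  using FD_iff banded_add bdd_mat_add by meson

lemma FD_mmul: "0 < q \<Longrightarrow> q < 1 \<Longrightarrow> A \<in> FD q \<Longrightarrow> B \<in> FD q \<Longrightarrow> A \<odot> B \<in> FD q"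
  using FD_iff banded_mmul bdd_mat_mmul by meson

lemma FD_msc: "0 < q \<Longrightarrow> q < 1 \<Longrightarrow> A \<in> FD q \<Longrightarrow> c \<cdot> A \<in> FD q"
  using FD_iff banded_msc bdd_mat_msc by meson

text \<open>The scaling factors of \<open>sig\<close> are unbounded over all diagonals, but on a
  band of width K they are at most q^(-2K).\<close>

lemma FD_sig:
  assumes q: "0 < q" "q < 1" and "A \<in> FD q"
  shows "sig q 2 A \<in> FD q"
proof -
  obtain K C where A: "banded K A" "bdd_mat C A" using FD_iff[OF q] assms(3) by blast
  have "C \<ge> 0" using A bdd_mat_nonneg by blast
  have "bdd_mat (q powr (- 2 * real K) * C) (sig q 2 A)" unfolding bdd_mat_def
  proof (intro allI)
    fix m n
    show "cmod (sig q 2 A m n) \<le> q powr (- 2 * real K) * C"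
    proof (cases "m + K < n \<or> n + K < m")
      case True
      then show ?thesis using A \<open>C \<ge> 0\<close> by (simp add: sig_def bandedD)
    next
      case False
      then have "q powr (- 2 * (real m - real n)) \<le> q powr (- 2 * real K)"
        using q by (intro powr_mono') auto
      then show ?thesis using A(2) by (auto simp: sig_def norm_mult bdd_mat_def intro!: mult_mono)
    qed
  qed
  then show ?thesis using FD_iff[OF q] banded_sig[OF A(1)] by blast
qed

lemma FD_L2D: "0 < q \<Longrightarrow> q < 1 \<Longrightarrow> A \<in> FD q \<Longrightarrow> A \<in> L2D q 1"
  using FD_iff bdd_banded_L2D by meson

lemma mcomm_mmul:
  assumes "banded K Z" "banded L A" "banded M B"
  shows "mcomm Z (A \<odot> B) = mcomm Z A \<odot> B + A \<odot> mcomm Z B"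
proof -
  have "mcomm Z A \<odot> B = (Z \<odot> A) \<odot> B - (A \<odot> Z) \<odot> B"
    unfolding mcomm_def by (rule mmul_diff_left[OF assms(3)])
  moreover have "A \<odot> mcomm Z B = A \<odot> (Z \<odot> B) - A \<odot> (B \<odot> Z)"
    unfolding mcomm_def by (rule mmul_diff_right[OF assms(2)])
  ultimately show ?thesis
    by (simp add: mcomm_def mmul_assoc[OF assms(1,3)] mmul_assoc[OF assms(2,3)] mmul_assoc[OF assms(2,1)])
qed

lemma banded_mcomm: "banded K Z \<Longrightarrow> banded L A \<Longrightarrow> \<exists>M. banded M (mcomm Z A)"
  unfolding mcomm_def using banded_mmul banded_diff by blast

text \<open>The commutator is a derivation; in its second term \<open>y^(-2)\<close> still has to
  cross A, which produces the twist. \<open>dz_mmul\<close> and \<open>dzbar_mmul\<close> are scalar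
  multiples of this identity.\<close>

lemma ypow_mcomm_mmul:
  assumes "0 < q" "banded K Z" "banded L A" "banded M B"
  shows "ypow q (-2) \<odot> mcomm Z (A \<odot> B)
     = (ypow q (-2) \<odot> mcomm Z A) \<odot> B + sig q 2 A \<odot> (ypow q (-2) \<odot> mcomm Z B)"
proof -
  obtain R where R: "banded R (mcomm Z B)" using banded_mcomm assms(2,4) by blast
  have "ypow q (-2) \<odot> mcomm Z (A \<odot> B) = ypow q (-2) \<odot> (mcomm Z A \<odot> B) + ypow q (-2) \<odot> (A \<odot> mcomm Z B)"
    unfolding mcomm_mmul[OF assms(2-4)] by (rule mmul_add_right[OF banded_ypow])
  then show ?thesis
    by (simp add: mmul_assoc[OF banded_ypow assms(4)] ypow_mmul[OF assms(1,3) R])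
qed

lemma msc_add: "c \<cdot> (A + B) = c \<cdot> A + c \<cdot> B"
  by (simp add: msc_def fun_eq_iff distrib_left)

lemma msc_msc: "c \<cdot> d \<cdot> A = (c * d) \<cdot> A"
  by (simp add: msc_def fun_eq_iff)

lemma dz_mmul:
  assumes "0 < q" "banded L A" "banded M B"
  shows "dz q (A \<odot> B) = dz q A \<odot> B + sig q 2 A \<odot> dz q B"
  by (simp add: dz_def ypow_mcomm_mmul[OF assms(1) banded_zstar assms(2,3)] msc_add mmul_msc_left mmul_msc_right)

lemma dzbar_mmul:
  assumes "0 < q" "banded L A" "banded M B"
  shows "dzbar q (A \<odot> B) = dzbar q A \<odot> B + sig q 2 A \<odot> dzbar q B"
  by (simp add: dzbar_def ypow_mcomm_mmul[OF assms(1) banded_zop assms(2,3)] msc_add mmul_msc_left mmul_msc_right)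

lemma F1D_FD: "F1D q \<subseteq> FD q"
  by (auto simp: F1D_def)

lemma dz_FD: "0 < q \<Longrightarrow> q < 1 \<Longrightarrow> A \<in> F1D q \<Longrightarrow> dz q A \<in> FD q"
  by (simp add: dz_def F1D_def FD_msc)

lemma dzbar_FD: "0 < q \<Longrightarrow> q < 1 \<Longrightarrow> A \<in> F1D q \<Longrightarrow> dzbar q A \<in> FD q"
  by (simp add: dzbar_def F1D_def FD_msc)

lemma F1D_mmul:
  assumes q: "0 < q" "q < 1" and "A \<in> F1D q" "B \<in> F1D q"
  shows "A \<odot> B \<in> F1D q"
proof -
  have FD: "A \<in> FD q" "B \<in> FD q" using assms by (auto simp: F1D_def)
  then obtain K L where KL: "banded K A" "banded L B" using FD_banded[OF q] by blast
  show ?thesis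
    using assms(3,4) FD unfolding F1D_def
    by (auto simp: ypow_mcomm_mmul[OF q(1) banded_zstar KL] ypow_mcomm_mmul[OF q(1) banded_zop KL]
        intro!: FD_add[OF q] FD_mmul[OF q] FD_sig[OF q])
qed

text \<open>The vector \<open>y^(-2) A B\<close> is \<open>sig q 2 A\<close>, a bounded operator,
  applied to \<open>y^(-2) B\<close>. This is why \<pi>(\<phi>) preserves the domain.\<close>

lemma D0_mmul:
  assumes q: "0 < q" "q < 1" and "A \<in> F1D q" "B \<in> D0 q"
  shows "A \<odot> B \<in> D0 q"
proof -
  have B: "B \<in> F1D q" "ypow q (-2) \<odot> B \<in> L2D q 1" using assms by (auto simp: D0_def dom_ypow_def)
  have FD: "A \<in> FD q" "B \<in> FD q" using assms B by (auto simp: F1D_def)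
  then obtain K L where KL: "banded K A" "banded L B" using FD_banded[OF q] by blast
  have "sig q 2 A \<odot> (ypow q (-2) \<odot> B) \<in> L2D q 1"
    using FD_sig[OF q FD(1)] FD_iff[OF q] B(2) L2D_mmul_left[OF q(1)] by blast
  then show ?thesis
    using F1D_mmul[OF q assms(3) B(1)] FD_L2D[OF q FD_mmul[OF q FD]]
    by (simp add: D0_def dom_ypow_def ypow_mmul[OF q(1) KL])
qed

lemma finite_supp_in_FD:
  assumes q: "0 < q" "q < 1" and A: "\<And>m n. m \<ge> L \<or> n \<ge> L \<Longrightarrow> A m n = 0"
  shows "A \<in> FD q"
proof -
  let ?C = "\<Sum>p\<in>{..<L}\<times>{..<L}. cmod (A (fst p) (snd p))"
  have "banded L A" unfolding banded_def using A by (metis add.commute le_add1 less_imp_le_nat order_trans)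
  moreover have "bdd_mat ?C A" unfolding bdd_mat_def
  proof (intro allI)
    fix m n
    show "cmod (A m n) \<le> ?C"
    proof (cases "m < L \<and> n < L")
      case True
      then show ?thesis
        using member_le_sum[of "(m, n)" "{..<L}\<times>{..<L}" "\<lambda>p. cmod (A (fst p) (snd p))"] by simp
    next
      case False
      then have "A m n = 0" using A by (auto simp: not_less)
      then show ?thesis by (simp add: sum_nonneg)
    qed
  qed
  ultimately show ?thesis using FD_iff[OF q] by blast
qed

lemma unit_mat_D0:
  assumes q: "0 < q" "q < 1" shows "unit_mat i j \<in> D0 q"
proof -
  \<comment> \<open>Commutation with \<open>zstar\<close> or \<open>zop\<close> moves one index by
    one, so i + j + 3 leaves room for every nonzero entry.\<close>
  have "ypow q (-2) \<odot> mcomm (zstar q) (unit_mat i j) \<in> FD q"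
    by (rule finite_supp_in_FD[OF q, of "i + j + 3"])
      (auto simp: ypow_m2_mult[OF q(1)] mcomm_def zstar_mult mult_zstar unit_mat_def split: nat.splits)
  moreover have "ypow q (-2) \<odot> mcomm (zop q) (unit_mat i j) \<in> FD q"
    by (rule finite_supp_in_FD[OF q, of "i + j + 3"])
      (auto simp: ypow_m2_mult[OF q(1)] mcomm_def zop_mult mult_zop unit_mat_def split: nat.splits)
  moreover have "unit_mat i j \<in> FD q"
    by (rule finite_supp_in_FD[OF q, of "i + j + 3"]) (auto simp: unit_mat_def)
  moreover have "ypow q (-2) \<odot> unit_mat i j \<in> FD q"
    by (rule finite_supp_in_FD[OF q, of "i + j + 3"]) (auto simp: ypow_m2_mult[OF q(1)] unit_mat_def)
  ultimately show ?thesis using FD_L2D[OF q] by (simp add: D0_def F1D_def dom_ypow_def)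
qed

subsection \<open>Symmetry\<close>

text \<open>Infinite sums add only when they are summable, so additivity requires membership in
  \<open>L2D\<close>. The membership of the partial sums is proved together with the identity
  because the induction needs it.\<close>

lemma l2inner_sum_left:
  assumes "0 < q" "\<And>j. j < N \<Longrightarrow> f j \<in> L2D q 1" "g \<in> L2D q 1"
  shows "(\<lambda>m n. \<Sum>j<N. f j m n * a j) \<in> L2D q 1 \<and>
     l2inner q 1 (\<lambda>m n. \<Sum>j<(N :: nat). f j m n * a j) g = (\<Sum>j<N. cnj (a j) * l2inner q 1 (f j) g)"
  using assms(2)
proof (induction N)
  case 0
  then show ?case using assms(1) by (simp add: L2D_iff nnorm2_def l2inner_eq)
next
  case (Suc N)
  let ?p = "\<lambda>m n. \<Sum>j<N. f j m n * a j"
  have IH: "?p \<in> L2D q 1" "l2inner q 1 ?p g = (\<Sum>j<N. cnj (a j) * l2inner q 1 (f j) g)"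
    using Suc by auto
  have fN: "f N \<in> L2D q 1" using Suc.prems by simp
  have eq: "(\<lambda>m n. \<Sum>j<Suc N. f j m n * a j) = ?p + a N \<cdot> f N"
    by (simp add: fun_eq_iff msc_def mult.commute)
  have L: "?p + a N \<cdot> f N \<in> L2D q 1"
    by (intro L2D_add L2D_msc assms IH fN)
  have "(\<Sum>\<^sub>\<infinity>(n, m). cnj ((?p + a N \<cdot> f N) m n) * g m n * complex_of_real q ^ n)
     = (\<Sum>\<^sub>\<infinity>p. (\<lambda>(n, m). cnj (?p m n) * g m n * complex_of_real q ^ n) p
           + cnj (a N) * (\<lambda>(n, m). cnj (f N m n) * g m n * complex_of_real q ^ n) p)"
    by (intro infsum_cong) (auto simp: msc_def algebra_simps)
  also have "\<dots> = (\<Sum>\<^sub>\<infinity>p. (\<lambda>(n, m). cnj (?p m n) * g m n * complex_of_real q ^ n) p)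
      + cnj (a N) * (\<Sum>\<^sub>\<infinity>p. (\<lambda>(n, m). cnj (f N m n) * g m n * complex_of_real q ^ n) p)"
    using L2D_abs_summable[OF assms(1) IH(1) assms(3)] L2D_abs_summable[OF assms(1) fN assms(3)]
    by (subst infsum_add) (auto intro: summable_on_cmult_right simp: infsum_cmult_right')
  finally have "l2inner q 1 (?p + a N \<cdot> f N) g = l2inner q 1 ?p g + cnj (a N) * l2inner q 1 (f N) g"
    unfolding l2inner_pairs[OF assms(1) L assms(3)] l2inner_pairs[OF assms(1) IH(1) assms(3)]
      l2inner_pairs[OF assms(1) fN assms(3)]
    by (simp only: distrib_left mult_ac)
  then show ?case unfolding eq using IH(2) L by simp
qed

text \<open>Valid for arbitrary matrices, hence every rule for the first argument transfers to the
  second without further conditions.\<close>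

lemma l2inner_cnj: "cnj (l2inner q 1 f g) = l2inner q 1 g f"
  by (simp add: l2inner_eq infsum_cnj[symmetric] mult.commute)

lemma l2inner_sum_right:
  assumes "0 < q" "\<And>j. j < N \<Longrightarrow> f j \<in> L2D q 1" "g \<in> L2D q 1"
  shows "l2inner q 1 g (\<lambda>m n. \<Sum>j<(N :: nat). f j m n * a j) = (\<Sum>j<N. a j * l2inner q 1 g (f j))"
proof -
  have "l2inner q 1 g (\<lambda>m n. \<Sum>j<N. f j m n * a j) = cnj (l2inner q 1 (\<lambda>m n. \<Sum>j<N. f j m n * a j) g)"
    by (simp add: l2inner_cnj)
  also have "\<dots> = (\<Sum>j<N. a j * l2inner q 1 g (f j))"
    using l2inner_sum_left[OF assms(1), of N f g a] assms(2,3) by (simp add: l2inner_cnj)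
  finally show ?thesis .
qed

lemma l2inner_add_left:
  assumes "0 < q" "f \<in> L2D q 1" "f' \<in> L2D q 1" "g \<in> L2D q 1"
  shows "l2inner q 1 (f + f') g = l2inner q 1 f g + l2inner q 1 f' g"
proof -
  have "f + f' = (\<lambda>m n. \<Sum>j<(2 :: nat). (if j = 0 then f else f') m n * (\<lambda>_. 1) j)"
    by (simp add: fun_eq_iff numeral_2_eq_2)
  then show ?thesis
    using l2inner_sum_left[OF assms(1), of 2 "\<lambda>j. if j = 0 then f else f'" g "\<lambda>_. 1"] assms
    by (simp add: numeral_2_eq_2)
qed

lemma l2inner_msc_left: "l2inner q 1 (c \<cdot> f) g = cnj c * l2inner q 1 f g"
proof -
  have "(\<Sum>\<^sub>\<infinity>m. cnj ((c \<cdot> f) m n) * g m n) = cnj c * (\<Sum>\<^sub>\<infinity>m. cnj (f m n) * g m n)" for n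
    by (simp add: msc_def infsum_cmult_right'[symmetric] mult.assoc)
  then show ?thesis by (simp add: l2inner_eq infsum_cmult_right' mult.assoc)
qed

lemma l2inner_uminus_left: "l2inner q 1 (- f) g = - l2inner q 1 f g"
  using l2inner_msc_left[of q "-1" f g] by (simp add: msc_def fun_Compl_def)

lemma l2inner_diff_left:
  assumes "0 < q" "f \<in> L2D q 1" "f' \<in> L2D q 1" "g \<in> L2D q 1"
  shows "l2inner q 1 (f - f') g = l2inner q 1 f g - l2inner q 1 f' g"
  using l2inner_add_left[OF assms(1,2) L2D_uminus[OF assms(1,3)] assms(4)]
  by (simp add: l2inner_uminus_left)

lemma l2inner_add_right:
  assumes "0 < q" "f \<in> L2D q 1" "f' \<in> L2D q 1" "g \<in> L2D q 1"
  shows "l2inner q 1 g (f + f') = l2inner q 1 g f + l2inner q 1 g f'"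
  using l2inner_add_left[OF assms] by (metis l2inner_cnj complex_cnj_add)

lemma l2inner_diff_right:
  assumes "0 < q" "f \<in> L2D q 1" "f' \<in> L2D q 1" "g \<in> L2D q 1"
  shows "l2inner q 1 g (f - f') = l2inner q 1 g f - l2inner q 1 g f'"
  using l2inner_diff_left[OF assms] by (metis l2inner_cnj complex_cnj_diff)

lemma l2inner_msc_right: "l2inner q 1 g (c \<cdot> f) = c * l2inner q 1 g f"
  using l2inner_msc_left[of q c f g] by (metis l2inner_cnj complex_cnj_mult complex_cnj_cnj)

lemma tensor_at:
  assumes "0 < q" "\<phi> \<in> tensor A B" "\<And>f. f \<in> A \<Longrightarrow> f \<in> L2D q 1"
  shows "\<phi> t \<in> L2D q 1"
proof -
  obtain N :: nat and f g where \<phi>: "\<phi> = (\<lambda>t m n. \<Sum>j<N. f j m n * g j t)"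
    and fg: "\<And>j. j < N \<Longrightarrow> f j \<in> A" "\<And>j. j < N \<Longrightarrow> g j \<in> B"
    by (rule tensorE[OF assms(2)]) (rule that)
  have "(\<lambda>m n. 0) \<in> L2D q 1" using assms(1) by (simp add: L2D_iff nnorm2_def)
  then show ?thesis unfolding \<phi>
    using l2inner_sum_left[OF assms(1), of N f "\<lambda>m n. 0" "\<lambda>j. g j t"] fg assms(3) by blast
qed

lemma l2inner_tensor:
  assumes q: "0 < q" and L: "tlin L" "\<And>j. j < N \<Longrightarrow> L (f j) \<in> L2D q 1"
    and M: "tlin M" "\<And>k. k < N' \<Longrightarrow> M (f' k) \<in> L2D q 1"
  shows "l2inner q 1 (L (\<lambda>m n. \<Sum>j<(N :: nat). f j m n * a j)) (M (\<lambda>m n. \<Sum>k<(N' :: nat). f' k m n * b k))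
     = (\<Sum>j<N. \<Sum>k<N'. cnj (a j) * b k * l2inner q 1 (L (f j)) (M (f' k)))"
proof -
  have eq: "L (\<lambda>m n. \<Sum>j<N. f j m n * a j) = (\<lambda>m n. \<Sum>j<N. L (f j) m n * a j)"
    "M (\<lambda>m n. \<Sum>k<N'. f' k m n * b k) = (\<lambda>m n. \<Sum>k<N'. M (f' k) m n * b k)"
    using L(1) M(1) by (simp_all add: tlin_def)
  have "(\<lambda>m n. 0) \<in> L2D q 1" using q by (simp add: L2D_iff nnorm2_def)
  then have Mb: "(\<lambda>m n. \<Sum>k<N'. M (f' k) m n * b k) \<in> L2D q 1"
    using l2inner_sum_left[OF q, of N' "\<lambda>k. M (f' k)" "\<lambda>m n. 0" b] M(2) by blast
  show ?thesis unfolding eq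
    using l2inner_sum_left[OF q L(2) Mb, where N = N and a = a]
    by (simp add: l2inner_sum_right[OF q M(2) L(2)] sum_distrib_left mult.assoc)
qed

text \<open>By sesquilinearity the inner product of two tensors is a finite sum of scalar functions
  of t with constant coefficients. Continuity, and likewise the derivative in the companion lemma,
  is then a matter of scalar calculus.\<close>

lemma l2inner_tensor_continuous:
  assumes q: "0 < q" and "tlin L" "tlin M" "\<psi> \<in> tensor A CT" "\<eta> \<in> tensor A' CT"
    "\<And>f. f \<in> A \<Longrightarrow> L f \<in> L2D q 1" "\<And>f. f \<in> A' \<Longrightarrow> M f \<in> L2D q 1"
  shows "continuous_on UNIV (\<lambda>t. l2inner q 1 (L (\<psi> t)) (M (\<eta> t)))"
proof -
  obtain N :: nat and f g where \<psi>: "\<psi> = (\<lambda>t m n. \<Sum>j<N. f j m n * g j t)"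
    and fg: "\<And>j. j < N \<Longrightarrow> f j \<in> A" "\<And>j. j < N \<Longrightarrow> g j \<in> CT"
    by (rule tensorE[OF assms(4)]) (rule that)
  obtain N' :: nat and f' g' where \<eta>: "\<eta> = (\<lambda>t m n. \<Sum>j<N'. f' j m n * g' j t)"
    and fg': "\<And>j. j < N' \<Longrightarrow> f' j \<in> A'" "\<And>j. j < N' \<Longrightarrow> g' j \<in> CT"
    by (rule tensorE[OF assms(5)]) (rule that)
  have eq: "l2inner q 1 (L (\<psi> t)) (M (\<eta> t))
      = (\<Sum>j<N. \<Sum>k<N'. cnj (g j t) * g' k t * l2inner q 1 (L (f j)) (M (f' k)))" for t
    unfolding \<psi> \<eta> using assms(6,7) fg(1) fg'(1) by (intro l2inner_tensor[OF q]) (auto intro: assms)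
  show ?thesis unfolding eq using fg(2) fg'(2)
    by (intro continuous_on_sum continuous_on_mult continuous_on_cnj continuous_on_const) (auto simp: CT_def)
qed

lemma l2inner_tensor_derivative:
  assumes q: "0 < q" and "tlin L" "tlin M" "\<psi> \<in> tensor A C1S" "\<eta> \<in> tensor A' C1S"
    "\<And>f. f \<in> A \<Longrightarrow> L f \<in> L2D q 1" "\<And>f. f \<in> A' \<Longrightarrow> M f \<in> L2D q 1"
  shows "((\<lambda>t. l2inner q 1 (L (\<psi> t)) (M (\<eta> t))) has_vector_derivative
     (l2inner q 1 (L (ddt \<psi> t)) (M (\<eta> t)) + l2inner q 1 (L (\<psi> t)) (M (ddt \<eta> t)))) (at t)"
proof -
  obtain N :: nat and f g where \<psi>: "\<psi> = (\<lambda>t m n. \<Sum>j<N. f j m n * g j t)"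
    and fg: "\<And>j. j < N \<Longrightarrow> f j \<in> A" "\<And>j. j < N \<Longrightarrow> g j \<in> C1S"
    by (rule tensorE[OF assms(4)]) (rule that)
  obtain N' :: nat and f' g' where \<eta>: "\<eta> = (\<lambda>t m n. \<Sum>j<N'. f' j m n * g' j t)"
    and fg': "\<And>j. j < N' \<Longrightarrow> f' j \<in> A'" "\<And>j. j < N' \<Longrightarrow> g' j \<in> C1S"
    by (rule tensorE[OF assms(5)]) (rule that)
  have d\<psi>: "ddt \<psi> = (\<lambda>t m n. \<Sum>j<N. f j m n * vector_derivative (g j) (at t))"
    unfolding \<psi> by (rule ddt_tensor(2)) (rule fg(2))
  have d\<eta>: "ddt \<eta> = (\<lambda>t m n. \<Sum>j<N'. f' j m n * vector_derivative (g' j) (at t))"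
    unfolding \<eta> by (rule ddt_tensor(2)) (rule fg'(2))
  have eq: "l2inner q 1 (L (\<lambda>m n. \<Sum>j<N. f j m n * a j)) (M (\<lambda>m n. \<Sum>j<N'. f' j m n * b j))
      = (\<Sum>j<N. \<Sum>k<N'. cnj (a j) * b k * l2inner q 1 (L (f j)) (M (f' k)))" for a b
    using assms(6,7) fg(1) fg'(1) by (intro l2inner_tensor[OF q]) (auto intro: assms)
  have "((\<lambda>t. \<Sum>j<N. \<Sum>k<N'. cnj (g j t) * g' k t * l2inner q 1 (L (f j)) (M (f' k))) has_vector_derivative
     (\<Sum>j<N. \<Sum>k<N'. (cnj (g j t) * vector_derivative (g' k) (at t) + cnj (vector_derivative (g j) (at t)) * g' k t)
       * l2inner q 1 (L (f j)) (M (f' k)))) (at t)"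
    using C1S_deriv(1)[OF fg(2)] C1S_deriv(1)[OF fg'(2)]
    by (intro has_vector_derivative_sum has_vector_derivative_mult_left has_vector_derivative_mult
        has_vector_derivative_cnj) auto
  then show ?thesis unfolding \<psi>[THEN fun_cong] \<eta>[THEN fun_cong] d\<psi>[THEN fun_cong] d\<eta>[THEN fun_cong] eq
    by (simp add: sum.distrib distrib_right add.commute)
qed

lemma integrable_circle:
  fixes w :: "real \<Rightarrow> complex"
  shows "continuous_on UNIV w \<Longrightarrow> integrable circle w"
  unfolding circle_def by (intro continuous_imp_integrable_real) (auto intro: continuous_on_subset)

lemma integral_circle_derivative:
  fixes w :: "real \<Rightarrow> complex"
  assumes "\<And>t. (w has_vector_derivative w' t) (at t)" "continuous_on UNIV w'" "w pi = w (-pi)"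
  shows "(LINT t|circle. w' t) = 0"
proof -
  have "(LINT t|circle. w' t) = integral {-pi..pi} w'"
    using integrable_circle[OF assms(2)] unfolding circle_def by (intro lebesgue_integral_eq_integral) auto
  also have "(w' has_integral (w pi - w (-pi))) {-pi..pi}"
    using assms(1) by (intro fundamental_theorem_of_calculus) (auto intro: has_vector_derivative_at_within)
  then have "integral {-pi..pi} w' = 0" using assms(3) by (simp add: integral_unique)
  finally show ?thesis .
qed

lemma tensor_periodic:
  assumes "\<phi> \<in> tensor A C1S" shows "\<phi> pi = \<phi> (-pi)"
proof -
  obtain N :: nat and f g where \<phi>: "\<phi> = (\<lambda>t m n. \<Sum>j<N. f j m n * g j t)"
    and fg: "\<And>j. j < N \<Longrightarrow> f j \<in> A" "\<And>j. j < N \<Longrightarrow> g j \<in> C1S"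
    by (rule tensorE[OF assms]) (rule that)
  have "g j pi = g j (-pi)" if "j < N" for j
  proof -
    have "g j (-pi + 2 * pi) = g j (-pi)" using fg(2)[OF that] unfolding C1S_def by blast
    then show ?thesis by simp
  qed
  then show ?thesis by (simp add: \<phi>)
qed

lemma hinner_cnj: "cnj (hinner q 1 \<psi> \<eta>) = hinner q 1 \<eta> \<psi>"
proof -
  have "hinner q 1 \<eta> \<psi> = (LINT t|circle. cnj (l2inner q 1 (\<psi> t) (\<eta> t)))"
    by (simp add: hinner_def l2inner_cnj)
  then show ?thesis by (simp only: hinner_def Bochner_Integration.integral_cnj)
qed

lemma tensor_inner_continuous:
  assumes "0 < q" "\<psi> \<in> tensor (L2D q 1) CT" "\<eta> \<in> tensor (L2D q 1) CT"
  shows "continuous_on UNIV (\<lambda>t. l2inner q 1 (\<psi> t) (\<eta> t))"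
  by (rule l2inner_tensor_continuous[OF assms(1) tlin_id tlin_id assms(2,3)]) auto

lemma hinner_add_left:
  assumes "0 < q" "\<psi> \<in> tensor (L2D q 1) CT" "\<psi>' \<in> tensor (L2D q 1) CT" "\<eta> \<in> tensor (L2D q 1) CT"
  shows "hinner q 1 (\<lambda>t. \<psi> t + \<psi>' t) \<eta> = hinner q 1 \<psi> \<eta> + hinner q 1 \<psi>' \<eta>"
  unfolding hinner_def
  using assms tensor_at[OF assms(1,2)] tensor_at[OF assms(1,3)] tensor_at[OF assms(1,4)]
  by (simp add: l2inner_add_left integrable_circle tensor_inner_continuous)

lemma hinner_msc_left: "hinner q 1 (\<lambda>t. c \<cdot> \<psi> t) \<eta> = cnj c * hinner q 1 \<psi> \<eta>"
  by (simp add: hinner_def l2inner_msc_left)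

lemma tensor_add:
  assumes "\<phi> \<in> tensor A B" "\<psi> \<in> tensor A B"
  shows "(\<lambda>t. \<phi> t + \<psi> t) \<in> tensor A B"
proof -
  obtain N :: nat and f g where \<phi>: "\<phi> = (\<lambda>t m n. \<Sum>j<N. f j m n * g j t)"
    and fg: "\<And>j. j < N \<Longrightarrow> f j \<in> A" "\<And>j. j < N \<Longrightarrow> g j \<in> B"
    by (rule tensorE[OF assms(1)]) (rule that)
  obtain N' :: nat and f' g' where \<psi>: "\<psi> = (\<lambda>t m n. \<Sum>j<N'. f' j m n * g' j t)"
    and fg': "\<And>j. j < N' \<Longrightarrow> f' j \<in> A" "\<And>j. j < N' \<Longrightarrow> g' j \<in> B"
    by (rule tensorE[OF assms(2)]) (rule that)
  have "(\<lambda>t. \<phi> t + \<psi> t) = (\<lambda>t m n. \<Sum>j\<in>{..<N} <+> {..<N'}. case_sum f f' j m n * case_sum g g' j t)"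
    by (simp add: \<phi> \<psi> fun_eq_iff sum.Plus)
  then show ?thesis using fg fg' by (auto intro!: tensor_finite)
qed

lemma tensor_scale:
  assumes "\<phi> \<in> tensor A CT" "u \<in> CT"
  shows "(\<lambda>t. u t \<cdot> \<phi> t) \<in> tensor A CT"
proof -
  obtain N :: nat and f g where \<phi>: "\<phi> = (\<lambda>t m n. \<Sum>j<N. f j m n * g j t)"
    and fg: "\<And>j. j < N \<Longrightarrow> f j \<in> A" "\<And>j. j < N \<Longrightarrow> g j \<in> CT"
    by (rule tensorE[OF assms(1)]) (rule that)
  have "(\<lambda>t. u t \<cdot> \<phi> t) = (\<lambda>t m n. \<Sum>j<N. f j m n * (u t * g j t))"
    by (simp add: \<phi> msc_def fun_eq_iff sum_distrib_left mult_ac)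
  moreover have "\<dots> \<in> tensor A CT"
    using fg assms(2) by (intro tensorI) (auto simp: CT_def intro!: continuous_intros)
  ultimately show ?thesis by simp
qed

section \<open>Adjoint relations as shifts of summation indices\<close>

lemma infsum_shift_fst:
  fixes F :: "nat \<times> nat \<Rightarrow> complex"
  assumes "\<And>m. F (0, m) = 0"
  shows "infsum F UNIV = (\<Sum>\<^sub>\<infinity>(n, m). F (Suc n, m))"
proof -
  have "infsum F UNIV = infsum F (map_prod Suc (id :: nat \<Rightarrow> nat) ` UNIV)"
  proof (rule infsum_cong_neutral)
    fix p assume "p \<in> UNIV - map_prod Suc (id :: nat \<Rightarrow> nat) ` UNIV"
    then have "fst p = 0"
      by (cases p, cases "fst p") (auto simp: image_iff map_prod_def)
    then show "F p = 0" using assms by (cases p) auto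
  qed auto
  also have "\<dots> = infsum (F \<circ> map_prod Suc (id :: nat \<Rightarrow> nat)) UNIV"
    by (rule infsum_reindex) (auto simp: inj_on_def map_prod_def)
  finally show ?thesis by (simp add: o_def map_prod_def case_prod_unfold)
qed

lemma infsum_shift_snd:
  fixes F :: "nat \<times> nat \<Rightarrow> complex"
  assumes "\<And>n. F (n, 0) = 0"
  shows "infsum F UNIV = (\<Sum>\<^sub>\<infinity>(n, m). F (n, Suc m))"
proof -
  have "infsum F UNIV = infsum F (map_prod (id :: nat \<Rightarrow> nat) Suc ` UNIV)"
  proof (rule infsum_cong_neutral)
    fix p assume "p \<in> UNIV - map_prod (id :: nat \<Rightarrow> nat) Suc ` UNIV"
    then have "snd p = 0"
      by (cases p, cases "snd p") (auto simp: image_iff map_prod_def)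
    then show "F p = 0" using assms by (cases p) auto
  qed auto
  also have "\<dots> = infsum (F \<circ> map_prod (id :: nat \<Rightarrow> nat) Suc) UNIV"
    by (rule infsum_reindex) (auto simp: inj_on_def map_prod_def)
  finally show ?thesis by (simp add: o_def map_prod_def case_prod_unfold)
qed

definition Hrad :: "real \<Rightarrow> mat \<Rightarrow> mat" where
  "Hrad q f = complex_of_real q \<cdot> (dz q f \<odot> zop q) - dzbar q f \<odot> zstar q"

context
  fixes q :: real
  assumes q: "0 < q" "q < 1"
begin

lemma dom_L2D: "f \<in> dom_ypow q 1 (-2) \<Longrightarrow> f \<in> L2D q 1"
  and dom_ypow_L2D: "f \<in> dom_ypow q 1 (-2) \<Longrightarrow> ypow q (-2) \<odot> f \<in> L2D q 1"
  by (simp_all add: dom_ypow_def)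

lemmas L2D_mult =
  L2D_mmul_left[OF q(1) banded_zop bdd_zop[OF q]] L2D_mmul_left[OF q(1) banded_zstar bdd_zstar[OF q]]
  L2D_mmul_right[OF q banded_zop bdd_zop[OF q]] L2D_mmul_right[OF q banded_zstar bdd_zstar[OF q]]

lemma bdd_yop: "bdd_mat 1 (yop q)"
  using q by (auto simp: bdd_mat_def yop_eq mdiag_def power_le_one norm_power)

lemma bdd_ypow2: "bdd_mat 1 (ypow q 2)"
  using q by (auto simp: bdd_mat_def ypow_eq mdiag_def norm_power intro!: power_le_one)

lemmas L2D_mult_y =
  L2D_mmul_right[OF q banded_yop bdd_yop] L2D_mmul_right[OF q banded_ypow bdd_ypow2]

lemmas inner_pairs = l2inner_pairs[OF q(1)]

lemma q_nz: "complex_of_real q \<noteq> 0"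
  using q by simp

lemma infsum_scaled:
  fixes F G :: "nat \<times> nat \<Rightarrow> complex"
  assumes "\<And>n m. F (n, m) = c * G (n, m)"
  shows "infsum F UNIV = c * infsum G UNIV"
proof -
  have "F = (\<lambda>p. c * G p)" using assms by auto
  then show ?thesis by (simp add: infsum_cmult_right')
qed

text \<open>Both indices are shifted by one. The column shift changes the weight q^n by q, and the
  row shift changes \<open>y^(-2)\<close> by q^2, whence q^3.\<close>

lemma inner_zstar_z:
  assumes f: "f \<in> dom_ypow q 1 (-2)" and g: "g \<in> dom_ypow q 1 (-2)"
  shows "l2inner q 1 (zstar q \<odot> (ypow q (-2) \<odot> f) \<odot> zop q) g
     = complex_of_real q ^ 3 * l2inner q 1 f (zop q \<odot> (ypow q (-2) \<odot> g) \<odot> zstar q)"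
proof -
  note L = dom_L2D[OF f] dom_L2D[OF g] dom_ypow_L2D[OF f] dom_ypow_L2D[OF g]
  show ?thesis
    apply (subst inner_pairs, (intro L2D_mult L)+)
    apply (subst inner_pairs, (intro L2D_mult L)+)
    apply (subst infsum_shift_fst, simp add: mult_zop)
    apply (subst infsum_shift_snd, simp add: mult_zop zstar_mult)
    apply (subst infsum_scaled[where c = "complex_of_real q ^ 3" and
        G = "\<lambda>(n, m). cnj (f m n) * (zop q \<odot> (ypow q (-2) \<odot> g) \<odot> zstar q) m n * complex_of_real q ^ n"])
     apply (use q_nz in \<open>simp add: mult_zop zstar_mult mult_zstar zop_mult ypow_m2_mult[OF q(1)] field_simps power3_eq_cube power2_eq_square\<close>)
    apply (simp only: mult_ac)
    done
qed

text \<open>Only the row index moves, so the weight is untouched and q^2 comes from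
  \<open>y^(-2)\<close> alone.\<close>

lemma inner_z_y:
  assumes f: "f \<in> dom_ypow q 1 (-2)" and g: "g \<in> dom_ypow q 1 (-2)"
  shows "complex_of_real q ^ 2 * l2inner q 1 (zop q \<odot> (ypow q (-2) \<odot> f) \<odot> yop q) g
     = l2inner q 1 f (zstar q \<odot> (ypow q (-2) \<odot> g) \<odot> yop q)"
proof -
  note L = dom_L2D[OF f] dom_L2D[OF g] dom_ypow_L2D[OF f] dom_ypow_L2D[OF g]
  have "l2inner q 1 f (zstar q \<odot> (ypow q (-2) \<odot> g) \<odot> yop q)
      = complex_of_real q ^ 2 * l2inner q 1 (zop q \<odot> (ypow q (-2) \<odot> f) \<odot> yop q) g"
    apply (subst inner_pairs, (intro L2D_mult L2D_mult_y L)+)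
    apply (subst inner_pairs, (intro L2D_mult L2D_mult_y L)+)
    apply (subst infsum_shift_snd, simp add: mult_yop zstar_mult)
    apply (subst infsum_scaled[where c = "complex_of_real q ^ 2" and
        G = "\<lambda>(n, m). cnj ((zop q \<odot> (ypow q (-2) \<odot> f) \<odot> yop q) m n) * g m n * complex_of_real q ^ n"])
     apply (use q_nz in \<open>simp add: mult_yop zstar_mult zop_mult ypow_m2_mult[OF q(1)] field_simps power2_eq_square\<close>)
    apply (simp only: mult_ac)
    done
  then show ?thesis by simp
qed

text \<open>Only the column index moves: one factor q comes from the weight, the other from y, which
  is evaluated after the shift.\<close>

lemma inner_y_z:
  assumes f: "f \<in> dom_ypow q 1 (-2)" and g: "g \<in> dom_ypow q 1 (-2)"
  shows "l2inner q 1 ((ypow q (-2) \<odot> f) \<odot> zop q \<odot> yop q) g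
     = complex_of_real q ^ 2 * l2inner q 1 f ((ypow q (-2) \<odot> g) \<odot> zstar q \<odot> yop q)"
proof -
  note L = dom_L2D[OF f] dom_L2D[OF g] dom_ypow_L2D[OF f] dom_ypow_L2D[OF g]
  show ?thesis
    apply (subst inner_pairs, (intro L2D_mult L2D_mult_y L)+)
    apply (subst inner_pairs, (intro L2D_mult L2D_mult_y L)+)
    apply (subst infsum_shift_fst, simp add: mult_yop mult_zop)
    apply (subst infsum_scaled[where c = "complex_of_real q ^ 2" and
        G = "\<lambda>(n, m). cnj (f m n) * ((ypow q (-2) \<odot> g) \<odot> zstar q \<odot> yop q) m n * complex_of_real q ^ n"])
     apply (use q_nz in \<open>simp add: mult_yop mult_zop mult_zstar ypow_m2_mult[OF q(1)] field_simps power2_eq_square\<close>)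
    apply (simp only: mult_ac)
    done
qed

text \<open>With y to the left of z the column shift changes the weight and the value of y by
  opposite powers of q, and no factor remains.\<close>

lemma inner_yz:
  assumes f: "f \<in> dom_ypow q 1 (-2)" and g: "g \<in> dom_ypow q 1 (-2)"
  shows "l2inner q 1 ((ypow q (-2) \<odot> f) \<odot> yop q \<odot> zop q) g
     = l2inner q 1 f ((ypow q (-2) \<odot> g) \<odot> yop q \<odot> zstar q)"
proof -
  note L = dom_L2D[OF f] dom_L2D[OF g] dom_ypow_L2D[OF f] dom_ypow_L2D[OF g]
  show ?thesis
    apply (subst inner_pairs, (intro L2D_mult L2D_mult_y L)+)
    apply (subst inner_pairs, (intro L2D_mult L2D_mult_y L)+)
    apply (subst infsum_shift_fst, simp add: mult_yop mult_zop)
    apply (subst infsum_scaled[where c = 1 and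
        G = "\<lambda>(n, m). cnj (f m n) * ((ypow q (-2) \<odot> g) \<odot> yop q \<odot> zstar q) m n * complex_of_real q ^ n"])
     apply (use q_nz in \<open>simp add: mult_yop mult_zop mult_zstar ypow_m2_mult[OF q(1)] field_simps power2_eq_square\<close>)
    apply (simp only: mult_1)
    done
qed

lemma inner_diag:
  assumes f: "f \<in> dom_ypow q 1 (-2)" and g: "g \<in> dom_ypow q 1 (-2)"
    and d: "\<And>A m n. R A m n = A m n * d n" "\<And>n. cnj (d n) = d n" and R: "\<And>A. A \<in> L2D q 1 \<Longrightarrow> R A \<in> L2D q 1"
  shows "l2inner q 1 (R (ypow q (-2) \<odot> f)) g = l2inner q 1 f (R (ypow q (-2) \<odot> g))"
proof -
  note L = dom_L2D[OF f] dom_L2D[OF g] dom_ypow_L2D[OF f] dom_ypow_L2D[OF g]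
  show ?thesis
    apply (subst inner_pairs, (intro R L)+)
    apply (subst inner_pairs, (intro R L)+)
    apply (simp add: d ypow_m2_mult[OF q(1)] mult_ac)
    done
qed

text \<open>Moving \<open>y^(-2)\<close> past \<open>zstar\<close> costs q^(-2) and places it next
  to f. Every term is then a bounded operator applied to \<open>y^(-2) f\<close>, which is square
  integrable on the domain.\<close>

lemma dz_eq:
  "dz q f = complex_of_real (- 1 / (1 - q\<^sup>2)) \<cdot>
     ((1 / complex_of_real q ^ 2) \<cdot> (zstar q \<odot> (ypow q (-2) \<odot> f)) - (ypow q (-2) \<odot> f) \<odot> zstar q)"
proof -
  have "ypow q (-2) \<odot> mcomm (zstar q) f =
     (1 / complex_of_real q ^ 2) \<cdot> (zstar q \<odot> (ypow q (-2) \<odot> f)) - (ypow q (-2) \<odot> f) \<odot> zstar q"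
    unfolding mcomm_def
    by (auto simp: ypow_m2_mult[OF q(1)] zstar_mult mult_zstar msc_def fun_eq_iff diff_divide_distrib
        power2_eq_square mult_ac split: nat.splits)
  then show ?thesis by (simp only: dz_def)
qed

lemma dzbar_eq:
  "dzbar q f = complex_of_real (1 / (1 - q\<^sup>2)) \<cdot>
     (complex_of_real q ^ 2 \<cdot> (zop q \<odot> (ypow q (-2) \<odot> f)) - (ypow q (-2) \<odot> f) \<odot> zop q)"
proof -
  have "ypow q (-2) \<odot> mcomm (zop q) f =
     complex_of_real q ^ 2 \<cdot> (zop q \<odot> (ypow q (-2) \<odot> f)) - (ypow q (-2) \<odot> f) \<odot> zop q"
    unfolding mcomm_def using q_nz
    by (auto simp: ypow_m2_mult[OF q(1)] zop_mult mult_zop msc_def fun_eq_iff diff_divide_distrib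
        power2_eq_square mult_ac split: nat.splits)
  then show ?thesis by (simp only: dzbar_def)
qed

lemma dz_L2D: "f \<in> dom_ypow q 1 (-2) \<Longrightarrow> dz q f \<in> L2D q 1"
  unfolding dz_eq by (intro L2D_msc[OF q(1)] L2D_diff[OF q(1)] L2D_mult dom_ypow_L2D)

lemma dzbar_L2D: "f \<in> dom_ypow q 1 (-2) \<Longrightarrow> dzbar q f \<in> L2D q 1"
  unfolding dzbar_eq by (intro L2D_msc[OF q(1)] L2D_diff[OF q(1)] L2D_mult dom_ypow_L2D)

lemma Hrad_L2D: "f \<in> dom_ypow q 1 (-2) \<Longrightarrow> Hrad q f \<in> L2D q 1"
  unfolding Hrad_def by (intro L2D_diff[OF q(1)] L2D_msc[OF q(1)] L2D_mult dz_L2D dzbar_L2D)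

lemma tlin_Hrad: "tlin (Hrad q)"
  unfolding Hrad_def
  by (intro tlin_diff tlin_comp[OF tlin_msc] tlin_comp[OF tlin_mmul_right[OF banded_zop]]
      tlin_comp[OF tlin_mmul_right[OF banded_zstar]] tlin_dz tlin_dzbar)

lemma Hrad_eq:
  "Hrad q f = complex_of_real (1 / (1 - q\<^sup>2)) \<cdot>
     (complex_of_real q \<cdot> ((ypow q (-2) \<odot> f) \<odot> zstar q \<odot> zop q) + (ypow q (-2) \<odot> f) \<odot> zop q \<odot> zstar q
      - ((1 / complex_of_real q) \<cdot> (zstar q \<odot> (ypow q (-2) \<odot> f) \<odot> zop q)
         + complex_of_real q ^ 2 \<cdot> (zop q \<odot> (ypow q (-2) \<odot> f) \<odot> zstar q)))"
proof -
  \<comment> \<open>The normalising constant is made opaque, so that the simplifier does not expand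
    it while the four products are collected.\<close>
  obtain \<kappa> where \<kappa>: "complex_of_real (1 / (1 - q\<^sup>2)) = \<kappa>" by blast
  then have "complex_of_real (- 1 / (1 - q\<^sup>2)) = - \<kappa>" by simp
  with \<kappa> show ?thesis unfolding Hrad_def dz_eq dzbar_eq
      mmul_msc_left mmul_diff_left[OF banded_zop] mmul_diff_left[OF banded_zstar]
    using q_nz by (simp add: msc_def fun_eq_iff power2_eq_square ring_distribs mult_ac del: of_real_divide)
qed

text \<open>The two terms that multiply by a real diagonal matrix from the right are symmetric on
  their own. The two terms with z on one side and \<open>zstar\<close> on the other are exchanged by
  the adjoint up to q^3, which is exactly the ratio of their coefficients q^2 and 1/q.\<close>

lemma Hrad_symmetric:
  assumes f: "f \<in> dom_ypow q 1 (-2)" and g: "g \<in> dom_ypow q 1 (-2)"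
  shows "l2inner q 1 (Hrad q f) g = l2inner q 1 f (Hrad q g)"
proof -
  note L = dom_L2D[OF f] dom_L2D[OF g] dom_ypow_L2D[OF f] dom_ypow_L2D[OF g]
  note ops = L2D_add[OF q(1)] L2D_diff[OF q(1)] L2D_msc[OF q(1)] L2D_mult L
  have 1: "l2inner q 1 ((ypow q (-2) \<odot> f) \<odot> zstar q \<odot> zop q) g
      = l2inner q 1 f ((ypow q (-2) \<odot> g) \<odot> zstar q \<odot> zop q)"
  proof (rule inner_diag[OF f g, of "\<lambda>A. A \<odot> zstar q \<odot> zop q" "\<lambda>n. aq q n * aq q n"])
    show "(A \<odot> zstar q \<odot> zop q) m n = A m n * (aq q n * aq q n)" for A m n
      by (simp add: mult_zop mult_zstar split: nat.splits)
    show "A \<odot> zstar q \<odot> zop q \<in> L2D q 1" if "A \<in> L2D q 1" for A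
      using that by (intro L2D_mult)
  qed simp
  have 2: "l2inner q 1 ((ypow q (-2) \<odot> f) \<odot> zop q \<odot> zstar q) g
      = l2inner q 1 f ((ypow q (-2) \<odot> g) \<odot> zop q \<odot> zstar q)"
  proof (rule inner_diag[OF f g, of "\<lambda>A. A \<odot> zop q \<odot> zstar q" "\<lambda>n. aq q (Suc n) * aq q (Suc n)"])
    show "(A \<odot> zop q \<odot> zstar q) m n = A m n * (aq q (Suc n) * aq q (Suc n))" for A m n
      by (simp add: mult_zop mult_zstar)
    show "A \<odot> zop q \<odot> zstar q \<in> L2D q 1" if "A \<in> L2D q 1" for A
      using that by (intro L2D_mult)
  qed simp
  note 3 = inner_zstar_z[OF f g]
  have "complex_of_real q ^ 3 * l2inner q 1 (zop q \<odot> (ypow q (-2) \<odot> f) \<odot> zstar q) g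
      = l2inner q 1 f (zstar q \<odot> (ypow q (-2) \<odot> g) \<odot> zop q)"
    using arg_cong[OF inner_zstar_z[OF g f], of cnj] by (simp add: l2inner_cnj)
  then have 4: "l2inner q 1 (zop q \<odot> (ypow q (-2) \<odot> f) \<odot> zstar q) g
      = l2inner q 1 f (zstar q \<odot> (ypow q (-2) \<odot> g) \<odot> zop q) / complex_of_real q ^ 3"
    using q_nz by (simp add: field_simps)
  have "l2inner q 1 (Hrad q f) g = complex_of_real (1 / (1 - q\<^sup>2)) *
     (complex_of_real q * l2inner q 1 ((ypow q (-2) \<odot> f) \<odot> zstar q \<odot> zop q) g
      + l2inner q 1 ((ypow q (-2) \<odot> f) \<odot> zop q \<odot> zstar q) g
      - (1 / complex_of_real q * l2inner q 1 (zstar q \<odot> (ypow q (-2) \<odot> f) \<odot> zop q) g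
         + complex_of_real q ^ 2 * l2inner q 1 (zop q \<odot> (ypow q (-2) \<odot> f) \<odot> zstar q) g))"
    unfolding Hrad_eq l2inner_msc_left
    by (subst l2inner_diff_left[OF q(1)], (intro ops)+,
        subst l2inner_add_left[OF q(1)], (intro ops)+,
        subst l2inner_add_left[OF q(1)], (intro ops)+) (simp add: l2inner_msc_left)
  also have "\<dots> = complex_of_real (1 / (1 - q\<^sup>2)) *
     (complex_of_real q * l2inner q 1 f ((ypow q (-2) \<odot> g) \<odot> zstar q \<odot> zop q)
      + l2inner q 1 f ((ypow q (-2) \<odot> g) \<odot> zop q \<odot> zstar q)
      - (1 / complex_of_real q * l2inner q 1 f (zstar q \<odot> (ypow q (-2) \<odot> g) \<odot> zop q)
         + complex_of_real q ^ 2 * l2inner q 1 f (zop q \<odot> (ypow q (-2) \<odot> g) \<odot> zstar q)))"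
    unfolding 1 2 3 4 using q_nz by (simp add: field_simps power2_eq_square power3_eq_cube)
  also have "\<dots> = l2inner q 1 f (Hrad q g)"
    unfolding Hrad_eq l2inner_msc_right
    by (subst l2inner_diff_right[OF q(1)], (intro ops)+,
        subst l2inner_add_right[OF q(1)], (intro ops)+,
        subst l2inner_add_right[OF q(1)], (intro ops)+) (simp add: l2inner_msc_right)
  finally show ?thesis .
qed

text \<open>The factors in \<open>inner_z_y\<close> and \<open>inner_y_z\<close> turn the
  coefficients (q^2, -1) of \<open>dzbar\<close> into (1, -q^2), which is q^2 times the pair (1/q^2,
  -1) of \<open>dz\<close>. The sign is the difference between the two normalising
  constants.\<close>

lemma dzbar_dz_adjoint:
  assumes f: "f \<in> dom_ypow q 1 (-2)" and g: "g \<in> dom_ypow q 1 (-2)"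
  shows "l2inner q 1 (dzbar q f \<odot> yop q) g = - (complex_of_real q ^ 2 * l2inner q 1 f (dz q g \<odot> yop q))"
proof -
  note L = dom_L2D[OF f] dom_L2D[OF g] dom_ypow_L2D[OF f] dom_ypow_L2D[OF g]
  note ops = L2D_diff[OF q(1)] L2D_msc[OF q(1)] L2D_mult L2D_mult_y L
  have k: "complex_of_real (- 1 / (1 - q\<^sup>2)) = - complex_of_real (1 / (1 - q\<^sup>2))" by simp
  have "l2inner q 1 (dzbar q f \<odot> yop q) g = complex_of_real (1 / (1 - q\<^sup>2)) *
     (complex_of_real q ^ 2 * l2inner q 1 (zop q \<odot> (ypow q (-2) \<odot> f) \<odot> yop q) g
       - l2inner q 1 ((ypow q (-2) \<odot> f) \<odot> zop q \<odot> yop q) g)"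
    unfolding dzbar_eq mmul_msc_left mmul_diff_left[OF banded_yop] l2inner_msc_left
    by (subst l2inner_diff_left[OF q(1)], (intro ops)+) (simp add: l2inner_msc_left)
  also have "\<dots> = complex_of_real (1 / (1 - q\<^sup>2)) *
     (l2inner q 1 f (zstar q \<odot> (ypow q (-2) \<odot> g) \<odot> yop q)
      - complex_of_real q ^ 2 * l2inner q 1 f ((ypow q (-2) \<odot> g) \<odot> zstar q \<odot> yop q))"
    by (simp only: inner_z_y[OF f g] inner_y_z[OF f g])
  also have "\<dots> = - (complex_of_real q ^ 2 * l2inner q 1 f (dz q g \<odot> yop q))"
    unfolding dz_eq mmul_msc_left mmul_diff_left[OF banded_yop] l2inner_msc_right k
    apply (subst l2inner_diff_right[OF q(1)], (intro ops)+)
    using q_nz by (simp add: l2inner_msc_right right_diff_distrib)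
  finally show ?thesis .
qed

end

lemma CT_intros: "(\<lambda>t. c) \<in> CT" "u \<in> CT \<Longrightarrow> v \<in> CT \<Longrightarrow> (\<lambda>t. u t * v t) \<in> CT"
  "(\<lambda>t. exp (\<i> * complex_of_real t)) \<in> CT" "(\<lambda>t. exp (- \<i> * complex_of_real t)) \<in> CT"
  by (auto simp: CT_def intro!: continuous_intros)

lemma tensor_diff:
  assumes "\<phi> \<in> tensor A CT" "\<psi> \<in> tensor A CT"
  shows "(\<lambda>t. \<phi> t - \<psi> t) \<in> tensor A CT"
proof -
  have "(\<lambda>t. \<phi> t - \<psi> t) = (\<lambda>t. \<phi> t + (\<lambda>_. -1) t \<cdot> \<psi> t)"
    by (simp add: msc_def fun_eq_iff)
  then show ?thesis using tensor_add[OF assms(1) tensor_scale[OF assms(2), of "\<lambda>_. -1"]]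
    by (simp add: CT_intros)
qed

lemma minus_eq_msc: "- A = (-1) \<cdot> A"
  by (simp add: msc_def fun_eq_iff)

lemma exp_minus_i_cnj: "cnj (exp (- \<i> * complex_of_real t)) = exp (\<i> * complex_of_real t)"
  by (simp add: exp_cnj)

text \<open>Each operator splits into a radial part (\<open>Hrad\<close>, \<open>Erad\<close>,
  \<open>Frad\<close>) and an angular coefficient (\<open>Hang\<close>, \<open>Eang\<close>,
  \<open>Fang\<close>) that is applied to the angular derivative and, for E and F, also to the
  function itself. All of them act at fixed t.\<close>

definition Hang :: "real \<Rightarrow> mat \<Rightarrow> mat" where
  "Hang q f = ypow q (-2) \<odot> f \<odot> ypow q 2"

definition Eang :: "real \<Rightarrow> mat \<Rightarrow> mat" where
  "Eang q f = ypow q (-2) \<odot> f \<odot> yop q \<odot> zop q"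

definition Fang :: "real \<Rightarrow> mat \<Rightarrow> mat" where
  "Fang q f = ypow q (-2) \<odot> f \<odot> yop q \<odot> zstar q"

definition Erad :: "real \<Rightarrow> mat \<Rightarrow> mat" where
  "Erad q f = dzbar q f \<odot> yop q"

definition Frad :: "real \<Rightarrow> mat \<Rightarrow> mat" where
  "Frad q f = dz q f \<odot> yop q"

lemma Hop_eq: "Hop q \<phi> t = Hrad q (\<phi> t) + \<i> \<cdot> Hang q (ddt \<phi> t)"
  by (simp add: Hop_def Hrad_def Hang_def)

lemma Eop_eq: "Eop q \<gamma> \<phi> t =
    (- complex_of_real (1 / q) * exp (- \<i> * t)) \<cdot> Erad q (\<phi> t)
    - (complex_of_real \<gamma> * exp (- \<i> * t) * \<i>) \<cdot> Eang q (ddt \<phi> t)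
    - (complex_of_real (\<gamma> / 2) * exp (- \<i> * t)) \<cdot> Eang q (\<phi> t)"
  by (simp add: Eop_def Erad_def Eang_def mmul_msc_right mmul_msc_left msc_msc)

lemma Fop_eq: "Fop q \<gamma> \<phi> t =
    (complex_of_real q * exp (\<i> * t)) \<cdot> Frad q (\<phi> t)
    - (complex_of_real \<gamma> * exp (\<i> * t) * \<i>) \<cdot> Fang q (ddt \<phi> t)
    + (complex_of_real (\<gamma> / 2) * exp (\<i> * t)) \<cdot> Fang q (\<phi> t)"
  by (simp add: Fop_def Frad_def Fang_def mmul_msc_right mmul_msc_left msc_msc)

context
  fixes q :: real
  assumes q: "0 < q" "q < 1"
begin

abbreviation (input) "V \<equiv> dom_ypow q 1 (-2)"

lemma Dom_subset: "Dom q \<subseteq> tensor V C1S"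
  unfolding Dom_def by (intro tensor_mono) (auto simp: D0_def)

lemma V_tensor_at: "\<psi> \<in> tensor V B \<Longrightarrow> \<psi> t \<in> V"
proof -
  assume \<psi>: "\<psi> \<in> tensor V B"
  have "(\<lambda>t. ypow q (-2) \<odot> \<psi> t) \<in> tensor (L2D q 1) B"
    by (rule tensor_map[OF tlin_mmul_left[OF banded_ypow] \<psi>]) (rule dom_ypow_L2D[OF q])
  then have "ypow q (-2) \<odot> \<psi> t \<in> L2D q 1" by (rule tensor_at[OF q(1)])
  moreover have "\<psi> t \<in> L2D q 1" by (rule tensor_at[OF q(1) \<psi>]) (rule dom_L2D[OF q])
  ultimately show ?thesis by (simp add: dom_ypow_def)
qed

lemma tlin_ops: "tlin (Hang q)" "tlin (Eang q)" "tlin (Fang q)" "tlin (Erad q)" "tlin (Frad q)"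
  unfolding Hang_def Eang_def Fang_def Erad_def Frad_def
  by (intro tlin_comp[OF tlin_mmul_right[OF banded_zop]] tlin_comp[OF tlin_mmul_right[OF banded_zstar]]
      tlin_comp[OF tlin_mmul_right[OF banded_yop]] tlin_comp[OF tlin_mmul_right[OF banded_ypow]]
      tlin_mmul_left[OF banded_ypow] tlin_dz tlin_dzbar)+

lemma ops_L2D:
  assumes "f \<in> V"
  shows "Hang q f \<in> L2D q 1" "Eang q f \<in> L2D q 1" "Fang q f \<in> L2D q 1" "Erad q f \<in> L2D q 1" "Frad q f \<in> L2D q 1"
  unfolding Hang_def Eang_def Fang_def Erad_def Frad_def
  by (intro L2D_mult[OF q] L2D_mult_y[OF q] dom_ypow_L2D[OF q] dz_L2D[OF q] dzbar_L2D[OF q] assms)+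

lemma tensor_op:
  assumes "tlin L" "\<And>f. f \<in> V \<Longrightarrow> L f \<in> L2D q 1" "\<psi> \<in> tensor V C1S"
  shows "(\<lambda>t. L (\<psi> t)) \<in> tensor (L2D q 1) CT" "(\<lambda>t. L (ddt \<psi> t)) \<in> tensor (L2D q 1) CT"
  using tensor_map[OF assms(1) assms(3) assms(2)] tensor_mono[OF order_refl C1S_subset_CT]
    tensor_map[OF assms(1) ddt_in_tensor[OF assms(3)] assms(2)] by auto

lemma tensor_V_L2D: "\<psi> \<in> tensor V C1S \<Longrightarrow> \<psi> \<in> tensor (L2D q 1) CT"
  using tensor_op(1)[OF tlin_id dom_L2D[OF q]] by simp

lemma Hop_tensor:
  assumes "\<psi> \<in> tensor V C1S" shows "Hop q \<psi> \<in> tensor (L2D q 1) CT"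
proof -
  have "(\<lambda>t. Hrad q (\<psi> t) + (\<lambda>_. \<i>) t \<cdot> Hang q (ddt \<psi> t)) \<in> tensor (L2D q 1) CT"
    by (intro tensor_add tensor_scale tensor_op tlin_ops tlin_Hrad[OF q] Hrad_L2D[OF q] ops_L2D assms CT_intros)
  then show ?thesis by (simp add: Hop_eq[abs_def])
qed

lemma Eop_tensor:
  assumes "\<psi> \<in> tensor V C1S" shows "Eop q \<gamma> \<psi> \<in> tensor (L2D q 1) CT"
proof -
  let ?e = "\<lambda>t. exp (- \<i> * complex_of_real t)"
  have u: "(\<lambda>t. c * ?e t) \<in> CT" "(\<lambda>t. c * ?e t * d) \<in> CT" for c d
    by (auto simp: CT_def intro!: continuous_intros)
  have "(\<lambda>t. (- complex_of_real (1 / q) * ?e t) \<cdot> Erad q (\<psi> t)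
    - (complex_of_real \<gamma> * ?e t * \<i>) \<cdot> Eang q (ddt \<psi> t)
    - (complex_of_real (\<gamma> / 2) * ?e t) \<cdot> Eang q (\<psi> t)) \<in> tensor (L2D q 1) CT"
    by (rule tensor_diff[OF tensor_diff[OF
          tensor_scale[OF tensor_op(1)[OF tlin_ops(4) ops_L2D(4) assms] u(1)]
          tensor_scale[OF tensor_op(2)[OF tlin_ops(2) ops_L2D(2) assms] u(2)]]
          tensor_scale[OF tensor_op(1)[OF tlin_ops(2) ops_L2D(2) assms] u(1)]])
  then show ?thesis by (simp only: Eop_eq[abs_def])
qed

lemma Fop_tensor:
  assumes "\<psi> \<in> tensor V C1S" shows "Fop q \<gamma> \<psi> \<in> tensor (L2D q 1) CT"
proof -
  let ?e = "\<lambda>t. exp (\<i> * complex_of_real t)"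
  have u: "(\<lambda>t. c * ?e t) \<in> CT" "(\<lambda>t. c * ?e t * d) \<in> CT" for c d
    by (auto simp: CT_def intro!: continuous_intros)
  have "(\<lambda>t. (complex_of_real q * ?e t) \<cdot> Frad q (\<psi> t)
    - (complex_of_real \<gamma> * ?e t * \<i>) \<cdot> Fang q (ddt \<psi> t)
    + (complex_of_real (\<gamma> / 2) * ?e t) \<cdot> Fang q (\<psi> t)) \<in> tensor (L2D q 1) CT"
    by (rule tensor_add[OF tensor_diff[OF
          tensor_scale[OF tensor_op(1)[OF tlin_ops(5) ops_L2D(5) assms] u(1)]
          tensor_scale[OF tensor_op(2)[OF tlin_ops(3) ops_L2D(3) assms] u(2)]]
          tensor_scale[OF tensor_op(1)[OF tlin_ops(3) ops_L2D(3) assms] u(1)]])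
  then show ?thesis by (simp only: Fop_eq[abs_def])
qed

lemma Hang_symmetric:
  assumes "f \<in> V" "g \<in> V"
  shows "l2inner q 1 (Hang q f) g = l2inner q 1 f (Hang q g)"
  unfolding Hang_def
  by (rule inner_diag[OF q assms, of "\<lambda>A. A \<odot> ypow q 2" "\<lambda>n. complex_of_real q ^ (2 * n)"])
    (auto simp: mult_ypow_2[OF q(1)] intro: L2D_mult_y[OF q, unfolded mult_ypow_2[OF q(1)]])

lemma Eang_adjoint: "f \<in> V \<Longrightarrow> g \<in> V \<Longrightarrow> l2inner q 1 (Eang q f) g = l2inner q 1 f (Fang q g)"
  unfolding Eang_def Fang_def by (rule inner_yz[OF q])

lemma Erad_adjoint:
  "f \<in> V \<Longrightarrow> g \<in> V \<Longrightarrow> l2inner q 1 (Erad q f) g = - (complex_of_real q ^ 2 * l2inner q 1 f (Frad q g))"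
  unfolding Erad_def Frad_def by (rule dzbar_dz_adjoint[OF q])

text \<open>Integration by parts in t: w is the boundary term, and periodicity makes it
  cancel.\<close>

lemma hinner_eqI:
  assumes "\<psi> \<in> tensor (L2D q 1) CT" "\<eta> \<in> tensor (L2D q 1) CT"
    "\<psi>' \<in> tensor (L2D q 1) CT" "\<eta>' \<in> tensor (L2D q 1) CT"
    and w: "\<And>t. (w has_vector_derivative l2inner q 1 (\<psi> t) (\<eta> t) - l2inner q 1 (\<psi>' t) (\<eta>' t)) (at t)"
      "w pi = w (-pi)"
  shows "hinner q 1 \<psi> \<eta> = hinner q 1 \<psi>' \<eta>'"
proof -
  note c = tensor_inner_continuous[OF q(1) assms(1,2)] tensor_inner_continuous[OF q(1) assms(3,4)]
  have "(LINT t|circle. l2inner q 1 (\<psi> t) (\<eta> t) - l2inner q 1 (\<psi>' t) (\<eta>' t)) = 0"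
    by (rule integral_circle_derivative[OF w(1) _ w(2)]) (intro continuous_on_diff c)
  then show ?thesis
    by (simp add: hinner_def integrable_circle c)
qed

text \<open>Radial part and angular coefficient are symmetric at each t, so only the derivative
  terms survive in the difference. Conjugation turns \<i> into -\<i> on the left, which leaves -\<i>
  times the derivative of the inner product of \<open>Hang \<psi>\<close> with \<eta>.\<close>

lemma Hop_symmetric:
  assumes \<psi>: "\<psi> \<in> tensor V C1S" and \<eta>: "\<eta> \<in> tensor V C1S"
  shows "hinner q 1 (Hop q \<psi>) \<eta> = hinner q 1 \<psi> (Hop q \<eta>)"
proof (rule hinner_eqI[OF Hop_tensor[OF \<psi>] tensor_V_L2D[OF \<eta>] tensor_V_L2D[OF \<psi>] Hop_tensor[OF \<eta>],
      where w = "\<lambda>t. - \<i> * l2inner q 1 (Hang q (\<psi> t)) (\<eta> t)"])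
  fix t
  have mem: "\<psi> t \<in> V" "\<eta> t \<in> V" "ddt \<psi> t \<in> V" "ddt \<eta> t \<in> V"
    using V_tensor_at \<psi> \<eta> ddt_in_tensor by blast+
  note L = dom_L2D[OF q mem(1)] dom_L2D[OF q mem(2)] Hrad_L2D[OF q mem(1)] Hrad_L2D[OF q mem(2)]
    L2D_msc[OF q(1) ops_L2D(1)[OF mem(3)]] L2D_msc[OF q(1) ops_L2D(1)[OF mem(4)]]
  have "l2inner q 1 (Hop q \<psi> t) (\<eta> t) - l2inner q 1 (\<psi> t) (Hop q \<eta> t)
     = - \<i> * (l2inner q 1 (Hang q (ddt \<psi> t)) (\<eta> t) + l2inner q 1 (Hang q (\<psi> t)) (ddt \<eta> t))"
    unfolding Hop_eq l2inner_add_left[OF q(1) L(3,5,2)] l2inner_add_right[OF q(1) L(4,6,1)]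
    by (simp add: l2inner_msc_left l2inner_msc_right Hrad_symmetric[OF q mem(1,2)] Hang_symmetric[OF mem(1,4)]
        algebra_simps)
  moreover have "((\<lambda>t. l2inner q 1 (Hang q (\<psi> t)) (\<eta> t)) has_vector_derivative
     (l2inner q 1 (Hang q (ddt \<psi> t)) (\<eta> t) + l2inner q 1 (Hang q (\<psi> t)) (ddt \<eta> t))) (at t)"
    by (rule l2inner_tensor_derivative[OF q(1) tlin_ops(1) tlin_id \<psi> \<eta>]) (auto intro: ops_L2D dom_L2D[OF q])
  ultimately show "((\<lambda>t. - \<i> * l2inner q 1 (Hang q (\<psi> t)) (\<eta> t)) has_vector_derivative
      l2inner q 1 (Hop q \<psi> t) (\<eta> t) - l2inner q 1 (\<psi> t) (Hop q \<eta> t)) (at t)"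
    by (simp only:) (rule has_vector_derivative_mult_right)
next
  show "- \<i> * l2inner q 1 (Hang q (\<psi> pi)) (\<eta> pi) = - \<i> * l2inner q 1 (Hang q (\<psi> (- pi))) (\<eta> (- pi))"
    by (simp add: tensor_periodic[OF \<psi>] tensor_periodic[OF \<eta>])
qed

text \<open>The boundary term carries e^(it), whose derivative leaves a term without any derivative
  of \<psi> or \<eta>. The terms with \<gamma>/2 in E and in F each supply half of it. The radial
  coefficients -1/q and q match through the factor -q^2 of \<open>Erad_adjoint\<close>.\<close>

lemma Eop_adjoint:
  assumes \<psi>: "\<psi> \<in> tensor V C1S" and \<eta>: "\<eta> \<in> tensor V C1S"
  shows "hinner q 1 (Eop q \<gamma> \<psi>) \<eta> = hinner q 1 \<psi> (Fop q \<gamma> \<eta>)"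
proof (rule hinner_eqI[OF Eop_tensor[OF \<psi>] tensor_V_L2D[OF \<eta>] tensor_V_L2D[OF \<psi>] Fop_tensor[OF \<eta>],
      where w = "\<lambda>t. (\<i> * complex_of_real \<gamma>) * (exp (\<i> * complex_of_real t) * l2inner q 1 (Eang q (\<psi> t)) (\<eta> t))"])
  fix t
  have mem: "\<psi> t \<in> V" "\<eta> t \<in> V" "ddt \<psi> t \<in> V" "ddt \<eta> t \<in> V"
    using V_tensor_at \<psi> \<eta> ddt_in_tensor by blast+
  note ops = L2D_add[OF q(1)] L2D_diff[OF q(1)] L2D_msc[OF q(1)] ops_L2D dom_L2D[OF q] mem
  let ?e = "exp (\<i> * complex_of_real t)"
  let ?J = "l2inner q 1 (Eang q (\<psi> t)) (\<eta> t)"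
  let ?J' = "l2inner q 1 (Eang q (ddt \<psi> t)) (\<eta> t) + l2inner q 1 (Eang q (\<psi> t)) (ddt \<eta> t)"
  have E: "l2inner q 1 (Eop q \<gamma> \<psi> t) (\<eta> t) =
     - complex_of_real (1 / q) * ?e * l2inner q 1 (Erad q (\<psi> t)) (\<eta> t)
     + complex_of_real \<gamma> * ?e * \<i> * l2inner q 1 (Eang q (ddt \<psi> t)) (\<eta> t)
     - complex_of_real (\<gamma> / 2) * ?e * ?J"
    unfolding Eop_eq
    by (subst l2inner_diff_left[OF q(1)], (intro ops)+, subst l2inner_diff_left[OF q(1)], (intro ops)+)
      (simp add: l2inner_msc_left exp_minus_i_cnj[unfolded mult_minus_left] del: of_real_divide)
  have F: "l2inner q 1 (\<psi> t) (Fop q \<gamma> \<eta> t) =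
     complex_of_real q * ?e * l2inner q 1 (\<psi> t) (Frad q (\<eta> t))
     - complex_of_real \<gamma> * ?e * \<i> * l2inner q 1 (\<psi> t) (Fang q (ddt \<eta> t))
     + complex_of_real (\<gamma> / 2) * ?e * l2inner q 1 (\<psi> t) (Fang q (\<eta> t))"
    unfolding Fop_eq
    by (subst l2inner_add_right[OF q(1)], (intro ops)+, subst l2inner_diff_right[OF q(1)], (intro ops)+)
      (simp add: l2inner_msc_right del: of_real_divide)
  have qq: "complex_of_real (1 / q) * complex_of_real q ^ 2 = complex_of_real q"
    using q by (simp add: power2_eq_square)
  have "l2inner q 1 (Eop q \<gamma> \<psi> t) (\<eta> t) - l2inner q 1 (\<psi> t) (Fop q \<gamma> \<eta> t)
     = (\<i> * complex_of_real \<gamma>) * (?e * ?J' + (\<i> * ?e) * ?J)"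
  proof -
    have "complex_of_real (\<gamma> / 2) = complex_of_real \<gamma> / 2" by simp
    moreover have "- complex_of_real (1 / q) * ?e * - (complex_of_real q ^ 2 * l2inner q 1 (\<psi> t) (Frad q (\<eta> t)))
       = (complex_of_real (1 / q) * complex_of_real q ^ 2) * (?e * l2inner q 1 (\<psi> t) (Frad q (\<eta> t)))"
      by (simp only: mult_minus_left mult_minus_right minus_minus mult_ac)
    ultimately show ?thesis
      unfolding E F Erad_adjoint[OF mem(1,2)] Eang_adjoint[OF mem(1,2), symmetric] Eang_adjoint[OF mem(1,4), symmetric] qq
      by (simp add: algebra_simps)
  qed
  moreover have "((\<lambda>t. exp (\<i> * complex_of_real t) * l2inner q 1 (Eang q (\<psi> t)) (\<eta> t)) has_vector_derivative
     (?e * ?J' + (\<i> * ?e) * ?J)) (at t)"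
  proof (rule has_vector_derivative_mult)
    show "((\<lambda>t. exp (\<i> * complex_of_real t)) has_vector_derivative \<i> * ?e) (at t)"
      by (auto intro!: derivative_eq_intros has_vector_derivative_real_field)
    show "((\<lambda>t. l2inner q 1 (Eang q (\<psi> t)) (\<eta> t)) has_vector_derivative ?J') (at t)"
      by (rule l2inner_tensor_derivative[OF q(1) tlin_ops(2) tlin_id \<psi> \<eta>]) (auto intro: ops_L2D dom_L2D[OF q])
  qed
  ultimately show "((\<lambda>t. (\<i> * complex_of_real \<gamma>) * (exp (\<i> * complex_of_real t) * l2inner q 1 (Eang q (\<psi> t)) (\<eta> t)))
     has_vector_derivative l2inner q 1 (Eop q \<gamma> \<psi> t) (\<eta> t) - l2inner q 1 (\<psi> t) (Fop q \<gamma> \<eta> t)) (at t)"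
    by (simp only:) (rule has_vector_derivative_mult_right)
next
  have "exp (\<i> * complex_of_real (-pi + 2 * pi)) = exp (\<i> * complex_of_real (-pi))"
    using C1S_exp unfolding C1S_def by blast
  then show "(\<i> * complex_of_real \<gamma>) * (exp (\<i> * complex_of_real pi) * l2inner q 1 (Eang q (\<psi> pi)) (\<eta> pi))
    = (\<i> * complex_of_real \<gamma>) * (exp (\<i> * complex_of_real (- pi)) * l2inner q 1 (Eang q (\<psi> (- pi))) (\<eta> (- pi)))"
    by (simp add: tensor_periodic[OF \<psi>] tensor_periodic[OF \<eta>])
qed

lemma Fop_adjoint:
  assumes "\<psi> \<in> tensor V C1S" "\<eta> \<in> tensor V C1S"
  shows "hinner q 1 (Fop q \<gamma> \<psi>) \<eta> = hinner q 1 \<psi> (Eop q \<gamma> \<eta>)"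
  using Eop_adjoint[OF assms(2,1)] by (metis hinner_cnj)

lemma D1_components:
  assumes "\<psi>1 \<in> tensor V C1S" "\<psi>2 \<in> tensor V C1S"
  shows "fst (D1 q \<gamma> c (\<psi>1, \<psi>2)) \<in> tensor (L2D q 1) CT"
    "snd (D1 q \<gamma> c (\<psi>1, \<psi>2)) \<in> tensor (L2D q 1) CT"
proof -
  note T = Hop_tensor Eop_tensor Fop_tensor tensor_V_L2D assms CT_intros
  have "(\<lambda>t. (Hop q \<psi>1 t - (\<lambda>_. 2) t \<cdot> \<psi>1 t) + (\<lambda>_. complex_of_real c) t \<cdot> Eop q \<gamma> \<psi>2 t) \<in> tensor (L2D q 1) CT"
    by (intro tensor_add tensor_diff tensor_scale T)
  then show "fst (D1 q \<gamma> c (\<psi>1, \<psi>2)) \<in> tensor (L2D q 1) CT" by (simp add: D1_def)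
  have "(\<lambda>t. (\<lambda>_. complex_of_real c) t \<cdot> Fop q \<gamma> \<psi>1 t + ((\<lambda>_. -1) t \<cdot> Hop q \<psi>2 t - (\<lambda>_. 2) t \<cdot> \<psi>2 t)) \<in> tensor (L2D q 1) CT"
    by (intro tensor_add tensor_diff tensor_scale T)
  then show "snd (D1 q \<gamma> c (\<psi>1, \<psi>2)) \<in> tensor (L2D q 1) CT"
    by (simp add: D1_def minus_eq_msc[symmetric])
qed

lemma hinner_D1_left:
  assumes "\<psi>1 \<in> tensor V C1S" "\<psi>2 \<in> tensor V C1S" "\<eta>1 \<in> tensor V C1S" "\<eta>2 \<in> tensor V C1S"
  shows "hinner2 q 1 (D1 q \<gamma> c (\<psi>1, \<psi>2)) (\<eta>1, \<eta>2) =
     hinner q 1 (Hop q \<psi>1) \<eta>1 - 2 * hinner q 1 \<psi>1 \<eta>1 + complex_of_real c * hinner q 1 (Eop q \<gamma> \<psi>2) \<eta>1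
     + (complex_of_real c * hinner q 1 (Fop q \<gamma> \<psi>1) \<eta>2 - hinner q 1 (Hop q \<psi>2) \<eta>2 - 2 * hinner q 1 \<psi>2 \<eta>2)"
proof -
  note T = Hop_tensor Eop_tensor Fop_tensor tensor_V_L2D assms CT_intros
  have m: "(\<lambda>t. c \<cdot> \<phi> t) \<in> tensor (L2D q 1) CT" if "\<phi> \<in> tensor (L2D q 1) CT" for c \<phi>
    using tensor_scale[OF that, of "\<lambda>_. c"] by (simp add: CT_intros)
  \<comment> \<open>Subtractions are written as additions of negative multiples, so that
    \<open>hinner_add_left\<close> and \<open>hinner_msc_left\<close> suffice.\<close>
  have 1: "fst (D1 q \<gamma> c (\<psi>1, \<psi>2)) = (\<lambda>t. (\<lambda>t. Hop q \<psi>1 t + (\<lambda>t. (-2) \<cdot> \<psi>1 t) t) t + (\<lambda>t. complex_of_real c \<cdot> Eop q \<gamma> \<psi>2 t) t)"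
    by (simp add: D1_def fun_eq_iff msc_def)
  have 2: "snd (D1 q \<gamma> c (\<psi>1, \<psi>2)) = (\<lambda>t. (\<lambda>t. complex_of_real c \<cdot> Fop q \<gamma> \<psi>1 t) t
       + (\<lambda>t. (\<lambda>t. (-1) \<cdot> Hop q \<psi>2 t) t + (\<lambda>t. (-2) \<cdot> \<psi>2 t) t) t)"
    by (simp add: D1_def fun_eq_iff msc_def)
  have "hinner q 1 (fst (D1 q \<gamma> c (\<psi>1, \<psi>2))) \<eta>1 =
     hinner q 1 (Hop q \<psi>1) \<eta>1 + hinner q 1 (\<lambda>t. (-2) \<cdot> \<psi>1 t) \<eta>1
      + hinner q 1 (\<lambda>t. complex_of_real c \<cdot> Eop q \<gamma> \<psi>2 t) \<eta>1"
    unfolding 1 by (subst hinner_add_left[OF q(1)], (intro tensor_add m T)+, subst hinner_add_left[OF q(1)], (intro tensor_add m T)+) simp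
  moreover have "hinner q 1 (snd (D1 q \<gamma> c (\<psi>1, \<psi>2))) \<eta>2 =
     hinner q 1 (\<lambda>t. complex_of_real c \<cdot> Fop q \<gamma> \<psi>1 t) \<eta>2 + (hinner q 1 (\<lambda>t. (-1) \<cdot> Hop q \<psi>2 t) \<eta>2
      + hinner q 1 (\<lambda>t. (-2) \<cdot> \<psi>2 t) \<eta>2)"
    unfolding 2 by (subst hinner_add_left[OF q(1)], (intro tensor_add m T)+, subst hinner_add_left[OF q(1)], (intro tensor_add m T)+) simp
  ultimately show ?thesis by (simp add: hinner2_def hinner_msc_left)
qed

lemma hinner2_cnj: "cnj (hinner2 q 1 \<Psi> X) = hinner2 q 1 X \<Psi>"
  by (simp add: hinner2_def hinner_cnj)

text \<open>The diagonal entries are symmetric, with the real constant -2, and the off-diagonal ones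
  are adjoint to each other because c is real.\<close>

lemma D1_symmetric:
  assumes "\<psi>1 \<in> tensor V C1S" "\<psi>2 \<in> tensor V C1S" "\<eta>1 \<in> tensor V C1S" "\<eta>2 \<in> tensor V C1S"
  shows "hinner2 q 1 (D1 q \<gamma> c (\<psi>1, \<psi>2)) (\<eta>1, \<eta>2) = hinner2 q 1 (\<psi>1, \<psi>2) (D1 q \<gamma> c (\<eta>1, \<eta>2))"
proof -
  have "hinner2 q 1 (\<psi>1, \<psi>2) (D1 q \<gamma> c (\<eta>1, \<eta>2)) = cnj (hinner2 q 1 (D1 q \<gamma> c (\<eta>1, \<eta>2)) (\<psi>1, \<psi>2))"
    by (simp add: hinner2_cnj)
  also have "\<dots> = hinner q 1 \<psi>1 (Hop q \<eta>1) - 2 * hinner q 1 \<psi>1 \<eta>1 + complex_of_real c * hinner q 1 \<psi>1 (Eop q \<gamma> \<eta>2)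
     + (complex_of_real c * hinner q 1 \<psi>2 (Fop q \<gamma> \<eta>1) - hinner q 1 \<psi>2 (Hop q \<eta>2) - 2 * hinner q 1 \<psi>2 \<eta>2)"
    unfolding hinner_D1_left[OF assms(3,4,1,2)] by (simp add: hinner_cnj)
  also have "\<dots> = hinner2 q 1 (D1 q \<gamma> c (\<psi>1, \<psi>2)) (\<eta>1, \<eta>2)"
    unfolding hinner_D1_left[OF assms] Hop_symmetric[OF assms(1,3)] Hop_symmetric[OF assms(2,4)]
      Eop_adjoint[OF assms(2,3)] Fop_adjoint[OF assms(1,4)] by simp
  finally show ?thesis by simp
qed

lemma Dom_Hsp: "Dom q \<subseteq> Hsp q 1"
  using tensor_Hsp[OF q] tensor_V_L2D Dom_subset by blast

lemma Dom_dense: "dense_in (hinner2 q 1) (Hsp q 1 \<times> Hsp q 1) (Dom q \<times> Dom q)"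
  unfolding dense_in_def
proof (intro conjI ballI allI impI)
  show "Dom q \<times> Dom q \<subseteq> Hsp q 1 \<times> Hsp q 1" using Dom_Hsp by auto
next
  fix x :: "matfun \<times> matfun" and e :: real
  assume x: "x \<in> Hsp q 1 \<times> Hsp q 1" and "e > 0"
  obtain \<psi> \<eta> where x_eq: "x = (\<psi>, \<eta>)" by (cases x)
  have H: "\<psi> \<in> Hsp q 1" "\<eta> \<in> Hsp q 1" using x by (auto simp: x_eq)
  \<comment> \<open>Half of e^2 for each component; the factor 1 - q in the norm is at most 1 and
    can be discarded.\<close>
  have "0 < ennreal (e\<^sup>2 / 2)" "ennreal (e\<^sup>2 / 2) \<noteq> top" using \<open>e > 0\<close> by auto
  then obtain y1 y2 where y: "y1 \<in> Dom q" "hh q (\<psi> - y1) < ennreal (e\<^sup>2 / 2)"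
      "y2 \<in> Dom q" "hh q (\<eta> - y2) < ennreal (e\<^sup>2 / 2)"
    using tensor_dense[OF q unit_mat_D0[OF q] H(1)] tensor_dense[OF q unit_mat_D0[OF q] H(2)]
    unfolding Dom_def by meson
  have d: "\<phi> - y \<in> Hsp q 1" if "\<phi> \<in> Hsp q 1" "y \<in> Dom q" "hh q (\<phi> - y) < ennreal (e\<^sup>2 / 2)" for \<phi> y
  proof -
    have "entries_meas \<phi>" "entries_meas y" using that Dom_Hsp by (auto simp: Hsp_iff[OF q])
    then have "entries_meas (\<phi> - y)"
      unfolding entries_meas_def fun_diff_def by (intro allI borel_measurable_diff) auto
    moreover have "hh q (\<phi> - y) < \<infinity>" using that(3) by (rule order_less_trans) simp
    ultimately show ?thesis by (simp add: Hsp_iff[OF q])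
  qed
  have "ennreal ((ipnorm (hinner2 q 1) (\<psi> - y1, \<eta> - y2))\<^sup>2) = ennreal (1 - q) * (hh q (\<psi> - y1) + hh q (\<eta> - y2))"
    by (rule ipnorm_hinner2[OF q d[OF H(1) y(1,2)] d[OF H(2) y(3,4)]])
  also have "\<dots> \<le> 1 * (hh q (\<psi> - y1) + hh q (\<eta> - y2))"
    using q by (intro mult_right_mono) (auto simp: ennreal_le_1)
  also have "\<dots> < ennreal (e\<^sup>2 / 2) + ennreal (e\<^sup>2 / 2)"
    unfolding mult_1 using y by (intro add_strict_mono)
  also have "\<dots> = ennreal (e\<^sup>2)" by (subst ennreal_plus[symmetric]) auto
  finally have "(ipnorm (hinner2 q 1) (\<psi> - y1, \<eta> - y2))\<^sup>2 < e\<^sup>2"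
    by (simp add: ennreal_less_iff)
  then have "ipnorm (hinner2 q 1) (x - (y1, y2)) < e"
    using \<open>e > 0\<close> unfolding x_eq diff_Pair by (meson less_imp_le power_less_imp_less_base)
  then show "\<exists>y\<in>Dom q \<times> Dom q. ipnorm (hinner2 q 1) (x - y) < e" using y by blast
qed

lemma D1_symmetric_op:
  "symmetric_op (hinner2 q 1) (Hsp q 1 \<times> Hsp q 1) (Dom q \<times> Dom q) (D1 q \<gamma> c)"
  unfolding symmetric_op_def
proof (intro conjI ballI Dom_dense image_subsetI)
  fix x assume "x \<in> Dom q \<times> Dom q"
  then obtain \<psi>1 \<psi>2 where x: "x = (\<psi>1, \<psi>2)" "\<psi>1 \<in> tensor V C1S" "\<psi>2 \<in> tensor V C1S"
    using Dom_subset by blast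
  then show "D1 q \<gamma> c x \<in> Hsp q 1 \<times> Hsp q 1"
    using tensor_Hsp[OF q D1_components(1)[OF x(2,3)]] tensor_Hsp[OF q D1_components(2)[OF x(2,3)]]
    by (metis mem_Times_iff)
  fix y assume "y \<in> Dom q \<times> Dom q"
  then obtain \<eta>1 \<eta>2 where y: "y = (\<eta>1, \<eta>2)" "\<eta>1 \<in> tensor V C1S" "\<eta>2 \<in> tensor V C1S"
    using Dom_subset by blast
  show "hinner2 q 1 (D1 q \<gamma> c x) y = hinner2 q 1 x (D1 q \<gamma> c y)"
    unfolding x(1) y(1) by (rule D1_symmetric[OF x(2,3) y(2,3)])
qed

end

subsection \<open>The twisted commutator\<close>

text \<open>A right factor passes through the twisted left factor S by associativity. Hence the
  opposite elements respect the twisted Leibniz rule.\<close>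

lemma mmul_twist_right:
  assumes "banded K S" "banded L R"
  shows "(P + S \<odot> W) \<odot> R = P \<odot> R + S \<odot> (W \<odot> R)"
  by (simp add: mmul_add_left[OF assms(2)] mmul_assoc[OF assms])

context
  fixes q :: real and A A' B B' :: mat and K K' L :: nat
  assumes q: "0 < q" and A: "banded K A" "banded K A'" and B: "banded L B" "banded L B'"
begin

text \<open>A' and B' stand for the angular derivatives of A and B at a fixed t. They are
  independent matrices here, so that these rules are pure algebra.\<close>

lemma ypow_leibniz:
  "ypow q (-2) \<odot> (A' \<odot> B + A \<odot> B') = ypow q (-2) \<odot> A' \<odot> B + sig q 2 A \<odot> (ypow q (-2) \<odot> B')"
  by (simp add: mmul_add_right[OF banded_ypow] mmul_assoc[OF banded_ypow B(1)] ypow_mmul[OF q A(1) B(2)])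

lemma Hang_leibniz:
  "Hang q (A' \<odot> B + A \<odot> B') = ypow q (-2) \<odot> A' \<odot> B \<odot> ypow q 2 + sig q 2 A \<odot> Hang q B'"
  unfolding Hang_def ypow_leibniz by (rule mmul_twist_right[OF banded_sig[OF A(1)] banded_ypow])

lemma Eang_leibniz:
  "Eang q (A' \<odot> B + A \<odot> B') = ypow q (-2) \<odot> A' \<odot> B \<odot> yop q \<odot> zop q + sig q 2 A \<odot> Eang q B'"
  unfolding Eang_def ypow_leibniz
  by (simp only: mmul_twist_right[OF banded_sig[OF A(1)] banded_yop] mmul_twist_right[OF banded_sig[OF A(1)] banded_zop])

lemma Fang_leibniz:
  "Fang q (A' \<odot> B + A \<odot> B') = ypow q (-2) \<odot> A' \<odot> B \<odot> yop q \<odot> zstar q + sig q 2 A \<odot> Fang q B'"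
  unfolding Fang_def ypow_leibniz
  by (simp only: mmul_twist_right[OF banded_sig[OF A(1)] banded_yop] mmul_twist_right[OF banded_sig[OF A(1)] banded_zstar])

text \<open>Without a derivative there is no extra term, so the \<gamma>/2 part cancels in the
  twisted commutator; the same holds for F.\<close>

lemma Eang_mmul: "Eang q (A \<odot> B) = sig q 2 A \<odot> Eang q B"
  unfolding Eang_def ypow_mmul[OF q A(1) B(1)]
  by (simp only: mmul_assoc[OF banded_sig[OF A(1)] banded_yop] mmul_assoc[OF banded_sig[OF A(1)] banded_zop])

lemma Fang_mmul: "Fang q (A \<odot> B) = sig q 2 A \<odot> Fang q B"
  unfolding Fang_def ypow_mmul[OF q A(1) B(1)]
  by (simp only: mmul_assoc[OF banded_sig[OF A(1)] banded_yop] mmul_assoc[OF banded_sig[OF A(1)] banded_zstar])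

lemma Erad_mmul: "Erad q (A \<odot> B) = dzbar q A \<odot> B \<odot> yop q + sig q 2 A \<odot> Erad q B"
  unfolding Erad_def dzbar_mmul[OF q A(1) B(1)] by (rule mmul_twist_right[OF banded_sig[OF A(1)] banded_yop])

lemma Frad_mmul: "Frad q (A \<odot> B) = dz q A \<odot> B \<odot> yop q + sig q 2 A \<odot> Frad q B"
  unfolding Frad_def dz_mmul[OF q A(1) B(1)] by (rule mmul_twist_right[OF banded_sig[OF A(1)] banded_yop])

lemma Hrad_mmul: "Hrad q (A \<odot> B) =
    complex_of_real q \<cdot> (dz q A \<odot> B \<odot> zop q) - dzbar q A \<odot> B \<odot> zstar q + sig q 2 A \<odot> Hrad q B"
  unfolding Hrad_def dz_mmul[OF q A(1) B(1)] dzbar_mmul[OF q A(1) B(1)]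
    mmul_twist_right[OF banded_sig[OF A(1)] banded_zop] mmul_twist_right[OF banded_sig[OF A(1)] banded_zstar]
  by (simp add: msc_add mmul_diff_right[OF banded_sig[OF A(1)]] mmul_msc_right)

end

text \<open>In each term apart from the twisted one, \<psi> occurs undifferentiated between a matrix
  that depends on \<phi> and a bounded right factor. Those terms are the commutator.\<close>

lemma Hop_lmul:
  assumes q: "0 < q" and b: "banded K (\<phi> t)" "banded K (ddt \<phi> t)" "banded L (\<psi> t)" "banded L (ddt \<psi> t)"
    and d: "ddt (lmul \<phi> \<psi>) = lmul (ddt \<phi>) \<psi> + lmul \<phi> (ddt \<psi>)"
  shows "Hop q (lmul \<phi> \<psi>) t = complex_of_real q \<cdot> (dz q (\<phi> t) \<odot> \<psi> t \<odot> zop q) - dzbar q (\<phi> t) \<odot> \<psi> t \<odot> zstar q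
     + \<i> \<cdot> (ypow q (-2) \<odot> ddt \<phi> t \<odot> \<psi> t \<odot> ypow q 2) + sig q 2 (\<phi> t) \<odot> Hop q \<psi> t"
proof -
  have l: "lmul \<phi> \<psi> t = \<phi> t \<odot> \<psi> t" by (simp add: lmul_def)
  have dt: "ddt (lmul \<phi> \<psi>) t = ddt \<phi> t \<odot> \<psi> t + \<phi> t \<odot> ddt \<psi> t"
    unfolding d by (simp add: lmul_def)
  show ?thesis unfolding Hop_eq l dt Hrad_mmul[OF q b] Hang_leibniz[OF q b]
    mmul_add_right[OF banded_sig[OF b(1)]] mmul_msc_right msc_add by (simp only: add_ac)
qed

lemma Eop_lmul:
  assumes q: "0 < q" and b: "banded K (\<phi> t)" "banded K (ddt \<phi> t)" "banded L (\<psi> t)" "banded L (ddt \<psi> t)"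
    and d: "ddt (lmul \<phi> \<psi>) = lmul (ddt \<phi>) \<psi> + lmul \<phi> (ddt \<psi>)"
  shows "Eop q \<gamma> (lmul \<phi> \<psi>) t = (- complex_of_real (1 / q) * exp (- \<i> * t)) \<cdot> (dzbar q (\<phi> t) \<odot> \<psi> t \<odot> yop q)
     - (complex_of_real \<gamma> * exp (- \<i> * t) * \<i>) \<cdot> (ypow q (-2) \<odot> ddt \<phi> t \<odot> \<psi> t \<odot> yop q \<odot> zop q)
     + sig q 2 (\<phi> t) \<odot> Eop q \<gamma> \<psi> t"
proof -
  have l: "lmul \<phi> \<psi> t = \<phi> t \<odot> \<psi> t" by (simp add: lmul_def)
  have dt: "ddt (lmul \<phi> \<psi>) t = ddt \<phi> t \<odot> \<psi> t + \<phi> t \<odot> ddt \<psi> t"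
    unfolding d by (simp add: lmul_def)
  show ?thesis unfolding Eop_eq l dt Erad_mmul[OF q b] Eang_leibniz[OF q b] Eang_mmul[OF q b]
    mmul_diff_right[OF banded_sig[OF b(1)]] mmul_msc_right msc_add
  by (simp only: diff_conv_add_uminus minus_add_distrib add_ac)
qed

lemma Fop_lmul:
  assumes q: "0 < q" and b: "banded K (\<phi> t)" "banded K (ddt \<phi> t)" "banded L (\<psi> t)" "banded L (ddt \<psi> t)"
    and d: "ddt (lmul \<phi> \<psi>) = lmul (ddt \<phi>) \<psi> + lmul \<phi> (ddt \<psi>)"
  shows "Fop q \<gamma> (lmul \<phi> \<psi>) t = (complex_of_real q * exp (\<i> * t)) \<cdot> (dz q (\<phi> t) \<odot> \<psi> t \<odot> yop q)
     - (complex_of_real \<gamma> * exp (\<i> * t) * \<i>) \<cdot> (ypow q (-2) \<odot> ddt \<phi> t \<odot> \<psi> t \<odot> yop q \<odot> zstar q)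
     + sig q 2 (\<phi> t) \<odot> Fop q \<gamma> \<psi> t"
proof -
  have l: "lmul \<phi> \<psi> t = \<phi> t \<odot> \<psi> t" by (simp add: lmul_def)
  have dt: "ddt (lmul \<phi> \<psi>) t = ddt \<phi> t \<odot> \<psi> t + \<phi> t \<odot> ddt \<psi> t"
    unfolding d by (simp add: lmul_def)
  show ?thesis unfolding Fop_eq l dt Frad_mmul[OF q b] Fang_leibniz[OF q b] Fang_mmul[OF q b]
    mmul_diff_right[OF banded_sig[OF b(1)]] mmul_add_right[OF banded_sig[OF b(1)]] mmul_msc_right msc_add
  by (simp only: diff_conv_add_uminus minus_add_distrib add_ac)
qed

subsection \<open>Decay of the angular derivative\<close>

text \<open>With x = q^(2n) one has 1 - x \<le> sqrt(1 - x) \<le> 1. Thus z differs from the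
  backward shift by a term of order y^2, which \<open>y^(-2)\<close> can still absorb.\<close>

lemma aq_diff_le:
  assumes q: "0 < q" "q < 1" shows "cmod (1 - aq q n) \<le> q ^ (2 * n)"
proof -
  define x where "x = q ^ (2 * n)"
  have x: "0 \<le> x" "x \<le> 1" using q by (auto simp: x_def power_le_one)
  have "(1 - x)\<^sup>2 \<le> 1 - x" using x by (simp add: power2_eq_square mult_left_le)
  then have "1 - x \<le> sqrt (1 - x)" by (rule real_le_rsqrt)
  moreover have "sqrt (1 - x) \<le> 1" using x by simp
  moreover have "1 - aq q n = complex_of_real (1 - sqrt (1 - x))"
    by (simp add: aq_def x_def)
  ultimately show ?thesis unfolding x_def[symmetric] by (simp only: norm_of_real)
qed

text \<open>The commutator with the plain shift would be the difference of neighbouring entries on a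
  diagonal. Replacing the coefficients of \<open>zstar\<close> by 1 costs only terms of the same
  order q^(2m).\<close>

lemma F1D_diag_diff:
  assumes q: "0 < q" "q < 1" and f: "f \<in> F1D q"
  shows "\<exists>C. 0 \<le> C \<and> (\<forall>m n. cmod (f m n - f (Suc m) (Suc n)) \<le> C * q ^ (2 * m))"
proof -
  obtain K C0 where K: "banded K f" and C0: "bdd_mat C0 f"
    using f F1D_FD FD_iff[OF q] by blast
  obtain C1 where C1: "bdd_mat C1 (ypow q (-2) \<odot> mcomm (zstar q) f)"
    using f FD_iff[OF q] unfolding F1D_def by blast
  have nn: "0 \<le> C0" "0 \<le> C1" using C0 C1 bdd_mat_nonneg by auto
  have le: "q ^ (2 * Suc k) \<le> q ^ (2 * k)" for k using q by (intro power_decreasing) auto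
  \<comment> \<open>C1 bounds the commutator; C0 and C0/q^(2K) pay for replacing the coefficients at
    row and column by 1. The last one converts q^(2n) into q^(2m), which differ by at most q^(-2K)
    inside the band.\<close>
  let ?C = "C1 + C0 + C0 / q ^ (2 * K)"
  have "cmod (f m n - f (Suc m) (Suc n)) \<le> ?C * q ^ (2 * m)" for m n
  proof (cases "m + K < n \<or> n + K < m")
    case True
    then have "f m n = 0" "f (Suc m) (Suc n) = 0" using bandedD[OF K] by auto
    then show ?thesis using nn q by simp
  next
    case False
    have "cmod ((ypow q (-2) \<odot> mcomm (zstar q) f) (Suc m) n) \<le> C1"
      using C1 by (simp add: bdd_mat_def)
    moreover have "(ypow q (-2) \<odot> mcomm (zstar q) f) (Suc m) n
        = (aq q (Suc m) * f m n - f (Suc m) (Suc n) * aq q (Suc n)) / complex_of_real (q ^ (2 * Suc m))"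
      by (simp add: ypow_m2_mult[OF q(1)] mcomm_def zstar_mult mult_zstar)
    ultimately have "cmod (aq q (Suc m) * f m n - f (Suc m) (Suc n) * aq q (Suc n)) / q ^ (2 * Suc m) \<le> C1"
      using q by (simp only: norm_divide norm_of_real abs_of_pos zero_less_power)
    then have "cmod (aq q (Suc m) * f m n - f (Suc m) (Suc n) * aq q (Suc n)) \<le> C1 * q ^ (2 * Suc m)"
      using q by (simp add: divide_le_eq)
    also have "\<dots> \<le> C1 * q ^ (2 * m)" using nn le by (intro mult_left_mono)
    finally have 1: "cmod (aq q (Suc m) * f m n - f (Suc m) (Suc n) * aq q (Suc n)) \<le> C1 * q ^ (2 * m)" .
    have "cmod ((1 - aq q (Suc m)) * f m n) \<le> q ^ (2 * m) * C0"
      unfolding norm_mult using C0 q order_trans[OF aq_diff_le[OF q] le] by (intro mult_mono) (auto simp: bdd_mat_def)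
    then have 2: "cmod ((1 - aq q (Suc m)) * f m n) \<le> C0 * q ^ (2 * m)" by (simp only: mult.commute)
    have "cmod ((1 - aq q (Suc n)) * f (Suc m) (Suc n)) \<le> q ^ (2 * n) * C0"
      unfolding norm_mult using C0 q order_trans[OF aq_diff_le[OF q] le] by (intro mult_mono) (auto simp: bdd_mat_def)
    also have "\<dots> \<le> (q ^ (2 * m) / q ^ (2 * K)) * C0"
    proof (intro mult_right_mono nn)
      have "q ^ (2 * n + 2 * K) \<le> q ^ (2 * m)" using False q by (intro power_decreasing) auto
      then show "q ^ (2 * n) \<le> q ^ (2 * m) / q ^ (2 * K)" using q by (simp add: le_divide_eq power_add)
    qed
    finally have 3: "cmod ((1 - aq q (Suc n)) * f (Suc m) (Suc n)) \<le> C0 / q ^ (2 * K) * q ^ (2 * m)"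
      by (simp add: mult.commute)
    have "f m n - f (Suc m) (Suc n) = (aq q (Suc m) * f m n - f (Suc m) (Suc n) * aq q (Suc n))
        + (1 - aq q (Suc m)) * f m n - (1 - aq q (Suc n)) * f (Suc m) (Suc n)"
      by (simp add: algebra_simps)
    then have "cmod (f m n - f (Suc m) (Suc n)) \<le> cmod (aq q (Suc m) * f m n - f (Suc m) (Suc n) * aq q (Suc n))
        + cmod ((1 - aq q (Suc m)) * f m n) + cmod ((1 - aq q (Suc n)) * f (Suc m) (Suc n))"
      by (simp only:) (intro order_trans[OF norm_triangle_ineq4] add_right_mono norm_triangle_ineq)
    also have "\<dots> \<le> C1 * q ^ (2 * m) + C0 * q ^ (2 * m) + C0 / q ^ (2 * K) * q ^ (2 * m)"
      by (intro add_mono 1 2 3)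
    finally show ?thesis by (simp only: distrib_right)
  qed
  then show ?thesis using nn q by (intro exI[of _ ?C]) auto
qed

lemma tensor_diag_diff:
  assumes q: "0 < q" "q < 1" and "\<phi> \<in> tensor (F1D q) CT"
  shows "\<exists>C. \<forall>t\<in>{-pi..pi}. \<forall>m n. cmod (\<phi> t m n - \<phi> t (Suc m) (Suc n)) \<le> C * q ^ (2 * m)"
proof -
  obtain N :: nat and f g where \<phi>: "\<phi> = (\<lambda>t m n. \<Sum>j<N. f j m n * g j t)"
    and fg: "\<And>j. j < N \<Longrightarrow> f j \<in> F1D q" "\<And>j. j < N \<Longrightarrow> g j \<in> CT"
    by (rule tensorE[OF assms(3)]) (rule that)
  have "\<forall>j. \<exists>C. j < N \<longrightarrow> 0 \<le> C \<and> (\<forall>m n. cmod (f j m n - f j (Suc m) (Suc n)) \<le> C * q ^ (2 * m))"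
    using F1D_diag_diff[OF q fg(1)] by blast
  then obtain C where C: "\<And>j. j < N \<Longrightarrow> 0 \<le> C j"
    "\<And>j m n. j < N \<Longrightarrow> cmod (f j m n - f j (Suc m) (Suc n)) \<le> C j * q ^ (2 * m)" by metis
  have "\<forall>j. \<exists>D. j < N \<longrightarrow> 0 \<le> D \<and> (\<forall>t\<in>{-pi..pi}. cmod (g j t) \<le> D)" using fg(2) CT_bounded by metis
  then obtain D where D: "\<And>j. j < N \<Longrightarrow> 0 \<le> D j" "\<And>j t. j < N \<Longrightarrow> t \<in> {-pi..pi} \<Longrightarrow> cmod (g j t) \<le> D j" by metis
  have "cmod (\<phi> t m n - \<phi> t (Suc m) (Suc n)) \<le> (\<Sum>j<N. C j * D j) * q ^ (2 * m)" if t: "t \<in> {-pi..pi}" for t m n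
  proof -
    have "\<phi> t m n - \<phi> t (Suc m) (Suc n) = (\<Sum>j<N. (f j m n - f j (Suc m) (Suc n)) * g j t)"
      by (simp add: \<phi> left_diff_distrib sum_subtractf)
    also have "cmod \<dots> \<le> (\<Sum>j<N. (C j * q ^ (2 * m)) * D j)"
      using C D t q by (intro order_trans[OF norm_sum] sum_mono) (auto simp: norm_mult intro!: mult_mono)
    finally show ?thesis by (simp only: sum_distrib_left mult_ac)
  qed
  then show ?thesis by blast
qed

text \<open>The differences telescope along the diagonal, the far end disappears in the limit, and
  1/(1 - q^2) is the sum of the geometric series.\<close>

lemma diag_decay:
  assumes q: "0 < q" "q < 1"
    and d: "\<And>m n. cmod (F m n - F (Suc m) (Suc n)) \<le> C * q ^ (2 * m)"
    and lim: "(\<lambda>j. F (m + j) (n + j)) \<longlonglongrightarrow> 0"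
  shows "cmod (F m n) \<le> C / (1 - q\<^sup>2) * q ^ (2 * m)"
proof -
  have "0 \<le> C" using order_trans[OF norm_ge_zero d[of 0 0]] by simp
  have q2: "0 \<le> q\<^sup>2" "q\<^sup>2 < 1" using q by (auto simp: power_less_one_iff abs_square_less_1)
  have 1: "cmod (F m n - F (m + J) (n + J)) \<le> (\<Sum>j<J. C * q ^ (2 * (m + j)))" for J
  proof (induction J)
    case (Suc J)
    have "cmod (F m n - F (m + Suc J) (n + Suc J))
        \<le> cmod (F m n - F (m + J) (n + J)) + cmod (F (m + J) (n + J) - F (Suc (m + J)) (Suc (n + J)))"
      by (rule order_trans[OF _ norm_triangle_ineq]) simp
    then show ?case using Suc d[of "m + J" "n + J"] by simp
  qed simp
  have 2: "(\<Sum>j<J. C * q ^ (2 * (m + j))) \<le> C / (1 - q\<^sup>2) * q ^ (2 * m)" for J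
  proof -
    have "q ^ (2 * (m + j)) = q ^ (2 * m) * (q\<^sup>2) ^ j" for j
      by (simp only: distrib_left power_add power_mult)
    then have "(\<Sum>j<J. C * q ^ (2 * (m + j))) = (C * q ^ (2 * m)) * (\<Sum>j<J. (q\<^sup>2) ^ j)"
      by (simp only: sum_distrib_left mult.assoc)
    also have "(\<Sum>j<J. (q\<^sup>2) ^ j) \<le> (\<Sum>j. (q\<^sup>2) ^ j)"
      using q2 by (intro sum_le_suminf summable_geometric) auto
    also have "(\<Sum>j. (q\<^sup>2) ^ j) = 1 / (1 - q\<^sup>2)" using q2 by (intro suminf_geometric) auto
    finally show ?thesis using \<open>0 \<le> C\<close> q by (simp add: mult_left_mono)
  qed
  have "(\<lambda>J. cmod (F m n - F (m + J) (n + J))) \<longlonglongrightarrow> cmod (F m n - 0)"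
    by (intro tendsto_norm tendsto_diff tendsto_const lim)
  then show ?thesis
    using order_trans[OF 1 2] by (intro LIMSEQ_le_const2[where X = "\<lambda>J. cmod (F m n - F (m + J) (n + J))"]) auto
qed

lemma le_suminf_ennreal:
  fixes f :: "nat \<Rightarrow> ennreal" shows "f i \<le> (\<Sum>i. f i)"
  using sum_le_suminf[of f "{i}"] by simp

text \<open>The test element \<open>unit_mat k 0\<close> carries column k of X into column 0, where
  the weight is 1, and its own norm does not depend on k. The operator bound becomes a bound on the
  entries that is uniform in row and column.\<close>

lemma lmul_bounded_entries:
  assumes q: "0 < q" "q < 1" and X: "lmul_bounded q X"
  shows "entries_meas X"
    "\<exists>M. \<forall>m k. (\<integral>\<^sup>+t. ennreal ((cmod (X t m k))\<^sup>2) \<partial>circle) \<le> ennreal M"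
proof -
  let ?u = "\<lambda>k (t :: real). unit_mat k 0"
  have u: "?u k \<in> tensor (FD0 q) C1S" for k
  proof -
    have "unit_mat k 0 \<in> FD0 q"
      by (rule finite_supp_in_FD0[OF q, of "Suc k"]) (auto simp: unit_mat_def)
    from tensor_single[OF this C1S_const[of 1]] show ?thesis by simp
  qed
  have eq: "lmul X (?u k) t m 0 = X t m k" for t m k
  proof -
    have "(X t \<odot> unit_mat k 0) m 0 = (\<Sum>\<^sub>\<infinity>j\<in>{k}. X t m k)"
      unfolding mmul_def by (rule infsum_cong_neutral) (auto simp: unit_mat_def)
    then show ?thesis by (simp add: lmul_def)
  qed
  obtain C where S: "tensor (FD0 q) C1S \<subseteq> Hsp q 1" and T: "lmul X ` tensor (FD0 q) C1S \<subseteq> Hsp q 1"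
    and C: "\<And>x. x \<in> tensor (FD0 q) C1S \<Longrightarrow> ipnorm (hinner q 1) (lmul X x) \<le> C * ipnorm (hinner q 1) x"
    using X unfolding lmul_bounded_def bounded_op_def by blast
  have H: "?u k \<in> Hsp q 1" "lmul X (?u k) \<in> Hsp q 1" for k using S T u by blast+
  have m: "entries_meas (lmul X (?u k))" for k using H(2) by (simp add: Hsp_iff[OF q])
  show "entries_meas X" unfolding entries_meas_def
    using entries_measD[OF m, where n = 0] by (simp add: eq)
  have hu: "hh q (?u k) = ennreal (2 * pi)" for k
  proof -
    have "nnorm2 q (unit_mat k 0) = (\<Sum>n. if n = 0 then 1 else 0)"
      unfolding nnorm2_def
    proof (intro suminf_cong)
      fix n
      show "(\<Sum>m. ennreal (q ^ n * (cmod (unit_mat k 0 m n))\<^sup>2)) = (if n = 0 then 1 else 0)"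
        by (subst suminf_finite[of "{k}"]) (auto simp: unit_mat_def)
    qed
    also have "\<dots> = 1" by (subst suminf_finite[of "{0}"]) auto
    finally show ?thesis by (simp add: hh_def emeasure_circle[simplified])
  qed
  have "(\<integral>\<^sup>+t. ennreal ((cmod (X t m k))\<^sup>2) \<partial>circle) \<le> ennreal (C\<^sup>2 * (2 * pi))" for m k
  proof -
    have "(\<integral>\<^sup>+t. ennreal ((cmod (X t m k))\<^sup>2) \<partial>circle) \<le> hh q (lmul X (?u k))"
      unfolding hh_def
    proof (rule nn_integral_mono)
      fix t
      let ?Y = "lmul X (?u k) t"
      have "ennreal (q ^ 0 * (cmod (?Y m 0))\<^sup>2) \<le> (\<Sum>m. ennreal (q ^ 0 * (cmod (?Y m 0))\<^sup>2))"
        by (rule le_suminf_ennreal[of "\<lambda>m. ennreal (q ^ 0 * (cmod (?Y m 0))\<^sup>2)" m])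
      also have "\<dots> \<le> nnorm2 q ?Y" unfolding nnorm2_def
        by (rule le_suminf_ennreal[of "\<lambda>n. \<Sum>m. ennreal (q ^ n * (cmod (?Y m n))\<^sup>2)" 0])
      finally show "ennreal ((cmod (X t m k))\<^sup>2) \<le> nnorm2 q ?Y" by (simp add: eq)
    qed
    moreover have "ennreal (1 - q) * hh q (lmul X (?u k)) \<le> ennreal (1 - q) * (ennreal (C\<^sup>2) * ennreal (2 * pi))"
    proof -
      have p: "0 \<le> ipnorm (hinner q 1) (lmul X (?u k))"
        unfolding ipnorm_def using hinner_self(1)[OF q H(2)] by simp
      have "ennreal (1 - q) * hh q (lmul X (?u k)) = ennreal ((ipnorm (hinner q 1) (lmul X (?u k)))\<^sup>2)"
        by (rule ipnorm_hinner[OF q H(2), symmetric])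
      also have "\<dots> \<le> ennreal ((C * ipnorm (hinner q 1) (?u k))\<^sup>2)"
        using C[OF u] p by (intro ennreal_leI power_mono)
      also have "\<dots> = ennreal (C\<^sup>2) * ennreal ((ipnorm (hinner q 1) (?u k))\<^sup>2)"
        by (simp add: power_mult_distrib ennreal_mult)
      also have "\<dots> = ennreal (1 - q) * (ennreal (C\<^sup>2) * ennreal (2 * pi))"
        unfolding ipnorm_hinner[OF q H(1)] hu by (simp only: mult_ac)
      finally show ?thesis .
    qed
    then have "hh q (lmul X (?u k)) \<le> ennreal (C\<^sup>2) * ennreal (2 * pi)"
      using q by (subst (asm) ennreal_mult_le_mult_iff) auto
    ultimately show ?thesis by (simp add: ennreal_mult)
  qed
  then show "\<exists>M. \<forall>m k. (\<integral>\<^sup>+t. ennreal ((cmod (X t m k))\<^sup>2) \<partial>circle) \<le> ennreal M" by blast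
qed

text \<open>A Borel-Cantelli argument: X is controlled only in mean square, but the factor q^j makes
  the integrals of |U_j|^2 summable. The sum of |U_j|^2 is therefore finite for almost every t, and
  its terms tend to 0.\<close>

lemma AE_vanishing:
  fixes U X :: "nat \<Rightarrow> real \<Rightarrow> complex"
  assumes q: "0 < q" "q < 1" and "0 \<le> K" "0 \<le> D"
    and U: "\<And>j. U j \<in> borel_measurable circle" and X: "\<And>j. X j \<in> borel_measurable circle"
    and UX: "\<And>j. AE t in circle. cmod (U j t) \<le> K * q ^ j * (cmod (X j t) + D)"
    and M: "\<And>j. (\<integral>\<^sup>+t. ennreal ((cmod (X j t))\<^sup>2) \<partial>circle) \<le> ennreal M"
  shows "AE t in circle. (\<lambda>j. U j t) \<longlonglongrightarrow> 0"
proof -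
  note [measurable] = U X
  let ?B = "max M 0 + D\<^sup>2 * (2 * pi)"
  have 1: "(\<integral>\<^sup>+t. ennreal ((cmod (U j t))\<^sup>2) \<partial>circle) \<le> ennreal (2 * K\<^sup>2 * ?B * q ^ j)" for j
  proof -
    have "(\<integral>\<^sup>+t. ennreal ((cmod (U j t))\<^sup>2) \<partial>circle)
       \<le> (\<integral>\<^sup>+t. ennreal (2 * K\<^sup>2 * q ^ j) * (ennreal ((cmod (X j t))\<^sup>2) + ennreal (D\<^sup>2)) \<partial>circle)"
    proof (rule nn_integral_mono_AE)
      show "AE t in circle. ennreal ((cmod (U j t))\<^sup>2) \<le> ennreal (2 * K\<^sup>2 * q ^ j) * (ennreal ((cmod (X j t))\<^sup>2) + ennreal (D\<^sup>2))"
        using UX[of j]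
      proof eventually_elim
        case (elim t)
        \<comment> \<open>One of the two powers of q^j is enough for summability.\<close>
        have qj: "q ^ j * q ^ j \<le> q ^ j" using q by (simp add: mult_left_le power_le_one)
        have "(cmod (U j t))\<^sup>2 \<le> (K * q ^ j * (cmod (X j t) + D))\<^sup>2"
          using elim by (intro power_mono) auto
        also have "\<dots> = (K\<^sup>2 * (cmod (X j t) + D)\<^sup>2) * (q ^ j * q ^ j)"
          by (simp add: power2_eq_square mult_ac)
        also have "\<dots> \<le> (K\<^sup>2 * (cmod (X j t) + D)\<^sup>2) * q ^ j"
          using qj by (intro mult_left_mono) auto
        also have "\<dots> \<le> (K\<^sup>2 * (2 * ((cmod (X j t))\<^sup>2 + D\<^sup>2))) * q ^ j"
          using sum_squares_bound[of "cmod (X j t)" D] q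
          by (intro mult_right_mono mult_left_mono) (auto simp: power2_sum)
        finally have "ennreal ((cmod (U j t))\<^sup>2) \<le> ennreal ((2 * K\<^sup>2 * q ^ j) * ((cmod (X j t))\<^sup>2 + D\<^sup>2))"
          by (intro ennreal_leI) (simp only: mult_ac)
        then show ?case using q by (simp add: ennreal_mult)
      qed
    qed
    also have "\<dots> = ennreal (2 * K\<^sup>2 * q ^ j) * ((\<integral>\<^sup>+t. ennreal ((cmod (X j t))\<^sup>2) \<partial>circle) + (\<integral>\<^sup>+t. ennreal (D\<^sup>2) \<partial>circle))"
      by (subst nn_integral_cmult, measurable, subst nn_integral_add) auto
    also have "(\<integral>\<^sup>+t. ennreal (D\<^sup>2) \<partial>circle) = ennreal (D\<^sup>2 * (2 * pi))"
      using emeasure_circle by (simp add: ennreal_mult)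
    also have "ennreal (2 * K\<^sup>2 * q ^ j) * ((\<integral>\<^sup>+t. ennreal ((cmod (X j t))\<^sup>2) \<partial>circle) + ennreal (D\<^sup>2 * (2 * pi)))
       \<le> ennreal (2 * K\<^sup>2 * q ^ j) * (ennreal (max M 0) + ennreal (D\<^sup>2 * (2 * pi)))"
      by (intro mult_left_mono add_right_mono order_trans[OF M ennreal_leI]) auto
    also have "\<dots> = ennreal (2 * K\<^sup>2 * q ^ j) * ennreal ?B"
      by (subst ennreal_plus) auto
    also have "\<dots> = ennreal ((2 * K\<^sup>2 * q ^ j) * ?B)"
      using q by (intro ennreal_mult[symmetric]) auto
    finally show ?thesis by (simp add: mult_ac)
  qed
  have "(\<integral>\<^sup>+t. (\<Sum>j. ennreal ((cmod (U j t))\<^sup>2)) \<partial>circle) = (\<Sum>j. \<integral>\<^sup>+t. ennreal ((cmod (U j t))\<^sup>2) \<partial>circle)"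
    by (rule nn_integral_suminf) measurable
  also have "\<dots> \<le> (\<Sum>j. ennreal (2 * K\<^sup>2 * ?B * q ^ j))"
    by (intro suminf_le 1) auto
  also have "\<dots> < top"
    unfolding less_top[symmetric] using q by (intro ennreal_suminf_neq_top summable_mult summable_geometric) auto
  finally have "(\<integral>\<^sup>+t. (\<Sum>j. ennreal ((cmod (U j t))\<^sup>2)) \<partial>circle) \<noteq> \<infinity>"
    by simp
  then have "AE t in circle. (\<Sum>j. ennreal ((cmod (U j t))\<^sup>2)) \<noteq> \<infinity>"
    by (intro nn_integral_PInf_AE) measurable
  then show ?thesis
  proof eventually_elim
    case (elim t)
    then have "summable (\<lambda>j. (cmod (U j t))\<^sup>2)"
      by (intro summable_suminf_not_top) auto
    then have "(\<lambda>j. sqrt ((cmod (U j t))\<^sup>2)) \<longlonglongrightarrow> sqrt 0"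
      by (intro tendsto_real_sqrt summable_LIMSEQ_zero)
    then show ?case by (simp add: tendsto_norm_zero_iff)
  qed
qed

text \<open>Away from index 0, where the coefficient vanishes, it is bounded below and can be
  divided out.\<close>

lemma aq_Suc_ge:
  assumes q: "0 < q" "q < 1" shows "sqrt (1 - q\<^sup>2) \<le> cmod (aq q (Suc n))"
proof -
  have "q ^ (2 * Suc n) \<le> q ^ 2" using q by (intro power_decreasing) auto
  then have "sqrt (1 - q\<^sup>2) \<le> sqrt (1 - q ^ (2 * Suc n))" by simp
  also have "\<dots> \<le> cmod (aq q (Suc n))" by (simp only: aq_def norm_of_real abs_ge_self)
  finally show ?thesis .
qed

text \<open>The entries of \<open>E(\<phi>)\<close> and \<open>F(\<phi>)\<close> have this form, \<open>u\<close> being an entry of \<open>\<i> \<partial>\<^sub>t \<phi> + \<phi>/2\<close> or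
  \<open>\<i> \<partial>\<^sub>t \<phi> - \<phi>/2\<close>.\<close>

lemma solve_for_entry:
  fixes X R u a c :: complex
  assumes q: "0 < q" and c: "cmod c = 1" and \<gamma>: "\<gamma> \<noteq> 0" and a: "0 < r" "r \<le> cmod a" and R: "cmod R \<le> D"
    and X: "X = c * (R - complex_of_real \<gamma> * (u / complex_of_real q ^ (2 * m)) * complex_of_real q ^ n * a)"
  shows "cmod u \<le> (q ^ (2 * m) / q ^ n) / (\<bar>\<gamma>\<bar> * r) * (cmod X + D)"
proof -
  have "c \<noteq> 0" using c by auto
  then have "complex_of_real \<gamma> * (u / complex_of_real q ^ (2 * m)) * complex_of_real q ^ n * a = R - X / c"
    using X by simp
  then have "cmod (complex_of_real \<gamma> * (u / complex_of_real q ^ (2 * m)) * complex_of_real q ^ n * a) \<le> D + cmod X"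
    using norm_triangle_ineq4[of R "X / c"] R by (simp add: norm_divide c)
  then have *: "\<bar>\<gamma>\<bar> * (cmod u / q ^ (2 * m)) * q ^ n * cmod a \<le> D + cmod X"
    using q by (simp add: norm_mult norm_divide norm_power)
  have "\<bar>\<gamma>\<bar> * (cmod u / q ^ (2 * m)) * q ^ n * r \<le> \<bar>\<gamma>\<bar> * (cmod u / q ^ (2 * m)) * q ^ n * cmod a"
    using a q by (intro mult_left_mono) auto
  also note *
  finally have "cmod u * (q ^ n * (\<bar>\<gamma>\<bar> * r)) / q ^ (2 * m) \<le> D + cmod X" by (simp add: mult_ac)
  then have "cmod u * (q ^ n * (\<bar>\<gamma>\<bar> * r)) \<le> (D + cmod X) * q ^ (2 * m)"
    using q by (simp add: divide_le_eq)
  moreover have "0 < q ^ n * (\<bar>\<gamma>\<bar> * r)" using q \<gamma> a by simp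
  ultimately have "cmod u \<le> (D + cmod X) * q ^ (2 * m) / (q ^ n * (\<bar>\<gamma>\<bar> * r))"
    by (simp only: le_divide_eq if_True)
  then show ?thesis by (simp add: mult_ac add.commute)
qed

lemma Eop_entry:
  assumes "0 < q"
  shows "Eop q \<gamma> \<phi> t m (Suc n) = exp (- \<i> * complex_of_real t) *
    (- complex_of_real (1 / q) * dzbar q (\<phi> t) m (Suc n) * complex_of_real q ^ Suc n
     - complex_of_real \<gamma> * ((\<i> * ddt \<phi> t m n + \<phi> t m n / 2) / complex_of_real q ^ (2 * m)) * complex_of_real q ^ n * aq q (Suc n))"
  using assms
  by (simp add: Eop_eq Erad_def Eang_def msc_def mult_yop mult_zop ypow_m2_mult add_divide_distrib algebra_simps)

text \<open>Right multiplication by \<open>y zstar\<close> reads column n+1, so F gives no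
  information on column 0 of \<phi>. In \<open>Eop_entry\<close> the factor \<open>y z\<close> reads
  column n from column n+1 and reaches every column.\<close>

lemma Fop_entry:
  assumes "0 < q"
  shows "Fop q \<gamma> \<phi> t m n = exp (\<i> * complex_of_real t) *
    (complex_of_real q * dz q (\<phi> t) m n * complex_of_real q ^ n
     - complex_of_real \<gamma> * ((\<i> * ddt \<phi> t m (Suc n) - \<phi> t m (Suc n) / 2) / complex_of_real q ^ (2 * m)) * complex_of_real q ^ Suc n * aq q (Suc n))"
  using assms
  by (simp add: Fop_eq Frad_def Fang_def msc_def mult_yop mult_zstar ypow_m2_mult diff_divide_distrib algebra_simps)

context
  fixes q \<gamma> :: real
  assumes q: "0 < q" "q < 1" and \<gamma>: "\<gamma> \<noteq> 0"
begin

lemma F1D_banded: "f \<in> F1D q \<Longrightarrow> \<exists>K. banded K f"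
  using F1D_FD FD_banded[OF q] by blast

lemma D0_F1D: "f \<in> D0 q \<Longrightarrow> f \<in> F1D q"
  by (simp add: D0_def)

lemma F1D_tensor_CT: "\<phi> \<in> tensor (F1D q) C1S \<Longrightarrow> \<phi> \<in> tensor (F1D q) CT"
  using tensor_mono[OF order_refl C1S_subset_CT] by blast

lemma ubanded_ops:
  assumes "\<phi> \<in> tensor (F1D q) C1S"
  shows "ubanded \<phi>" "ubanded (\<lambda>t. dz q (\<phi> t))" "ubanded (\<lambda>t. dzbar q (\<phi> t))" "ubanded (sighat q 2 \<phi>)"
proof -
  note T = F1D_tensor_CT[OF assms]
  have FD: "f \<in> FD q" if "f \<in> F1D q" for f using that F1D_FD by blast
  show "ubanded \<phi>" using ubanded_tensor[OF q tensor_map[OF tlin_id T FD]] by simp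
  show "ubanded (\<lambda>t. dz q (\<phi> t))" by (rule ubanded_tensor[OF q tensor_map[OF tlin_dz T dz_FD[OF q]]])
  show "ubanded (\<lambda>t. dzbar q (\<phi> t))" by (rule ubanded_tensor[OF q tensor_map[OF tlin_dzbar T dzbar_FD[OF q]]])
  show "ubanded (sighat q 2 \<phi>)" unfolding sighat_def
    by (rule ubanded_tensor[OF q tensor_map[OF tlin_sig T FD_sig[OF q FD]]])
qed

text \<open>One step down a diagonal gains q^2 on inverting \<open>y^(-2)\<close> and loses q on
  inverting the right factor y. The net factor q per step is the decay that
  \<open>AE_vanishing\<close> requires.\<close>

lemma power_shift_quotient: "q ^ (2 * (m + j)) / q ^ (k + j) = q ^ (2 * m) / q ^ k * q ^ j"
proof -
  have "2 * (m + j) = 2 * m + (j + j)" by simp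
  then show ?thesis using q by (simp only: power_add) simp
qed

lemma vanishing_at_infinity:
  assumes \<phi>: "\<phi> \<in> tensor (F1D q) C1S" and E: "lmul_bounded q (Eop q \<gamma> \<phi>)" and F: "lmul_bounded q (Fop q \<gamma> \<phi>)"
  shows "AE t in circle. (\<lambda>j. ddt \<phi> t (m + j) (n + j)) \<longlonglongrightarrow> 0"
proof -
  let ?r = "sqrt (1 - q\<^sup>2)"
  have r: "0 < ?r" using q by (simp add: power_less_one_iff abs_square_less_1)
  have meas: "entries_meas \<phi>" "entries_meas (ddt \<phi>)"
    using tensor_CT_meas[OF F1D_tensor_CT[OF \<phi>]] tensor_CT_meas[OF ddt_in_tensor[OF \<phi>]] by auto
  note mE = entries_measD[OF lmul_bounded_entries(1)[OF q E]]
    and mF = entries_measD[OF lmul_bounded_entries(1)[OF q F]]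
  obtain ME MF where ME: "\<And>m k. (\<integral>\<^sup>+t. ennreal ((cmod (Eop q \<gamma> \<phi> t m k))\<^sup>2) \<partial>circle) \<le> ennreal ME"
    and MF: "\<And>m k. (\<integral>\<^sup>+t. ennreal ((cmod (Fop q \<gamma> \<phi> t m k))\<^sup>2) \<partial>circle) \<le> ennreal MF"
    using lmul_bounded_entries(2)[OF q E] lmul_bounded_entries(2)[OF q F] by blast
  obtain C C' where C: "AE t in circle. bdd_mat C (dzbar q (\<phi> t))" and C': "AE t in circle. bdd_mat C' (dz q (\<phi> t))"
    using ubanded_ops(2,3)[OF \<phi>] unfolding ubanded_def by blast
  \<comment> \<open>The constant \<open>max C 0 / q\<close> bounds the radial term of E; the maximum
    keeps it nonnegative.\<close>
  have "AE t in circle. (\<lambda>j. \<i> * ddt \<phi> t (m + j) (n + j) + \<phi> t (m + j) (n + j) / 2) \<longlonglongrightarrow> 0"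
  proof (rule AE_vanishing[OF q, where K = "q ^ (2 * m) / q ^ n / (\<bar>\<gamma>\<bar> * ?r)" and D = "max C 0 / q"
        and X = "\<lambda>j t. Eop q \<gamma> \<phi> t (m + j) (Suc (n + j))" and M = ME])
    show "0 \<le> q ^ (2 * m) / q ^ n / (\<bar>\<gamma>\<bar> * ?r)" "0 \<le> max C 0 / q" using q r by auto
    show "(\<lambda>t. \<i> * ddt \<phi> t (m + j) (n + j) + \<phi> t (m + j) (n + j) / 2) \<in> borel_measurable circle" for j
      by (intro borel_measurable_add borel_measurable_times borel_measurable_divide borel_measurable_const
          entries_measD meas)
    show "AE t in circle. cmod (\<i> * ddt \<phi> t (m + j) (n + j) + \<phi> t (m + j) (n + j) / 2)
       \<le> q ^ (2 * m) / q ^ n / (\<bar>\<gamma>\<bar> * ?r) * q ^ j * (cmod (Eop q \<gamma> \<phi> t (m + j) (Suc (n + j))) + max C 0 / q)" for j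
      using C
    proof eventually_elim
      case (elim t)
      have "cmod (- complex_of_real (1 / q) * dzbar q (\<phi> t) (m + j) (Suc (n + j)) * complex_of_real q ^ Suc (n + j))
          \<le> 1 / q * max C 0 * 1"
        unfolding norm_mult using elim q
        by (intro mult_mono) (auto simp: bdd_mat_def norm_power norm_divide simp del: power_Suc
              intro: max.coboundedI1 intro!: power_le_one)
      then have "cmod (- complex_of_real (1 / q) * dzbar q (\<phi> t) (m + j) (Suc (n + j)) * complex_of_real q ^ Suc (n + j))
          \<le> max C 0 / q" by simp
      from solve_for_entry[OF q(1) _ \<gamma> r aq_Suc_ge[OF q, of "n + j"] this Eop_entry[OF q(1), of \<gamma> \<phi> t "m + j" "n + j"]]
      have "cmod (\<i> * ddt \<phi> t (m + j) (n + j) + \<phi> t (m + j) (n + j) / 2)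
         \<le> q ^ (2 * (m + j)) / q ^ (n + j) / (\<bar>\<gamma>\<bar> * ?r) * (cmod (Eop q \<gamma> \<phi> t (m + j) (Suc (n + j))) + max C 0 / q)"
        by (simp add: norm_exp_eq_Re)
      then show ?case unfolding power_shift_quotient by (simp only: times_divide_eq_left times_divide_eq_right mult_ac)
    qed
  qed (intro mE ME)+
  moreover have "AE t in circle. (\<lambda>j. \<i> * ddt \<phi> t (m + j) (Suc n + j) - \<phi> t (m + j) (Suc n + j) / 2) \<longlonglongrightarrow> 0" for m n
  proof (rule AE_vanishing[OF q, where K = "q ^ (2 * m) / q ^ Suc n / (\<bar>\<gamma>\<bar> * ?r)" and D = "max C' 0 * q"
        and X = "\<lambda>j t. Fop q \<gamma> \<phi> t (m + j) (n + j)" and M = MF])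
    show "0 \<le> q ^ (2 * m) / q ^ Suc n / (\<bar>\<gamma>\<bar> * ?r)" "0 \<le> max C' 0 * q" using q r by auto
    show "(\<lambda>t. \<i> * ddt \<phi> t (m + j) (Suc n + j) - \<phi> t (m + j) (Suc n + j) / 2) \<in> borel_measurable circle" for j
      by (intro borel_measurable_diff borel_measurable_times borel_measurable_divide borel_measurable_const
          entries_measD meas)
    show "AE t in circle. cmod (\<i> * ddt \<phi> t (m + j) (Suc n + j) - \<phi> t (m + j) (Suc n + j) / 2)
       \<le> q ^ (2 * m) / q ^ Suc n / (\<bar>\<gamma>\<bar> * ?r) * q ^ j * (cmod (Fop q \<gamma> \<phi> t (m + j) (n + j)) + max C' 0 * q)" for j
      using C'
    proof eventually_elim
      case (elim t)
      have "cmod (complex_of_real q * dz q (\<phi> t) (m + j) (n + j) * complex_of_real q ^ (n + j))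
          \<le> q * max C' 0 * 1"
        unfolding norm_mult using elim q
        by (intro mult_mono) (auto simp: bdd_mat_def norm_power intro: max.coboundedI1 power_le_one)
      then have "cmod (complex_of_real q * dz q (\<phi> t) (m + j) (n + j) * complex_of_real q ^ (n + j)) \<le> max C' 0 * q"
        by (simp add: mult.commute)
      from solve_for_entry[OF q(1) _ \<gamma> r aq_Suc_ge[OF q, of "n + j"] this Fop_entry[OF q(1), of \<gamma> \<phi> t "m + j" "n + j"]]
      have "cmod (\<i> * ddt \<phi> t (m + j) (Suc n + j) - \<phi> t (m + j) (Suc n + j) / 2)
         \<le> q ^ (2 * (m + j)) / q ^ (Suc n + j) / (\<bar>\<gamma>\<bar> * ?r) * (cmod (Fop q \<gamma> \<phi> t (m + j) (n + j)) + max C' 0 * q)"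
        by (simp add: norm_exp_eq_Re)
      then show ?case unfolding power_shift_quotient by (simp only: times_divide_eq_left times_divide_eq_right mult_ac)
    qed
  qed (intro mF MF)+
  \<comment> \<open>F reaches columns from 1 on only, so its limit is taken one step down the
    diagonal through (m, n) and shifted back by \<open>LIMSEQ_imp_Suc\<close>.\<close>
  from this[of "Suc m" n] calculation show ?thesis
  proof eventually_elim
    case (elim t)
    have "(\<lambda>j. \<i> * ddt \<phi> t (m + Suc j) (n + Suc j) - \<phi> t (m + Suc j) (n + Suc j) / 2) \<longlonglongrightarrow> 0"
      using elim(1) by simp
    then have "(\<lambda>j. \<i> * ddt \<phi> t (m + j) (n + j) - \<phi> t (m + j) (n + j) / 2) \<longlonglongrightarrow> 0"
      by (rule LIMSEQ_imp_Suc)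
    \<comment> \<open>Adding the two limits cancels \<phi>/2 and leaves 2\<i> times the derivative;
      the factor -\<i>/2 normalises it.\<close>
    from tendsto_mult[OF tendsto_const[of "- \<i> / 2"] tendsto_add[OF elim(2) this]]
    show ?case by (simp add: algebra_simps)
  qed
qed

lemma ubanded_angular:
  assumes \<phi>: "\<phi> \<in> tensor (F1D q) C1S" and E: "lmul_bounded q (Eop q \<gamma> \<phi>)" and F: "lmul_bounded q (Fop q \<gamma> \<phi>)"
  shows "ubanded (\<lambda>t. ypow q (-2) \<odot> ddt \<phi> t)"
proof -
  obtain C where C: "\<And>t m n. t \<in> {-pi..pi} \<Longrightarrow> cmod (ddt \<phi> t m n - ddt \<phi> t (Suc m) (Suc n)) \<le> C * q ^ (2 * m)"
    using tensor_diag_diff[OF q ddt_in_tensor[OF \<phi>]] by blast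
  obtain K where K: "\<And>t. banded K (ddt \<phi> t)"
    by (rule tensor_uniform_banded[OF \<phi>]; blast intro: F1D_banded that)
  \<comment> \<open>There are countably many starting points (m, n), so one null set serves all
    diagonals.\<close>
  have "AE t in circle. \<forall>m n. (\<lambda>j. ddt \<phi> t (m + j) (n + j)) \<longlonglongrightarrow> 0"
    unfolding AE_all_countable using vanishing_at_infinity[OF assms] by blast
  then have "AE t in circle. bdd_mat (C / (1 - q\<^sup>2)) (ypow q (-2) \<odot> ddt \<phi> t)"
    using AE_space
  proof eventually_elim
    case (elim t)
    show ?case unfolding bdd_mat_def
    proof (intro allI)
      fix m n
      have "cmod (ddt \<phi> t m n) \<le> C / (1 - q\<^sup>2) * q ^ (2 * m)"
        using elim C[of t] by (intro diag_decay[OF q, of "ddt \<phi> t"]) auto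
      then show "cmod ((ypow q (-2) \<odot> ddt \<phi> t) m n) \<le> C / (1 - q\<^sup>2)"
        using q by (simp add: ypow_m2_mult[OF q(1)] norm_divide norm_power pos_divide_le_eq)
    qed
  qed
  moreover have "entries_meas (\<lambda>t. ypow q (-2) \<odot> ddt \<phi> t)"
    by (rule tensor_CT_meas[OF tensor_map[OF tlin_mmul_left[OF banded_ypow] ddt_in_tensor[OF \<phi>] UNIV_I]])
  moreover have "banded (0 + K) (ypow q (-2) \<odot> ddt \<phi> t)" for t
    by (rule banded_mmul[OF banded_ypow K])
  ultimately show ?thesis unfolding ubanded_def by blast
qed

lemma hbdd_sandwich:
  assumes "ubanded X" "banded K R" "bdd_mat C R"
  shows "hbdd q (\<lambda>\<psi> t. X t \<odot> \<psi> t \<odot> R)"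
  using hbdd_comp[OF hbdd_rmul[OF q assms(2,3)] hbdd_lmul[OF q(1) assms(1)]] by (simp add: lmul_def)

lemma hbdd_scaled:
  assumes "u \<in> CT" "\<And>t. cmod (u t) \<le> C" "hbdd q T"
  shows "hbdd q (\<lambda>\<psi> t. u t \<cdot> T \<psi> t)"
  using hbdd_comp[OF hbdd_scale[OF continuous_measurable_circle assms(2)] assms(3)] assms(1)
  by (simp add: CT_def)

lemma Gamma1_twisted_comm:
  assumes \<phi>: "\<phi> \<in> Gamma1 q \<gamma>"
  shows "bounded_op (hinner2 q 1) (Hsp q 1 \<times> Hsp q 1) (Dom q \<times> Dom q) (twisted_comm q \<gamma> c \<phi>)"
proof -
  have T: "\<phi> \<in> tensor (F1D q) C1S" and EF: "lmul_bounded q (Eop q \<gamma> \<phi>)" "lmul_bounded q (Fop q \<gamma> \<phi>)"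
    using \<phi> by (auto simp: Gamma1_def)
  let ?Y = "\<lambda>t. ypow q (-2) \<odot> ddt \<phi> t"
  note X = ubanded_ops[OF T] ubanded_angular[OF T EF]
  let ?em = "\<lambda>t. exp (- \<i> * complex_of_real t)" and ?ep = "\<lambda>t. exp (\<i> * complex_of_real t)"
  define CH where "CH \<psi> = (\<lambda>t. complex_of_real q \<cdot> (dz q (\<phi> t) \<odot> \<psi> t \<odot> zop q)) + (\<lambda>t. (-1) \<cdot> (dzbar q (\<phi> t) \<odot> \<psi> t \<odot> zstar q))
      + (\<lambda>t. \<i> \<cdot> (?Y t \<odot> \<psi> t \<odot> ypow q 2))" for \<psi> :: matfun
  define CE where "CE \<psi> = (\<lambda>t. (- complex_of_real (1 / q) * ?em t) \<cdot> (dzbar q (\<phi> t) \<odot> \<psi> t \<odot> yop q))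
      + (\<lambda>t. (- (complex_of_real \<gamma> * ?em t * \<i>)) \<cdot> (?Y t \<odot> \<psi> t \<odot> yop q \<odot> zop q))" for \<psi> :: matfun
  define CF where "CF \<psi> = (\<lambda>t. (complex_of_real q * ?ep t) \<cdot> (dz q (\<phi> t) \<odot> \<psi> t \<odot> yop q))
      + (\<lambda>t. (- (complex_of_real \<gamma> * ?ep t * \<i>)) \<cdot> (?Y t \<odot> \<psi> t \<odot> yop q \<odot> zstar q))" for \<psi> :: matfun
  \<comment> \<open>The scalar -2 in D_1 does not commute away: \<phi> stands on one side and its
    twist on the other, which leaves -2 times their difference.\<close>
  define CP where "CP \<psi> = (\<lambda>t. (-2) \<cdot> lmul \<phi> \<psi> t) + (\<lambda>t. 2 \<cdot> lmul (sighat q 2 \<phi>) \<psi> t)" for \<psi> :: matfun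
  have u: "(\<lambda>t. a * ?em t) \<in> CT" "(\<lambda>t. a * ?ep t) \<in> CT" "(\<lambda>t. - (a * ?em t * b)) \<in> CT" "(\<lambda>t. - (a * ?ep t * b)) \<in> CT"
    "(\<lambda>t :: real. a) \<in> CT" for a b
    by (auto simp: CT_def intro!: continuous_intros)
  have cu: "cmod (a * ?em t) \<le> cmod a" "cmod (a * ?ep t) \<le> cmod a" "cmod (- (a * ?em t * b)) \<le> cmod a * cmod b"
    "cmod (- (a * ?ep t * b)) \<le> cmod a * cmod b" for a b t
    by (simp_all add: norm_mult norm_exp_eq_Re)
  note yz = hbdd_comp[OF hbdd_rmul[OF q banded_zop bdd_zop[OF q]] hbdd_sandwich[OF X(5) banded_yop bdd_yop[OF q]]]
    hbdd_comp[OF hbdd_rmul[OF q banded_zstar bdd_zstar[OF q]] hbdd_sandwich[OF X(5) banded_yop bdd_yop[OF q]]]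
  have const: "hbdd q (\<lambda>\<psi> t. a \<cdot> T \<psi> t)" if "hbdd q T" for a T
    by (rule hbdd_scaled[OF u(5) order_refl that])
  have H: "hbdd q CH" unfolding CH_def
    by (intro hbdd_add[OF q(1)] const hbdd_sandwich[OF X(2) banded_zop bdd_zop[OF q]]
        hbdd_sandwich[OF X(3) banded_zstar bdd_zstar[OF q]] hbdd_sandwich[OF X(5) banded_ypow bdd_ypow2[OF q]])
  have E: "hbdd q CE" unfolding CE_def
    by (rule hbdd_add[OF q(1) hbdd_scaled[OF u(1) cu(1) hbdd_sandwich[OF X(3) banded_yop bdd_yop[OF q]]]
          hbdd_scaled[OF u(3) cu(3) yz(1)]])
  have F: "hbdd q CF" unfolding CF_def
    by (rule hbdd_add[OF q(1) hbdd_scaled[OF u(2) cu(2) hbdd_sandwich[OF X(2) banded_yop bdd_yop[OF q]]]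
          hbdd_scaled[OF u(4) cu(4) yz(2)]])
  have P: "hbdd q CP" unfolding CP_def
    by (intro hbdd_add[OF q(1)] const hbdd_lmul[OF q(1) X(1)] hbdd_lmul[OF q(1) X(4)])
  obtain K where K: "\<And>t. banded K (\<phi> t)" "\<And>t. banded K (ddt \<phi> t)"
    by (rule tensor_uniform_banded[OF T]; blast intro: F1D_banded that)
  \<comment> \<open>In the second diagonal block H changes sign but the scalar -2 does not, so the
    block is -\<open>CH\<close> + \<open>CP\<close>.\<close>
  show ?thesis
  proof (rule bounded_op_hinner2I[OF q, of _ "\<lambda>\<psi>. CH \<psi> + CP \<psi>" "\<lambda>\<psi> t. complex_of_real c \<cdot> CE \<psi> t"
        "\<lambda>\<psi> t. complex_of_real c \<cdot> CF \<psi> t" "\<lambda>\<psi>. (\<lambda>t. (-1) \<cdot> CH \<psi> t) + CP \<psi>"])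
    show "Dom q \<times> Dom q \<subseteq> Hsp q 1 \<times> Hsp q 1" using Dom_Hsp[OF q] by blast
  next
    fix \<psi>1 \<psi>2 assume "(\<psi>1, \<psi>2) \<in> Dom q \<times> Dom q"
    then have D: "\<psi>1 \<in> tensor (D0 q) C1S" "\<psi>2 \<in> tensor (D0 q) C1S" by (auto simp: Dom_def)
    have ops: "Hop q (lmul \<phi> \<psi>) t = CH \<psi> t + sig q 2 (\<phi> t) \<odot> Hop q \<psi> t"
      "Eop q \<gamma> (lmul \<phi> \<psi>) t = CE \<psi> t + sig q 2 (\<phi> t) \<odot> Eop q \<gamma> \<psi> t"
      "Fop q \<gamma> (lmul \<phi> \<psi>) t = CF \<psi> t + sig q 2 (\<phi> t) \<odot> Fop q \<gamma> \<psi> t"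
      if \<psi>: "\<psi> \<in> tensor (D0 q) C1S" for \<psi> t
    proof -
      obtain L where L: "\<And>t. banded L (\<psi> t)" "\<And>t. banded L (ddt \<psi> t)"
        by (rule tensor_uniform_banded[OF \<psi>]; blast intro: F1D_banded D0_F1D that)
      have d: "ddt (lmul \<phi> \<psi>) = lmul (ddt \<phi>) \<psi> + lmul \<phi> (ddt \<psi>)"
        by (rule ddt_lmul[OF T \<psi>]) (rule F1D_banded)
      show "Hop q (lmul \<phi> \<psi>) t = CH \<psi> t + sig q 2 (\<phi> t) \<odot> Hop q \<psi> t"
        unfolding Hop_lmul[OF q(1) K L d] CH_def by (simp add: minus_eq_msc[symmetric])
      show "Eop q \<gamma> (lmul \<phi> \<psi>) t = CE \<psi> t + sig q 2 (\<phi> t) \<odot> Eop q \<gamma> \<psi> t"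
        unfolding Eop_lmul[OF q(1) K L d] CE_def by (simp add: msc_def fun_eq_iff)
      show "Fop q \<gamma> (lmul \<phi> \<psi>) t = CF \<psi> t + sig q 2 (\<phi> t) \<odot> Fop q \<gamma> \<psi> t"
        unfolding Fop_lmul[OF q(1) K L d] CF_def by (simp add: msc_def fun_eq_iff)
    qed
    note S = mmul_add_right[OF banded_sig[OF K(1)]] mmul_diff_right[OF banded_sig[OF K(1)]] mmul_msc_right
    have neg: "sig q 2 (\<phi> t) \<odot> (- W) = - (sig q 2 (\<phi> t) \<odot> W)" for t W
      by (simp add: minus_eq_msc mmul_msc_right)
    show "twisted_comm q \<gamma> c \<phi> (\<psi>1, \<psi>2) = (CH \<psi>1 + CP \<psi>1 + (\<lambda>t. complex_of_real c \<cdot> CE \<psi>2 t),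
        (\<lambda>t. complex_of_real c \<cdot> CF \<psi>1 t) + ((\<lambda>t. (-1) \<cdot> CH \<psi>2 t) + CP \<psi>2))"
    proof -
      have 1: "(Hop q (lmul \<phi> \<psi>1) t - 2 \<cdot> lmul \<phi> \<psi>1 t) + complex_of_real c \<cdot> Eop q \<gamma> (lmul \<phi> \<psi>2) t
          - sig q 2 (\<phi> t) \<odot> ((Hop q \<psi>1 t - 2 \<cdot> \<psi>1 t) + complex_of_real c \<cdot> Eop q \<gamma> \<psi>2 t)
         = CH \<psi>1 t + CP \<psi>1 t + complex_of_real c \<cdot> CE \<psi>2 t" for t
        unfolding ops(1)[OF D(1)] ops(2)[OF D(2)] S
        by (simp add: CP_def lmul_def sighat_def msc_def fun_eq_iff algebra_simps)
      have 2: "complex_of_real c \<cdot> Fop q \<gamma> (lmul \<phi> \<psi>1) t + (- Hop q (lmul \<phi> \<psi>2) t - 2 \<cdot> lmul \<phi> \<psi>2 t)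
          - sig q 2 (\<phi> t) \<odot> (complex_of_real c \<cdot> Fop q \<gamma> \<psi>1 t + (- Hop q \<psi>2 t - 2 \<cdot> \<psi>2 t))
         = complex_of_real c \<cdot> CF \<psi>1 t + ((-1) \<cdot> CH \<psi>2 t + CP \<psi>2 t)" for t
        unfolding ops(3)[OF D(1)] ops(1)[OF D(2)] S neg
        by (simp add: CP_def lmul_def sighat_def msc_def fun_eq_iff algebra_simps)
      show ?thesis
        using 1 2 by (simp add: twisted_comm_def D1_def pi_rep_def sighat_def fun_eq_iff lmul_def)
    qed
  qed (intro hbdd_add[OF q(1)] H P const E F)+
qed

lemma Gamma1_pi_bounded:
  assumes \<phi>: "\<phi> \<in> Gamma1 q \<gamma>"
  shows "bounded_op (hinner2 q 1) (Hsp q 1 \<times> Hsp q 1) (Hsp q 1 \<times> Hsp q 1) (pi_rep \<phi>)"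
proof (rule bounded_op_hinner2I[OF q order_refl, of "lmul \<phi>" "\<lambda>\<psi> t. 0 \<cdot> \<psi> t" "\<lambda>\<psi> t. 0 \<cdot> \<psi> t" "lmul \<phi>"])
  have T: "\<phi> \<in> tensor (F1D q) C1S" using \<phi> by (auto simp: Gamma1_def)
  show "hbdd q (lmul \<phi>)" "hbdd q (lmul \<phi>)" by (rule hbdd_lmul[OF q(1) ubanded_ops(1)[OF T]])+
  show "hbdd q (\<lambda>\<psi> t. 0 \<cdot> \<psi> t)" "hbdd q (\<lambda>\<psi> t. 0 \<cdot> \<psi> t)"
    by (rule hbdd_scale[of _ 0]; simp)+
  show "pi_rep \<phi> (\<psi>, \<eta>) = (lmul \<phi> \<psi> + (\<lambda>t. 0 \<cdot> \<eta> t), (\<lambda>t. 0 \<cdot> \<psi> t) + lmul \<phi> \<eta>)" for \<psi> \<eta>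
    by (simp add: pi_rep_def msc_def fun_eq_iff)
qed

lemma Gamma1_pi_Dom:
  assumes \<phi>: "\<phi> \<in> Gamma1 q \<gamma>"
  shows "pi_rep \<phi> ` (Dom q \<times> Dom q) \<subseteq> Dom q \<times> Dom q"
proof -
  have T: "\<phi> \<in> tensor (F1D q) C1S" using \<phi> by (auto simp: Gamma1_def)
  have "lmul \<phi> \<psi> \<in> Dom q" if "\<psi> \<in> Dom q" for \<psi>
    using that unfolding Dom_def
    by (rule tensor_lmul[OF T]) (auto intro: F1D_banded D0_F1D D0_mmul[OF q] C1S_mult)
  then show ?thesis by (auto simp: pi_rep_def)
qed

end

text \<open>The second and third conjuncts justify the last one: \<pi>(\<phi>) is a bounded operator
  on the whole space, and it maps the domain of D_1 into itself, so that D_1 \<pi>(\<phi>) is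
  defined there.\<close>

theorem theorem7p2:
  fixes q \<gamma> c :: real
  assumes "0 < q" and "q < 1" and "\<gamma> \<noteq> 0"
  shows "symmetric_op (hinner2 q 1) (Hsp q 1 \<times> Hsp q 1) (Dom q \<times> Dom q) (D1 q \<gamma> c)
       \<and> (\<forall>\<phi>\<in>Gamma1 q \<gamma>.
            bounded_op (hinner2 q 1) (Hsp q 1 \<times> Hsp q 1) (Hsp q 1 \<times> Hsp q 1) (pi_rep \<phi>)
          \<and> pi_rep \<phi> ` (Dom q \<times> Dom q) \<subseteq> Dom q \<times> Dom q
          \<and> bounded_op (hinner2 q 1) (Hsp q 1 \<times> Hsp q 1) (Dom q \<times> Dom q)
              (twisted_comm q \<gamma> c \<phi>))"
  using D1_symmetric_op[OF assms(1,2)] Gamma1_pi_bounded[OF assms] Gamma1_pi_Dom[OF assms]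
    Gamma1_twisted_comm[OF assms] by blast

end
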